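(* Consider the bilevel problem $\min_{x}\Phi(x)=f(x,y^*(x))$, $y^*(x)=\arg\min_y g(x,y)$, and suppose Assumptions A1, A2, A3, A4 of the context hold. Fix positive integers $T$ and $J$. Run ALS-SPIDER (the algorithm of the context with $\tau^x=\tau^y=\tau^v=0$) with $S_2=q_1$, $0<\beta<1$, $0<\eta<1$, and put $r=S_2/q_1$, $C_3=J^2+J^2M^2+2T^2$. Choose $$\lambda_1=\min\Big\{\tfrac{1}{2L_g+2\mu},\ \tfrac{(1/2)^{2T+5}\mu r}{T L_g^2\beta^2C_3}\Big\},\qquad \lambda_2=\min\Big\{\tfrac{1}{2L_g+2\mu},\ \tfrac{\mu^2\lambda_1\beta}{128\bar M_1J\eta},\ \tfrac{(1/2)^{2(T+J)+6}\mu r}{J(L_g^2\eta^2+T\bar M_1\beta\eta)}\Big\},$$ $$\alpha=\min\Big\{\tfrac{\mu\lambda_1\beta}{96C_y^2+8\bar M_1},\ \tfrac{\mu\lambda_2\eta}{48(L_g^2+C_v^2)},\ \tfrac{1}{6L_\Phi},\ \tfrac{\sqrt r}{12\sqrt{\bar M_1}},\ \tfrac{\mu}{C_4},\ \tfrac{\mu}{C_5},\ \tfrac{(1/2)^{2(T+J)+3}r}{\bar M_1T\beta+L_g^2\eta}\Big\},$$ where $C_4=192\lambda_1\beta L_g^2(1+r^{-1}C_3)$ and $C_5=192\lambda_2\eta\bar M_1(1+C_y^2+r^{-1}J)$. Then $$\frac1K\sum_{k=0}^{K-1}\mathbb{E}\|\nabla\Phi(x_k)\|^2\le O\Big(\frac1K+\frac1{S_1}\Big),$$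 where the implied constant does not depend on $K$, $S_1$ or $q_1=S_2$ (it may depend on $T$, $J$, $\beta$, $\eta$, the initial point and the constants in the assumptions).
   Context: Problem. $f(x,y)=\mathbb{E}_\xi[F(x,y;\xi)]$ and $g(x,y)=\mathbb{E}_\zeta[G(x,y;\zeta)]$ for $x\in\mathbb{R}^p$, $y\in\mathbb{R}^q$; $y^*(x)=\arg\min_{y\in\mathbb{R}^q}g(x,y)$; $\Phi(x)=f(x,y^*(x))$. $\|\cdot\|$ is the Euclidean norm for vectors and the spectral norm for matrices. $\nabla_x\nabla_y g$ is the Jacobian of $\nabla_x g$ with respect to $y$, $\nabla_y^2 g$ the Hessian in $y$. Assumption A1. For every $\xi,\zeta$: $f$, $F(\cdot,\cdot;\xi)$ are continuously differentiable and $g$, $G(\cdot,\cdot;\zeta)$ twice continuously differentiable on $\mathbb{R}^p\times\mathbb{R}^q$; for every $x,\zeta$, $g(x,\cdot)$ and $G(x,\cdot;\zeta)$ are $\mu$-strongly convex ($\mu>0$); $\Phi$ is nonconvex and $\inf_x\Phi(x)>-\infty$. Assumption A2. (a) $f$ and $\nabla f$ are Lipschitz in $(x,y)$ with constants $C_f$ and $L_f$. (b) $\nabla g$, $\nabla_x\nabla_yg$, $\nabla_y^2g$ are Lipschitz in $(x,y)$ with constants $L_g$, $L_{gxy}$, $L_{gyy}$. Assumption A3. $\nabla F(x,y;\xi)$, $\nabla G(x,y;\zeta)$, $\nabla_x\nabla_yG(x,y;\zeta)$, $\nabla_y^2G(x,y;\zeta)$ are unbiased estimates of $\nabla f$, $\nabla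 g$, $\nabla_x\nabla_yg$, $\nabla_y^2g$ at $(x,y)$, and $\mathbb{E}\|\nabla F-\nabla f\|^2\le\sigma_f^2$, $\mathbb{E}\|\nabla G-\nabla g\|^2\le\sigma_g^2$, $\mathbb{E}\|\nabla_x\nabla_yG-\nabla_x\nabla_yg\|^2\le\sigma_{gxy}^2$, $\mathbb{E}\|\nabla_y^2G-\nabla_y^2g\|^2\le\sigma_{gyy}^2$ for all $(x,y)$. Assumption A4. For all $\xi,\zeta$, $F(\cdot,\cdot;\xi)$ and $G(\cdot,\cdot;\zeta)$ satisfy the same conditions as $f$ and $g$ in A2 (same constants). Constants. $M\ge C_f/\mu$ is fixed, $\Omega=\{v\in\mathbb{R}^q:\|v\|\le M\}$, $L_{gg}=\max\{L_{gxy},L_{gyy}\}$, $\bar M_1=4L_f^2+4M^2L_{gg}^2$, $C_y=L_g/\mu$, $C_v=\big(\frac{L_f}{\mu}+\frac{C_fL_{gg}}{\mu^2}\big)\big(1+\frac{L_g}{\mu}\big)$, and $L_\Phi=L_f+\frac{2L_fL_g+C_fL_{gg}}{\mu}+\frac{L_fL_g^2+2C_fL_gL_{gg}}{\mu^2}+\frac{C_fL_g^2L_{gg}}{\mu^3}$ (a Lipschitz constant of $\nabla\Phi$). Directions. $D_y(x,y)=\nabla_yg(x,y)$, $D_v(x,y,v)=\nabla_y^2g(x,y)v-\nabla_yf(x,y)$, $D_x(x,y,v)=\nabla_xf(x,y)-\nabla_x\nabla_yg(x,y)v$. A single-sample version replaces $f,g$ by $F(\cdot;\xi_i),G(\cdot;\zeta_i)$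 with $\xi_i,\zeta_i$ fresh samples of $\xi,\zeta$ (for $D_y$ only $\zeta_i$); for a sample set $\mathcal S$, $D_\bullet(\cdot;\mathcal S)$ is the average of the single-sample versions over $\mathcal S$. Algorithm (parameters: positive integers $K,T,J,q_1,S_1,S_2$; stepsizes $\lambda_1,\lambda_2,\alpha,\beta,\eta>0$; $\tau^x,\tau^y,\tau^v$; initial $x_0\in\mathbb{R}^p$, $y_0\in\mathbb{R}^q$, $v_0\in\Omega$). All sample sets drawn are fresh and consist of mutually independent samples, and sets drawn are mutually independent. For $k=0,\dots,K-1$: 1. If $k\equiv0\pmod{q_1}$, draw sample sets $\mathcal S_{1,x},\mathcal S_{1,y},\mathcal S_{1,v}$ of size $S_1$ and set $D_k^x=D_x(x_k,y_k,v_k;\mathcal S_{1,x})$, $D_k^y=D_y(x_k,y_k;\mathcal S_{1,y})$, $D_k^v=D_v(x_k,y_k,v_k;\mathcal S_{1,v})$. Otherwise set $D_k^x=D_{k-1,J-1}^x$, $D_k^y=D_{k-1,T-1}^y$, $D_k^v=D_{k-1,J-1}^v$. 2. $x_{k+1}=x_k-\alpha D_k^x$. 3. Put $\bar x_{k,-1}=x_k$, $\bar y_{k,-1}=y_k$, $D_{k,-1}^y=D_k^y$, and $\bar x_{k,t}=x_{k+1}$ for $t\ge0$. For $t=0,\dots,T-1$: $\bar y_{k,t}=\bar y_{k,t-1}-\lambda_1\beta D_{k,t-1}^y$; draw a sample set $\mathcal S_{2,y}$ of size $S_2$; $D_{k,t}^y=D_y(\bar x_{k,t},\bar y_{k,t};\mathcal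 S_{2,y})+(1-\tau^y)\big(D_{k,t-1}^y-D_y(\bar x_{k,t-1},\bar y_{k,t-1};\mathcal S_{2,y})\big)$. Set $y_{k+1}=\bar y_{k,T-1}$. 4. Put $(x_{k,-1},y_{k,-1},v_{k,-1})=(x_k,y_k,v_k)$, $D_{k,-1}^x=D_k^x$, $D_{k,-1}^v=D_k^v$, and $x_{k,j}=x_{k+1}$, $y_{k,j}=y_{k+1}$ for $j\ge0$. For $j=0,\dots,J-1$: $v_{k,j}=\mathrm{proj}_\Omega(v_{k,j-1}-\lambda_2\eta D_{k,j-1}^v)$ (Euclidean projection); draw sample sets $\mathcal S_{2,x},\mathcal S_{2,v}$ of size $S_2$; with $u_{k,j}=(x_{k,j},y_{k,j},v_{k,j})$, $D_{k,j}^x=D_x(u_{k,j};\mathcal S_{2,x})+(1-\tau^x)\big(D_{k,j-1}^x-D_x(u_{k,j-1};\mathcal S_{2,x})\big)$ and $D_{k,j}^v=D_v(u_{k,j};\mathcal S_{2,v})+(1-\tau^v)\big(D_{k,j-1}^v-D_v(u_{k,j-1};\mathcal S_{2,v})\big)$. Set $v_{k+1}=v_{k,J-1}$. *)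

theory Defs
  imports "HOL-Probability.Probability"
begin

text \<open>
  Functions of the two variables $x$, $y$ are functions on the product space
  \<^typ>\<open>(real ^ 'p) \<times> (real ^ 'q)\<close>, whose norm and inner product are the Euclidean ones;
  \<^term>\<open>grad\<close> is therefore the full gradient when applied to such a function.
\<close>

definition grad :: "('a::real_inner \<Rightarrow> real) \<Rightarrow> 'a \<Rightarrow> 'a" where
  "grad h z = (THE d. GDERIV h z :> d)"

definition grad_x :: "((real ^ 'p) \<times> (real ^ 'q) \<Rightarrow> real) \<Rightarrow> (real ^ 'p) \<times> (real ^ 'q) \<Rightarrow> real ^ 'p" where
  "grad_x h z = grad (\<lambda>x. h (x, snd z)) (fst z)"

definition grad_y :: "((real ^ 'p) \<times> (real ^ 'q) \<Rightarrow> real) \<Rightarrow> (real ^ 'p) \<times> (real ^ 'q) \<Rightarrow> real ^ 'q" where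
  "grad_y h z = grad (\<lambda>y. h (fst z, y)) (snd z)"

definition hess_xy :: "((real ^ 'p) \<times> (real ^ 'q) \<Rightarrow> real) \<Rightarrow> (real ^ 'p) \<times> (real ^ 'q) \<Rightarrow> real ^ 'q ^ 'p" where
  "hess_xy h z = jacobian (\<lambda>y. grad_x h (fst z, y)) (at (snd z))"

definition hess_yy :: "((real ^ 'p) \<times> (real ^ 'q) \<Rightarrow> real) \<Rightarrow> (real ^ 'p) \<times> (real ^ 'q) \<Rightarrow> real ^ 'q ^ 'q" where
  "hess_yy h z = jacobian (\<lambda>y. grad_y h (fst z, y)) (at (snd z))"

text \<open>The norm of the type \<^typ>\<open>real ^ 'n ^ 'm\<close> is the Frobenius norm, so the spectral norm is separate.\<close>

definition spectral_norm :: "real ^ 'n ^ 'm \<Rightarrow> real" where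
  "spectral_norm A = onorm ((*v) A)"

definition spectral_lipschitz :: "real \<Rightarrow> ('a::real_normed_vector \<Rightarrow> real ^ 'n ^ 'm) \<Rightarrow> bool" where
  "spectral_lipschitz L A \<longleftrightarrow> (\<forall>z z'. spectral_norm (A z - A z') \<le> L * norm (z - z'))"

definition C1 :: "('a::real_normed_vector \<Rightarrow> 'b::real_normed_vector) \<Rightarrow> bool" where
  "C1 h \<longleftrightarrow> (\<exists>h' :: 'a \<Rightarrow> 'a \<Rightarrow>\<^sub>L 'b.
     (\<forall>z. (h has_derivative blinfun_apply (h' z)) (at z)) \<and> continuous_on UNIV h')"

definition C2 :: "('a::real_inner \<Rightarrow> real) \<Rightarrow> bool" where
  "C2 h \<longleftrightarrow> C1 h \<and> C1 (grad h)"

definition strongly_convex :: "real \<Rightarrow> ('a::real_inner \<Rightarrow> real) \<Rightarrow> bool" where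
  "strongly_convex \<mu> h \<longleftrightarrow> (\<forall>u v t. 0 \<le> t \<and> t \<le> 1 \<longrightarrow>
     h ((1 - t) *\<^sub>R u + t *\<^sub>R v)
       \<le> (1 - t) * h u + t * h v - \<mu> / 2 * t * (1 - t) * (norm (u - v))\<^sup>2)"

definition lower_solution :: "((real ^ 'p) \<times> (real ^ 'q) \<Rightarrow> real) \<Rightarrow> real ^ 'p \<Rightarrow> real ^ 'q" where
  "lower_solution g x = arg_min (\<lambda>y. g (x, y)) (\<lambda>_. True)"

definition hyperobjective ::
    "((real ^ 'p) \<times> (real ^ 'q) \<Rightarrow> real) \<Rightarrow> ((real ^ 'p) \<times> (real ^ 'q) \<Rightarrow> real) \<Rightarrow> real ^ 'p \<Rightarrow> real" where
  "hyperobjective f g x = f (x, lower_solution g x)"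

definition smooth_pair ::
    "real \<Rightarrow> ((real ^ 'p) \<times> (real ^ 'q) \<Rightarrow> real) \<Rightarrow> ((real ^ 'p) \<times> (real ^ 'q) \<Rightarrow> real) \<Rightarrow> bool" where
  "smooth_pair \<mu> f g \<longleftrightarrow> C1 f \<and> C2 g \<and> (\<forall>x. strongly_convex \<mu> (\<lambda>y. g (x, y)))"

definition lipschitz_pair ::
    "real \<Rightarrow> real \<Rightarrow> real \<Rightarrow> real \<Rightarrow> real \<Rightarrow>
     ((real ^ 'p) \<times> (real ^ 'q) \<Rightarrow> real) \<Rightarrow> ((real ^ 'p) \<times> (real ^ 'q) \<Rightarrow> real) \<Rightarrow> bool" where
  "lipschitz_pair Cf Lf Lg Lgxy Lgyy f g \<longleftrightarrow>
     Cf-lipschitz_on UNIV f \<and> Lf-lipschitz_on UNIV (grad f) \<and>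
     Lg-lipschitz_on UNIV (grad g) \<and>
     spectral_lipschitz Lgxy (hess_xy g) \<and> spectral_lipschitz Lgyy (hess_yy g)"

text \<open>
  \<open>nrm\<close> is the norm in which the variance is measured (Euclidean or spectral). Integrability is
  explicit because the Bochner integral of a non-integrable function is 0.
\<close>

definition unbiased_estimate ::
    "'s measure \<Rightarrow> ('e \<Rightarrow> real) \<Rightarrow> real \<Rightarrow> ('s \<Rightarrow> 'e) \<Rightarrow> 'e::{banach, second_countable_topology} \<Rightarrow> bool" where
  "unbiased_estimate D nrm \<sigma> H m \<longleftrightarrow>
     integrable D H \<and> (\<integral>\<xi>. H \<xi> \<partial>D) = m \<and>
     integrable D (\<lambda>\<xi>. (nrm (H \<xi> - m))\<^sup>2) \<and> (\<integral>\<xi>. (nrm (H \<xi> - m))\<^sup>2 \<partial>D) \<le> \<sigma>\<^sup>2"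

definition dir_y :: "((real ^ 'p) \<times> (real ^ 'q) \<Rightarrow> real) \<Rightarrow> (real ^ 'p) \<times> (real ^ 'q) \<Rightarrow> real ^ 'q" where
  "dir_y g z = grad_y g z"

definition dir_v ::
    "((real ^ 'p) \<times> (real ^ 'q) \<Rightarrow> real) \<Rightarrow> ((real ^ 'p) \<times> (real ^ 'q) \<Rightarrow> real) \<Rightarrow>
     (real ^ 'p) \<times> (real ^ 'q) \<Rightarrow> real ^ 'q \<Rightarrow> real ^ 'q" where
  "dir_v f g z v = hess_yy g z *v v - grad_y f z"

definition dir_x ::
    "((real ^ 'p) \<times> (real ^ 'q) \<Rightarrow> real) \<Rightarrow> ((real ^ 'p) \<times> (real ^ 'q) \<Rightarrow> real) \<Rightarrow>
     (real ^ 'p) \<times> (real ^ 'q) \<Rightarrow> real ^ 'q \<Rightarrow> real ^ 'p" where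
  "dir_x f g z v = grad_x f z - hess_xy g z *v v"

text \<open>
  \<open>Outer d k\<close> names the sample set of size $S_1$ drawn for direction \<open>d\<close> at a refresh in
  iteration \<open>k\<close>; \<open>Inner d k t\<close> names the set of size $S_2$ drawn in step \<open>t\<close> of its inner loop.
  The \<open>i\<close>-th member of a set is a pair $(\xi_i, \zeta_i)$; sets for the $y$-direction use only
  the second component.
\<close>

datatype direction = X_dir | Y_dir | V_dir

datatype sample_set = Outer direction nat | Inner direction nat nat

definition drawn :: "nat \<Rightarrow> nat \<Rightarrow> nat \<Rightarrow> nat \<Rightarrow> nat \<Rightarrow> nat \<Rightarrow> (sample_set \<times> nat) set" where
  "drawn K T J q1 S1 S2 =
     {(Outer d k, i) | d k i. k < K \<and> k mod q1 = 0 \<and> i < S1} \<union>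
     {(Inner Y_dir k t, i) | k t i. k < K \<and> t < T \<and> i < S2} \<union>
     {(Inner d k j, i) | d k j i. d \<in> {X_dir, V_dir} \<and> k < K \<and> j < J \<and> i < S2}"

definition iid_samples ::
    "'s measure \<Rightarrow> 'u measure \<Rightarrow> 'w measure \<Rightarrow> (sample_set \<times> nat) set \<Rightarrow>
     (sample_set \<times> nat \<Rightarrow> 's \<Rightarrow> 'u \<times> 'w) \<Rightarrow> bool" where
  "iid_samples P D\<^sub>\<xi> D\<^sub>\<zeta> I smp \<longleftrightarrow>
     prob_space P \<and>
     prob_space.indep_vars P (\<lambda>_. D\<^sub>\<xi> \<Otimes>\<^sub>M D\<^sub>\<zeta>) smp I \<and>
     (\<forall>i\<in>I. distr P (D\<^sub>\<xi> \<Otimes>\<^sub>M D\<^sub>\<zeta>) (smp i) = D\<^sub>\<xi> \<Otimes>\<^sub>M D\<^sub>\<zeta>)"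

definition batch_avg :: "nat \<Rightarrow> ('u \<times> 'w \<Rightarrow> 'e::real_vector) \<Rightarrow> (nat \<Rightarrow> 'u \<times> 'w) \<Rightarrow> 'e" where
  "batch_avg n h s = (\<Sum>i<n. h (s i)) /\<^sub>R real n"

record als_params =
  als_T :: nat
  als_J :: nat
  als_q1 :: nat
  als_S1 :: nat
  als_S2 :: nat
  als_lam1 :: real
  als_lam2 :: real
  als_alpha :: real
  als_beta :: real
  als_eta :: real
  als_tau_x :: real
  als_tau_y :: real
  als_tau_v :: real
  als_M :: real

text \<open>
  In the remaining definitions \<open>s\<close> is a realisation of all sample sets.

  \<open>y_loop \<dots> n\<close> is $(\bar y_{k,n-1}, D^y_{k,n-1})$ and \<open>v_loop \<dots> n\<close> is
  $(v_{k,n-1}, D^x_{k,n-1}, D^v_{k,n-1})$: the indices are shifted by one so that the initial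
  index $-1$ becomes 0. The unprimed \<open>x\<close>, \<open>y\<close>, \<open>v\<close> are the iterates of index $k$, the primed
  ones those of index $k + 1$; the point of index $-1$ in a loop has the unprimed ones.
\<close>

primrec y_loop ::
    "als_params \<Rightarrow> ('w \<Rightarrow> (real ^ 'p) \<times> (real ^ 'q) \<Rightarrow> real) \<Rightarrow> (sample_set \<Rightarrow> nat \<Rightarrow> 'u \<times> 'w) \<Rightarrow> nat \<Rightarrow>
     real ^ 'p \<Rightarrow> real ^ 'p \<Rightarrow> real ^ 'q \<Rightarrow> real ^ 'q \<Rightarrow> nat \<Rightarrow> (real ^ 'q) \<times> (real ^ 'q)" where
  "y_loop p G s k x x' y Dy 0 = (y, Dy)"
| "y_loop p G s k x x' y Dy (Suc t) =
     (let (y\<^sub>o, D\<^sub>o) = y_loop p G s k x x' y Dy t;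
          x\<^sub>o = (if t = 0 then x else x');
          y\<^sub>n = y\<^sub>o - (als_lam1 p * als_beta p) *\<^sub>R D\<^sub>o;
          B = (\<lambda>z. batch_avg (als_S2 p) (\<lambda>(\<xi>, \<zeta>). dir_y (G \<zeta>) z) (s (Inner Y_dir k t)))
      in (y\<^sub>n, B (x', y\<^sub>n) + (1 - als_tau_y p) *\<^sub>R (D\<^sub>o - B (x\<^sub>o, y\<^sub>o))))"

primrec v_loop ::
    "als_params \<Rightarrow> ('u \<Rightarrow> (real ^ 'p) \<times> (real ^ 'q) \<Rightarrow> real) \<Rightarrow> ('w \<Rightarrow> (real ^ 'p) \<times> (real ^ 'q) \<Rightarrow> real) \<Rightarrow>
     (sample_set \<Rightarrow> nat \<Rightarrow> 'u \<times> 'w) \<Rightarrow> nat \<Rightarrow>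
     (real ^ 'p) \<times> (real ^ 'q) \<Rightarrow> (real ^ 'p) \<times> (real ^ 'q) \<Rightarrow>
     real ^ 'q \<Rightarrow> real ^ 'p \<Rightarrow> real ^ 'q \<Rightarrow> nat \<Rightarrow> (real ^ 'q) \<times> (real ^ 'p) \<times> (real ^ 'q)" where
  "v_loop p F G s k z z' v Dx Dv 0 = (v, Dx, Dv)"
| "v_loop p F G s k z z' v Dx Dv (Suc j) =
     (let (v\<^sub>o, Dx\<^sub>o, Dv\<^sub>o) = v_loop p F G s k z z' v Dx Dv j;
          z\<^sub>o = (if j = 0 then z else z');
          v\<^sub>n = closest_point (cball 0 (als_M p)) (v\<^sub>o - (als_lam2 p * als_eta p) *\<^sub>R Dv\<^sub>o);
          Bx = (\<lambda>z v. batch_avg (als_S2 p) (\<lambda>(\<xi>, \<zeta>). dir_x (F \<xi>) (G \<zeta>) z v) (s (Inner X_dir k j)));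
          Bv = (\<lambda>z v. batch_avg (als_S2 p) (\<lambda>(\<xi>, \<zeta>). dir_v (F \<xi>) (G \<zeta>) z v) (s (Inner V_dir k j)))
      in (v\<^sub>n,
          Bx z' v\<^sub>n + (1 - als_tau_x p) *\<^sub>R (Dx\<^sub>o - Bx z\<^sub>o v\<^sub>o),
          Bv z' v\<^sub>n + (1 - als_tau_v p) *\<^sub>R (Dv\<^sub>o - Bv z\<^sub>o v\<^sub>o)))"

text \<open>
  \<open>als_state \<dots> k\<close> is $(x_k, y_k, v_k)$ together with the estimates
  $D^x_{k-1,J-1}$, $D^y_{k-1,T-1}$, $D^v_{k-1,J-1}$ carried over from the previous iteration.
  For $k = 0$ the latter do not exist; the dummy value 0 is overwritten by the refresh.
\<close>

primrec als_state ::
    "als_params \<Rightarrow> ('u \<Rightarrow> (real ^ 'p) \<times> (real ^ 'q) \<Rightarrow> real) \<Rightarrow> ('w \<Rightarrow> (real ^ 'p) \<times> (real ^ 'q) \<Rightarrow> real) \<Rightarrow>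
     real ^ 'p \<Rightarrow> real ^ 'q \<Rightarrow> real ^ 'q \<Rightarrow> (sample_set \<Rightarrow> nat \<Rightarrow> 'u \<times> 'w) \<Rightarrow> nat \<Rightarrow>
     ((real ^ 'p) \<times> (real ^ 'q) \<times> (real ^ 'q)) \<times> ((real ^ 'p) \<times> (real ^ 'q) \<times> (real ^ 'q))" where
  "als_state p F G x0 y0 v0 s 0 = ((x0, y0, v0), (0, 0, 0))"
| "als_state p F G x0 y0 v0 s (Suc k) =
     (let ((x, y, v), (Ex, Ey, Ev)) = als_state p F G x0 y0 v0 s k;
          refresh = (k mod als_q1 p = 0);
          Dx = (if refresh
                then batch_avg (als_S1 p) (\<lambda>(\<xi>, \<zeta>). dir_x (F \<xi>) (G \<zeta>) (x, y) v) (s (Outer X_dir k))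
                else Ex);
          Dy = (if refresh
                then batch_avg (als_S1 p) (\<lambda>(\<xi>, \<zeta>). dir_y (G \<zeta>) (x, y)) (s (Outer Y_dir k))
                else Ey);
          Dv = (if refresh
                then batch_avg (als_S1 p) (\<lambda>(\<xi>, \<zeta>). dir_v (F \<xi>) (G \<zeta>) (x, y) v) (s (Outer V_dir k))
                else Ev);
          x' = x - als_alpha p *\<^sub>R Dx;
          (y', Dy') = y_loop p G s k x x' y Dy (als_T p);
          (v', Dx', Dv') = v_loop p F G s k (x, y) (x', y') v Dx Dv (als_J p)
      in ((x', y', v'), (Dx', Dy', Dv')))"

definition als_x ::
    "als_params \<Rightarrow> ('u \<Rightarrow> (real ^ 'p) \<times> (real ^ 'q) \<Rightarrow> real) \<Rightarrow> ('w \<Rightarrow> (real ^ 'p) \<times> (real ^ 'q) \<Rightarrow> real) \<Rightarrow>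
     real ^ 'p \<Rightarrow> real ^ 'q \<Rightarrow> real ^ 'q \<Rightarrow> (sample_set \<Rightarrow> nat \<Rightarrow> 'u \<times> 'w) \<Rightarrow> nat \<Rightarrow> real ^ 'p" where
  "als_x p F G x0 y0 v0 s k = fst (fst (als_state p F G x0 y0 v0 s k))"

end

theory Submission
  imports Defs
begin

text \<open>
  Write $y^*(x)$ for the lower-level solution and $v^*(x)$ for the solution of
  $\nabla_y^2 g\, v = \nabla_y f$ at $(x, y^*(x))$, so that $\nabla\Phi(x) = D_x(x, y^*(x), v^*(x))$.
  With $a = \lambda_1\beta$ and $b = \lambda_2\eta$, the Lyapunov function
  $\Phi(x) + \|y - y^*(x)\|^2 + \|v - v^*(x)\|^2$ decreases in each iteration by a multiple of
  $\alpha\|\nabla\Phi(x_k)\|^2$ and of the squared directions, up to the squared errors of the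
  direction estimates: cocoercivity of the lower-level gradient makes both inner loops contract and
  leaves a negative multiple of $\|D\|^2$.

  The errors are sums of martingale differences whose conditional variances are bounded by squared
  moves of the iterates, hence by squared directions. Because $S_2 = q_1$, summing these variances
  over a refresh period costs a factor $q_1 / S_2 = 1$, and the step-size conditions let the negative
  squared directions absorb them. What remains is the noise of the refreshes, of order $1 / S_1$ per
  iteration, and the initial value of the Lyapunov function, of order $1 / K$ on average.
\<close>

section \<open>Gradients and convexity\<close>

text \<open>Independence is exploited without conditional expectations: the pair formed by an
  outcome, seen only through the samples already drawn, and a fresh sample has a product law, so
  Fubini turns "centred for every frozen past" into orthogonality. What remains is to track which
  samples each quantity depends on; since x and y are not confined to a bounded set, square
  integrability is carried along with this dependence. In an inner loop only the first step is
  delicate: its direction was estimated at the old point, while its target has to be the solution at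
  the new one. This step pays for the shift of the target, a Lipschitz multiple of the move of x.
  The later steps have a fixed target, and their contraction can be given away. The projection has
  two uses. The ball contains v*, so projecting does not increase the distance to it; and
  boundedness of v makes D_x and D_v bounded, and Lipschitz with constants that do not grow along
  the run. With batch size and period equal, r is 1, so the step sizes depend on none of K, S1 and
  q1. This is why the constant is uniform.\<close>

lemma grad_eqI:
  assumes "GDERIV h z :> d"
  shows "grad h z = d"
  unfolding grad_def
proof (rule the_equality[where P = "\<lambda>d. GDERIV h z :> d", OF assms])
  fix d' assume "GDERIV h z :> d'"
  then have "(\<lambda>u. inner u d') = (\<lambda>u. inner u d)"
    using assms has_derivative_unique unfolding gderiv_def by blast
  then have "inner (d' - d) (d' - d) = 0"
    by (metis inner_diff_right right_minus_eq)
  then show "d' = d" by simp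
qed

text \<open>A real-valued bounded linear derivative is represented by a vector, namely its adjoint
  evaluated at 1: the Riesz representation in finite dimension.\<close>

lemma C1_gderiv:
  fixes h :: "'a::euclidean_space \<Rightarrow> real"
  assumes "C1 h"
  shows "GDERIV h z :> grad h z"
proof -
  obtain h' :: "'a \<Rightarrow> 'a \<Rightarrow>\<^sub>L real" where h': "(h has_derivative blinfun_apply (h' z)) (at z)"
    using assms unfolding C1_def by blast
  have "linear (blinfun_apply (h' z))"
    by (simp add: blinfun.bounded_linear_right bounded_linear.linear)
  then have "blinfun_apply (h' z) = (\<lambda>u. inner u (adjoint (blinfun_apply (h' z)) 1))"
    by (auto simp: adjoint_works)
  then have "GDERIV h z :> adjoint (blinfun_apply (h' z)) 1"
    using h' unfolding gderiv_def by metis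
  then show ?thesis using grad_eqI by metis
qed

text \<open>In this form inequalities between function or gradient values pass to the derivative:
  they are applied at a small step s, divided by a power of s, and taken to the limit.\<close>

lemma directional_derivative:
  fixes h :: "'a::real_normed_vector \<Rightarrow> 'b::real_normed_vector"
  assumes "(h has_derivative B) (at z)"
  shows "((\<lambda>s. (h (z + s *\<^sub>R u) - h z) /\<^sub>R s) \<longlongrightarrow> B u) (at 0)"
proof -
  have lin: "bounded_linear B" using assms has_derivative_bounded_linear by blast
  have "((\<lambda>s::real. h (z + s *\<^sub>R u)) has_derivative (\<lambda>s. B (s *\<^sub>R u))) (at 0)"
    by (rule has_derivative_compose[where g = h])
       (use assms in \<open>auto intro!: derivative_eq_intros\<close>)
  then have "((\<lambda>s::real. norm (h (z + s *\<^sub>R u) - h z - s *\<^sub>R B u) / norm s) \<longlongrightarrow> 0) (at 0)"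
    by (simp add: has_derivative_at linear_simps(5)[OF lin])
  moreover have "norm (h (z + s *\<^sub>R u) - h z - s *\<^sub>R B u) / norm s
      = norm ((h (z + s *\<^sub>R u) - h z) /\<^sub>R s - B u)" if "s \<noteq> 0" for s :: real
  proof -
    have "(h (z + s *\<^sub>R u) - h z) /\<^sub>R s - B u = (h (z + s *\<^sub>R u) - h z - s *\<^sub>R B u) /\<^sub>R s"
      using that by (simp add: scaleR_diff_right)
    then show ?thesis by (simp add: divide_inverse mult.commute)
  qed
  ultimately have "((\<lambda>s. norm ((h (z + s *\<^sub>R u) - h z) /\<^sub>R s - B u)) \<longlongrightarrow> 0) (at 0)"
    by (subst tendsto_cong[of _ "\<lambda>s. norm (h (z + s *\<^sub>R u) - h z - s *\<^sub>R B u) / norm s"])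
       (auto simp: eventually_at_filter)
  then show ?thesis
    using Lim_null tendsto_norm_zero_iff by blast
qed

lemma derivative_bound:
  fixes h :: "'a::real_normed_vector \<Rightarrow> 'b::real_normed_vector"
  assumes "(h has_derivative B) (at z)" and "\<And>u. norm (h (z + u) - h z) \<le> L * norm u"
  shows "norm (B u) \<le> L * norm u"
proof (rule tendsto_upperbound)
  show "((\<lambda>s. norm ((h (z + s *\<^sub>R u) - h z) /\<^sub>R s)) \<longlongrightarrow> norm (B u)) (at 0)"
    by (intro tendsto_norm directional_derivative assms)
  show "\<forall>\<^sub>F s in at 0. norm ((h (z + s *\<^sub>R u) - h z) /\<^sub>R s) \<le> L * norm u"
  proof -
    have "norm ((h (z + s *\<^sub>R u) - h z) /\<^sub>R s) \<le> L * norm u" if "s \<noteq> 0" for s :: real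
    proof -
      have "norm ((h (z + s *\<^sub>R u) - h z) /\<^sub>R s) \<le> (L * norm (s *\<^sub>R u)) / \<bar>s\<bar>"
        using assms(2)[of "s *\<^sub>R u"] that
        by (simp only: norm_scaleR divide_inverse mult.commute[of _ "inverse \<bar>s\<bar>"] abs_inverse)
           (intro mult_left_mono, auto)
      also have "\<dots> = L * norm u" using that by simp
      finally show ?thesis .
    qed
    then show ?thesis by (auto simp: eventually_at_filter)
  qed
qed auto

section \<open>First-order inequalities for strongly convex and for smooth functions\<close>

lemma strongly_convex_first_order:
  assumes "strongly_convex \<mu> h" and "GDERIV h u :> d"
  shows "h v \<ge> h u + inner d (v - u) + \<mu> / 2 * (norm (v - u))\<^sup>2"
proof -
  have "((\<lambda>s. (h (u + s *\<^sub>R (v - u)) - h u) /\<^sub>R s) \<longlongrightarrow> inner (v - u) d) (at_right 0)"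
    using assms(2) unfolding gderiv_def
    by (intro tendsto_mono[OF at_le directional_derivative]) auto
  moreover have "((\<lambda>s. h v - h u - \<mu> / 2 * (1 - s) * (norm (v - u))\<^sup>2)
      \<longlongrightarrow> h v - h u - \<mu> / 2 * (1 - 0) * (norm (v - u))\<^sup>2) (at_right 0)"
    by (intro tendsto_intros)
  moreover have "\<forall>\<^sub>F s in at_right 0. (h (u + s *\<^sub>R (v - u)) - h u) /\<^sub>R s
      \<le> h v - h u - \<mu> / 2 * (1 - s) * (norm (v - u))\<^sup>2"
  proof (rule eventually_at_rightI[of 0 1])
    fix s :: real assume "s \<in> {0<..<1}"
    then have s: "0 < s" "s < 1" by auto
    have "u + s *\<^sub>R (v - u) = (1 - s) *\<^sub>R u + s *\<^sub>R v" by (simp add: algebra_simps)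
    then have "h (u + s *\<^sub>R (v - u)) \<le> (1 - s) * h u + s * h v - \<mu> / 2 * s * (1 - s) * (norm (u - v))\<^sup>2"
      using assms(1) s unfolding strongly_convex_def by (metis less_eq_real_def)
    then show "(h (u + s *\<^sub>R (v - u)) - h u) /\<^sub>R s \<le> h v - h u - \<mu> / 2 * (1 - s) * (norm (v - u))\<^sup>2"
      using s by (simp add: field_simps norm_minus_commute)
  qed simp
  ultimately have "inner (v - u) d \<le> h v - h u - \<mu> / 2 * (1 - 0) * (norm (v - u))\<^sup>2"
    by (intro tendsto_le[OF trivial_limit_at_right_real])
  then show ?thesis by (simp add: inner_commute)
qed

lemma strongly_convex_strongly_monotone:
  assumes "strongly_convex \<mu> h" and "GDERIV h u :> d" and "GDERIV h v :> e"
  shows "inner (e - d) (v - u) \<ge> \<mu> * (norm (v - u))\<^sup>2"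
  using strongly_convex_first_order[OF assms(1,2), of v] strongly_convex_first_order[OF assms(1,3), of u]
  by (simp add: norm_minus_commute[of u v] inner_diff_left inner_diff_right)

lemma gderiv_along_line:
  assumes "\<And>z. GDERIV h z :> g z"
  shows "((\<lambda>t. h (p + t *\<^sub>R u)) has_real_derivative inner u (g (p + t *\<^sub>R u))) (at t)"
proof -
  have "((\<lambda>t. h (p + t *\<^sub>R u)) has_derivative (\<lambda>r. inner (r *\<^sub>R u) (g (p + t *\<^sub>R u)))) (at t)"
    by (rule has_derivative_compose[where g = h])
       (use assms[of "p + t *\<^sub>R u"] in \<open>auto intro!: derivative_eq_intros simp: gderiv_def\<close>)
  moreover have "(\<lambda>r. inner (r *\<^sub>R u) (g (p + t *\<^sub>R u))) = (*) (inner u (g (p + t *\<^sub>R u)))"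
    by auto
  ultimately show ?thesis by (simp add: has_field_derivative_def)
qed

text \<open>Along the segment from u to u + w, \<psi> subtracts the linear part and the quadratic
  bound from h. Cauchy-Schwarz and the Lipschitz bound make its derivative nonpositive on [0, 1], so
  comparing end points replaces an integral of the gradient.\<close>

lemma smooth_upper_bound:
  assumes g: "\<And>z. GDERIV h z :> g z" and L: "L-lipschitz_on UNIV g"
  shows "h (u + w) \<le> h u + inner (g u) w + L / 2 * (norm w)\<^sup>2"
proof -
  define \<psi> where "\<psi> t = h (u + t *\<^sub>R w) - t * inner (g u) w - L / 2 * t\<^sup>2 * (norm w)\<^sup>2" for t :: real
  have "\<psi> 1 \<le> \<psi> 0"
  proof (rule DERIV_nonpos_imp_nonincreasing[of 0 1 \<psi>])
    fix t :: real assume t: "0 \<le> t" "t \<le> 1"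
    have "(\<psi> has_real_derivative inner w (g (u + t *\<^sub>R w)) - inner (g u) w - L * t * (norm w)\<^sup>2) (at t)"
      unfolding \<psi>_def by (auto intro!: derivative_eq_intros gderiv_along_line[of h g] g)
    moreover have "inner w (g (u + t *\<^sub>R w)) - inner (g u) w - L * t * (norm w)\<^sup>2 \<le> 0"
    proof -
      have "inner w (g (u + t *\<^sub>R w)) - inner (g u) w = inner w (g (u + t *\<^sub>R w) - g u)"
        by (simp add: inner_diff_right inner_commute)
      also have "\<dots> \<le> norm w * norm (g (u + t *\<^sub>R w) - g u)" by (rule norm_cauchy_schwarz)
      also have "\<dots> \<le> norm w * (L * norm (t *\<^sub>R w))"
        using lipschitz_onD[OF L, of "u + t *\<^sub>R w" u] by (intro mult_left_mono) (auto simp: dist_norm)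
      finally show ?thesis using t by (simp add: power2_eq_square mult_ac)
    qed
    ultimately show "\<exists>y. (\<psi> has_real_derivative y) (at t) \<and> y \<le> 0" by blast
  qed simp
  then show ?thesis unfolding \<psi>_def by simp
qed

text \<open>The Baillon-Haddad inequality. The tangent of h at u, which lies below h, and the
  quadratic upper bound at v are compared at the point v - d / L, where d is the difference of the
  gradients; this point minimizes the bound minus the tangent. Adding the same inequality with u and
  v exchanged cancels the function values.\<close>

lemma cocoercive:
  assumes conv: "\<And>u v. h v \<ge> h u + inner (g u) (v - u)"
    and g: "\<And>z. GDERIV h z :> g z" and L: "L-lipschitz_on UNIV g" and "L > 0"
  shows "inner (g v - g u) (v - u) \<ge> (norm (g v - g u))\<^sup>2 / L"
proof -
  have half: "h v - h u - inner (g u) (v - u) \<ge> (norm (g v - g u))\<^sup>2 / (2 * L)" for u v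
  proof -
    define d where "d = g v - g u"
    have "h u + inner (g u) ((v + (- 1 / L) *\<^sub>R d) - u) \<le> h (v + (- 1 / L) *\<^sub>R d)" by (rule conv)
    also have "\<dots> \<le> h v + inner (g v) ((- 1 / L) *\<^sub>R d) + L / 2 * (norm ((- 1 / L) *\<^sub>R d))\<^sup>2"
      by (rule smooth_upper_bound[OF g L])
    also have "L / 2 * (norm ((- 1 / L) *\<^sub>R d))\<^sup>2 = (norm d)\<^sup>2 / (2 * L)"
      using \<open>L > 0\<close> by (simp add: power_divide power2_eq_square)
    finally have "inner (g u) (v - u) + h u - h v \<le> (norm d)\<^sup>2 / (2 * L) - (1 / L) * (inner (g v) d - inner (g u) d)"
      by (simp add: inner_diff_right inner_add_right diff_divide_distrib)
    also have "inner (g v) d - inner (g u) d = (norm d)\<^sup>2"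
      by (simp add: d_def power2_norm_eq_inner flip: inner_diff_left)
    finally show ?thesis by (simp add: d_def[symmetric])
  qed
  show ?thesis
    using half[of u v] half[of v u] \<open>L > 0\<close>
    by (simp add: norm_minus_commute[of "g u" "g v"] inner_diff_left inner_diff_right field_simps)
qed

lemma strongly_convex_minimizer:
  fixes h :: "'a::euclidean_space \<Rightarrow> real"
  assumes sc: "strongly_convex \<mu> h" and "\<mu> > 0" and g: "\<And>z. GDERIV h z :> g z"
  obtains y where "\<And>z. h y \<le> h z" and "g y = 0" and "\<And>z. h z \<le> h y \<Longrightarrow> z = y"
proof -
  \<comment> \<open>Outside the ball of radius R the quadratic term of the lower bound at 0
    dominates the linear one, so h is at least h 0 there and the minimum over the compact ball is
    global.\<close>
  define R where "R = 2 * norm (g 0) / \<mu>"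
  have "R \<ge> 0" using \<open>\<mu> > 0\<close> by (simp add: R_def)
  have "continuous_on (cball 0 R) h"
    by (meson g gderiv_def has_derivative_continuous continuous_at_imp_continuous_on)
  then obtain y where y: "y \<in> cball 0 R" "\<And>z. z \<in> cball 0 R \<Longrightarrow> h y \<le> h z"
    using continuous_attains_inf[of "cball 0 R" h] \<open>R \<ge> 0\<close> by auto
  have min: "h y \<le> h z" for z
  proof (cases "norm z \<le> R")
    case False
    then have "\<mu> / 2 * norm z \<ge> norm (g 0)" using \<open>\<mu> > 0\<close> by (simp add: R_def field_simps)
    then have "\<mu> / 2 * norm z * norm z \<ge> norm (g 0) * norm z" by (intro mult_right_mono) auto
    moreover have "h z \<ge> h 0 + inner (g 0) (z - 0) + \<mu> / 2 * (norm (z - 0))\<^sup>2"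
      by (rule strongly_convex_first_order[OF sc g])
    moreover have "\<bar>inner (g 0) z\<bar> \<le> norm (g 0) * norm z" by (rule Cauchy_Schwarz_ineq2)
    ultimately have "h 0 \<le> h z" by (simp add: power2_eq_square)
    then show ?thesis using y(2)[of 0] \<open>R \<ge> 0\<close> by simp
  qed (use y in auto)
  have "(\<lambda>u. inner u (g y)) = (\<lambda>u. 0)"
    by (rule differential_zero_maxmin[of y UNIV h]) (use g[of y] min in \<open>auto simp: gderiv_def\<close>)
  then have g0: "g y = 0" by (metis inner_eq_zero_iff)
  show thesis
  proof (rule that[OF min g0])
    fix z assume "h z \<le> h y"
    moreover have "h z \<ge> h y + inner (g y) (z - y) + \<mu> / 2 * (norm (z - y))\<^sup>2"
      by (rule strongly_convex_first_order[OF sc g])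
    ultimately have "\<mu> / 2 * (norm (z - y))\<^sup>2 \<le> 0" using g0 by simp
    then show "z = y" using \<open>\<mu> > 0\<close> by (simp add: mult_le_0_iff)
  qed
qed

text \<open>Schwarz's theorem for a gradient that is differentiable at z. The mixed second
  difference \<Delta> is symmetric in u and w. The mean value theorem along u turns it into a
  difference of two gradients near z; expanding both at z leaves \<open>s^2 * inner (B w) u\<close>
  up to o(s^2). Exchanging u and w and cancelling s^2 finishes.\<close>

lemma gradient_derivative_symmetric:
  assumes g: "\<And>z. GDERIV h z :> g z" and B: "(g has_derivative B) (at z)"
  shows "inner (B u) w = inner u (B w)"
proof -
  have lin: "bounded_linear B" using B has_derivative_bounded_linear by blast
  define N where "N = norm u + norm w"
  define \<Delta> where "\<Delta> s = h (z + s *\<^sub>R u + s *\<^sub>R w) - h (z + s *\<^sub>R u) - h (z + s *\<^sub>R w) + h z" for s :: real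
  \<comment> \<open>Stated for arbitrary u and w, so that it applies a second time with their roles
    exchanged; \<Delta> enters only through its symmetric formula.\<close>
  have approx: "\<bar>\<Delta> s - s\<^sup>2 * inner (B w) u\<bar> \<le> s\<^sup>2 * (2 * \<epsilon> * (norm u + norm w)\<^sup>2)"
    if s: "s > 0" and \<Delta>: "\<Delta> s = h (z + s *\<^sub>R u + s *\<^sub>R w) - h (z + s *\<^sub>R u) - h (z + s *\<^sub>R w) + h z"
      and sd: "s * (norm u + norm w) < \<delta>" and \<epsilon>: "\<epsilon> > 0"
      and d: "\<And>x. norm x < \<delta> \<Longrightarrow> norm (g (z + x) - g z - B x) \<le> \<epsilon> * norm x"
    for u w s \<delta> \<epsilon> \<Delta>
  proof -
    define \<phi> where "\<phi> t = h ((z + s *\<^sub>R w) + t *\<^sub>R u) - h (z + t *\<^sub>R u)" for t :: real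
    have "(\<phi> has_real_derivative inner u (g (z + s *\<^sub>R w + t *\<^sub>R u)) - inner u (g (z + t *\<^sub>R u))) (at t)" for t
      unfolding \<phi>_def by (intro derivative_intros gderiv_along_line g)
    then obtain t where t: "0 < t" "t < s"
      and eq: "\<phi> s - \<phi> 0 = (s - 0) * (inner u (g (z + s *\<^sub>R w + t *\<^sub>R u)) - inner u (g (z + t *\<^sub>R u)))"
      using MVT2[of 0 s \<phi> "\<lambda>t. inner u (g (z + s *\<^sub>R w + t *\<^sub>R u)) - inner u (g (z + t *\<^sub>R u))"] s by blast
    define p where "p = s *\<^sub>R w + t *\<^sub>R u"
    define q where "q = t *\<^sub>R u"
    have np: "norm p \<le> s * (norm u + norm w)"
    proof -
      have "norm p \<le> s * norm w + t * norm u" unfolding p_def using s t by (intro norm_triangle_le) simp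
      also have "\<dots> \<le> s * norm w + s * norm u" using t by (simp add: mult_right_mono)
      finally show ?thesis by (simp add: algebra_simps)
    qed
    have nq: "norm q \<le> s * (norm u + norm w)"
      unfolding q_def using s t by (simp add: mult_mono)
    have "\<Delta> s = s * inner u (g (z + p) - g (z + q))"
      using eq unfolding \<Delta> \<phi>_def p_def q_def by (simp add: inner_diff_right algebra_simps)
    moreover have "B p - B q = s *\<^sub>R B w"
      unfolding p_def q_def by (simp add: linear_simps[OF lin])
    ultimately have "\<Delta> s - s\<^sup>2 * inner (B w) u
        = s * inner u ((g (z + p) - g z - B p) - (g (z + q) - g z - B q))"
      by (simp add: power2_eq_square inner_diff_right algebra_simps inner_commute[of u]
          flip: inner_scaleR_right)
    also have "\<bar>\<dots>\<bar> \<le> s * (norm u * norm ((g (z + p) - g z - B p) - (g (z + q) - g z - B q)))"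
      using s by (simp add: abs_mult Cauchy_Schwarz_ineq2)
    also have "\<dots> \<le> s * (norm u * (\<epsilon> * (s * (norm u + norm w)) + \<epsilon> * (s * (norm u + norm w))))"
    proof -
      have "norm (g (z + p) - g z - B p) \<le> \<epsilon> * (s * (norm u + norm w))"
        using d[of p] np sd \<epsilon> by (smt (verit) mult_left_mono)
      moreover have "norm (g (z + q) - g z - B q) \<le> \<epsilon> * (s * (norm u + norm w))"
        using d[of q] nq sd \<epsilon> by (smt (verit) mult_left_mono)
      ultimately have "norm ((g (z + p) - g z - B p) - (g (z + q) - g z - B q))
          \<le> \<epsilon> * (s * (norm u + norm w)) + \<epsilon> * (s * (norm u + norm w))"
        using norm_triangle_ineq4[of "g (z + p) - g z - B p" "g (z + q) - g z - B q"] by linarith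
      then show ?thesis using s by (intro mult_left_mono) auto
    qed
    also have "\<dots> = s\<^sup>2 * (2 * \<epsilon> * (norm u * (norm u + norm w)))"
      by (simp add: power2_eq_square algebra_simps)
    also have "\<dots> \<le> s\<^sup>2 * (2 * \<epsilon> * (norm u + norm w)\<^sup>2)"
      using \<epsilon> unfolding power2_eq_square[of "norm u + norm w"] by (intro mult_left_mono mult_right_mono) auto
    finally show ?thesis .
  qed
  have "\<bar>inner (B w) u - inner (B u) w\<bar> \<le> 0"
  proof (rule field_le_epsilon)
    fix e :: real assume "e > 0"
    \<comment> \<open>The two approximations together cost \<open>4 * \<epsilon> * N^2\<close>; the
      added 1 keeps the quotient meaningful when u and w vanish.\<close>
    define \<epsilon> where "\<epsilon> = e / (4 * N\<^sup>2 + 1)"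
    have pos: "4 * N\<^sup>2 + 1 > 0" by (simp add: add_nonneg_pos)
    then have \<epsilon>: "\<epsilon> > 0" using \<open>e > 0\<close> by (simp add: \<epsilon>_def)
    obtain \<delta> where \<delta>: "\<delta> > 0" "\<And>x. norm x < \<delta> \<Longrightarrow> norm (g (z + x) - g z - B x) \<le> \<epsilon> * norm x"
    proof -
      obtain \<delta> where "\<delta> > 0" "\<And>y. norm (y - z) < \<delta> \<Longrightarrow> norm (g y - g z - B (y - z)) \<le> \<epsilon> * norm (y - z)"
        using B \<epsilon> unfolding has_derivative_at_alt by blast
      then show thesis using that[of \<delta>] by (metis add_diff_cancel_left')
    qed
    define s where "s = \<delta> / (2 * (N + 1))"
    have N: "N \<ge> 0" by (simp add: N_def)
    have s: "s > 0" using \<delta>(1) N by (simp add: s_def)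
    have sN: "s * N < \<delta>" using \<delta>(1) N by (simp add: s_def field_simps) (smt (verit) mult_pos_pos mult_nonneg_nonneg)
    have 1: "\<bar>\<Delta> s - s\<^sup>2 * inner (B w) u\<bar> \<le> s\<^sup>2 * (2 * \<epsilon> * (norm u + norm w)\<^sup>2)"
      by (rule approx[OF s _ _ \<epsilon> \<delta>(2)]) (use sN in \<open>auto simp: \<Delta>_def N_def\<close>)
    have 2: "\<bar>\<Delta> s - s\<^sup>2 * inner (B u) w\<bar> \<le> s\<^sup>2 * (2 * \<epsilon> * (norm w + norm u)\<^sup>2)"
      by (rule approx[OF s _ _ \<epsilon> \<delta>(2)]) (use sN in \<open>auto simp: \<Delta>_def N_def algebra_simps\<close>)
    have "s\<^sup>2 * \<bar>inner (B w) u - inner (B u) w\<bar> = \<bar>s\<^sup>2 * inner (B w) u - s\<^sup>2 * inner (B u) w\<bar>"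
      by (simp add: abs_mult flip: right_diff_distrib)
    also have "\<dots> \<le> s\<^sup>2 * (4 * \<epsilon> * N\<^sup>2)"
      using 1 2 unfolding N_def by (simp add: add.commute[of "norm w"])
    finally have "\<bar>inner (B w) u - inner (B u) w\<bar> \<le> 4 * \<epsilon> * N\<^sup>2" using s by simp
    also have "\<dots> \<le> e" using \<open>e > 0\<close> pos by (simp add: \<epsilon>_def field_simps)
    finally show "\<bar>inner (B w) u - inner (B u) w\<bar> \<le> 0 + e" by simp
  qed
  then show ?thesis by (simp add: inner_commute)
qed

section \<open>The deterministic bilevel problem\<close>

lemma gderiv_partial:
  assumes "GDERIV h z :> d"
  shows "GDERIV (\<lambda>x. h (x, snd z)) (fst z) :> fst d" and "GDERIV (\<lambda>y. h (fst z, y)) (snd z) :> snd d"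
proof -
  have h: "(h has_derivative (\<lambda>u. inner u d)) (at (fst z, snd z))"
    using assms by (simp add: gderiv_def)
  have "((\<lambda>x. h (x, snd z)) has_derivative (\<lambda>u. inner (u, 0) d)) (at (fst z))"
    by (rule has_derivative_compose[where g = h]) (use h in \<open>auto intro!: derivative_eq_intros\<close>)
  then show "GDERIV (\<lambda>x. h (x, snd z)) (fst z) :> fst d"
    by (simp add: gderiv_def inner_prod_def)
  have "((\<lambda>y. h (fst z, y)) has_derivative (\<lambda>u. inner (0, u) d)) (at (snd z))"
    by (rule has_derivative_compose[where g = h]) (use h in \<open>auto intro!: derivative_eq_intros\<close>)
  then show "GDERIV (\<lambda>y. h (fst z, y)) (snd z) :> snd d"
    by (simp add: gderiv_def inner_prod_def)
qed

lemma norm_fst_le': "norm (fst z) \<le> norm z" and norm_snd_le': "norm (snd z) \<le> norm z"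
  by (metis norm_fst_le prod.collapse, metis norm_snd_le prod.collapse)

lemma sum_power2_le: "(a + b)\<^sup>2 \<le> 2 * a\<^sup>2 + 2 * (b::real)\<^sup>2"
  using zero_le_power2[of "a - b"] by (simp add: power2_eq_square algebra_simps)

text \<open>Stated for a general pair because it is interpreted both for the expected functions and
  for every sampled pair, to which A4 gives the same constants. All estimates below therefore hold
  sample by sample.\<close>

locale smooth_lipschitz_pair =
  fixes f g :: "(real ^ 'p) \<times> (real ^ 'q) \<Rightarrow> real"
    and \<mu> Cf Lf Lg Lgxy Lgyy :: real
  assumes smooth: "smooth_pair \<mu> f g"
    and lip: "lipschitz_pair Cf Lf Lg Lgxy Lgyy f g"
    and mu_pos: "\<mu> > 0"
begin

text \<open>The second derivative in both variables jointly. The two Hessian blocks are its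
  components on vectors (0, w); keeping the whole map gives both the same bound Lg and makes the
  symmetry between the blocks available.\<close>

definition D2 where "D2 z = frechet_derivative (grad g) (at z)"

lemma gderiv_f: "GDERIV f z :> grad f z" and gderiv_g: "GDERIV g z :> grad g z"
  using smooth by (auto simp: smooth_pair_def C2_def intro: C1_gderiv)

lemma grad_x_f: "grad_x f z = fst (grad f z)" and grad_y_f: "grad_y f z = snd (grad f z)"
  unfolding grad_x_def grad_y_def by (rule gderiv_partial[OF gderiv_f, THEN grad_eqI])+

lemma grad_x_g: "grad_x g z = fst (grad g z)" and grad_y_g: "grad_y g z = snd (grad g z)"
  unfolding grad_x_def grad_y_def by (rule gderiv_partial[OF gderiv_g, THEN grad_eqI])+

lemma D2: "(grad g has_derivative D2 z) (at z)"
proof -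
  have "grad g differentiable (at z)"
    using smooth unfolding smooth_pair_def C2_def C1_def differentiable_def by blast
  then show ?thesis by (simp add: D2_def frechet_derivative_works)
qed

lemma hess_yy_apply: "hess_yy g z *v w = snd (D2 z (0, w))"
proof -
  have "((\<lambda>y. grad g (fst z, y)) has_derivative (\<lambda>w. D2 z (0, w))) (at (snd z))"
    by (rule has_derivative_compose[where g = "grad g"]) (use D2[of z] in \<open>auto intro!: derivative_eq_intros\<close>)
  then have d: "((\<lambda>y. grad_y g (fst z, y)) has_derivative (\<lambda>w. snd (D2 z (0, w)))) (at (snd z))"
    unfolding grad_y_g by (rule has_derivative_snd)
  show ?thesis
    unfolding hess_yy_def jacobian_def frechet_derivative_at[OF d, symmetric]
    by (simp add: matrix_works linear_matrix_vector_mul_eq has_derivative_linear[OF d])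
qed

lemma hess_xy_apply: "hess_xy g z *v w = fst (D2 z (0, w))"
proof -
  have "((\<lambda>y. grad g (fst z, y)) has_derivative (\<lambda>w. D2 z (0, w))) (at (snd z))"
    by (rule has_derivative_compose[where g = "grad g"]) (use D2[of z] in \<open>auto intro!: derivative_eq_intros\<close>)
  then have d: "((\<lambda>y. grad_x g (fst z, y)) has_derivative (\<lambda>w. fst (D2 z (0, w)))) (at (snd z))"
    unfolding grad_x_g by (rule has_derivative_fst)
  show ?thesis
    unfolding hess_xy_def jacobian_def frechet_derivative_at[OF d, symmetric]
    by (simp add: matrix_works linear_matrix_vector_mul_eq has_derivative_linear[OF d])
qed

lemma lip_grad_g: "norm (grad g z' - grad g z) \<le> Lg * norm (z' - z)"
  and lip_grad_f: "norm (grad f z' - grad f z) \<le> Lf * norm (z' - z)"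
  and lip_f: "\<bar>f z' - f z\<bar> \<le> Cf * norm (z' - z)"
  using lip unfolding lipschitz_pair_def lipschitz_on_def
  by (auto simp: dist_norm simp del: split_paired_All)

lemma Cf_nonneg: "Cf \<ge> 0" and Lf_nonneg: "Lf \<ge> 0" and Lg_nonneg: "Lg \<ge> 0"
  using lip by (auto simp: lipschitz_pair_def dest: lipschitz_on_nonneg)

lemma norm_D2: "norm (D2 z u) \<le> Lg * norm u"
  by (rule derivative_bound[OF D2]) (use lip_grad_g[of "z + _" z] in simp)

lemma norm_grad_f: "norm (grad f z) \<le> Cf"
proof -
  have "norm (inner (grad f z) (grad f z)) \<le> Cf * norm (grad f z)"
    by (rule derivative_bound[OF gderiv_f[unfolded gderiv_def]]) (use lip_f[of "z + _" z] in simp)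
  then have "norm (grad f z) * norm (grad f z) \<le> Cf * norm (grad f z)"
    by (simp add: power2_norm_eq_inner[symmetric] power2_eq_square)
  then show ?thesis using Cf_nonneg by (cases "grad f z = 0") (auto simp: mult_le_cancel_right)
qed

section \<open>Bounds and Lipschitz estimates for Hessian products and directions\<close>

lemma norm_hess_xy: "norm (hess_xy g z *v w) \<le> Lg * norm w"
  and norm_hess_yy: "norm (hess_yy g z *v w) \<le> Lg * norm w"
  unfolding hess_xy_apply hess_yy_apply
  using norm_D2[of z "(0, w)"] norm_fst_le'[of "D2 z (0, w)"] norm_snd_le'[of "D2 z (0, w)"]
  by (auto simp: norm_Pair)

text \<open>The constants of A2 refer to the spectral norm, whereas the norm of the matrix type is
  the Frobenius norm. Matrices are therefore compared only through their action on a vector, where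
  the operator norm gives the intended constant.\<close>

lemma hess_lipschitz:
  shows "norm (hess_xy g z' *v w - hess_xy g z *v w) \<le> max Lgxy Lgyy * norm (z' - z) * norm w"
    and "norm (hess_yy g z' *v w - hess_yy g z *v w) \<le> max Lgxy Lgyy * norm (z' - z) * norm w"
proof -
  have *: "norm (A z' *v w - A z *v w) \<le> max Lgxy Lgyy * norm (z' - z) * norm w"
    if "spectral_lipschitz L A" "L \<le> max Lgxy Lgyy"
    for A :: "(real ^ 'p) \<times> (real ^ 'q) \<Rightarrow> real ^ 'n ^ 'm" and L and w
  proof -
    have "norm (A z' *v w - A z *v w) = norm ((A z' - A z) *v w)"
      by (simp add: matrix_vector_mult_diff_rdistrib)
    also have "\<dots> \<le> spectral_norm (A z' - A z) * norm w"
      unfolding spectral_norm_def by (rule onorm[OF matrix_vector_mul_bounded_linear])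
    also have "\<dots> \<le> L * norm (z' - z) * norm w"
      using that(1) unfolding spectral_lipschitz_def by (intro mult_right_mono) (blast, simp)
    also have "\<dots> \<le> max Lgxy Lgyy * norm (z' - z) * norm w"
      using that(2) by (intro mult_right_mono) auto
    finally show ?thesis .
  qed
  show "norm (hess_xy g z' *v w - hess_xy g z *v w) \<le> max Lgxy Lgyy * norm (z' - z) * norm w"
    by (rule *[of Lgxy]) (use lip in \<open>auto simp: lipschitz_pair_def\<close>)
  show "norm (hess_yy g z' *v w - hess_yy g z *v w) \<le> max Lgxy Lgyy * norm (z' - z) * norm w"
    by (rule *[of Lgyy]) (use lip in \<open>auto simp: lipschitz_pair_def\<close>)
qed

lemma dir_y_eq: "dir_y g z = snd (grad g z)" by (simp add: dir_y_def grad_y_g)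

lemma dir_y_lipschitz: "norm (dir_y g z' - dir_y g z) \<le> Lg * norm (z' - z)"
  using lip_grad_g[of z' z] norm_snd_le'[of "grad g z' - grad g z"] by (simp add: dir_y_eq)

text \<open>The decomposition is asymmetric: the change of the Hessian block acts on v, which lies
  in the ball, while the change v' - v is multiplied by the block at z', which is bounded by
  Lg.\<close>

lemma dir_lipschitz:
  assumes "norm v \<le> M"
  shows "norm (dir_x f g z' v' - dir_x f g z v) \<le> (Lf + M * max Lgxy Lgyy) * norm (z' - z) + Lg * norm (v' - v)"
    and "norm (dir_v f g z' v' - dir_v f g z v) \<le> (Lf + M * max Lgxy Lgyy) * norm (z' - z) + Lg * norm (v' - v)"
proof -
  have m: "max Lgxy Lgyy * norm (z' - z) * norm v \<le> max Lgxy Lgyy * norm (z' - z) * M"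
  proof (cases "norm (z' - z) = 0")
    case False
    \<comment> \<open>The signs of Lgxy and Lgyy are not given; testing the Lipschitz estimate on a
      unit vector shows that the factor in front is nonnegative.\<close>
    obtain w :: "real ^ 'q" where w: "norm w = 1" using vector_choose_size zero_le_one by blast
    have "0 \<le> max Lgxy Lgyy * norm (z' - z) * norm w"
      using hess_lipschitz(1)[of z' w z] norm_ge_zero order_trans by blast
    then show ?thesis using w assms by (intro mult_left_mono) auto
  qed simp
  have "dir_x f g z' v' - dir_x f g z v
      = fst (grad f z' - grad f z) - (hess_xy g z' *v v - hess_xy g z *v v) - hess_xy g z' *v (v' - v)"
    by (simp add: dir_x_def grad_x_f matrix_vector_mult_diff_distrib)
  then have "norm (dir_x f g z' v' - dir_x f g z v)
      \<le> norm (fst (grad f z' - grad f z)) + norm (hess_xy g z' *v v - hess_xy g z *v v) + norm (hess_xy g z' *v (v' - v))"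
    by (simp only:) (intro order_trans[OF norm_triangle_ineq4] add_right_mono norm_triangle_ineq4)
  then show "norm (dir_x f g z' v' - dir_x f g z v) \<le> (Lf + M * max Lgxy Lgyy) * norm (z' - z) + Lg * norm (v' - v)"
    using norm_fst_le'[of "grad f z' - grad f z"] lip_grad_f[of z' z] hess_lipschitz(1)[of z' v z] m
      norm_hess_xy[of z' "v' - v"] by (simp add: algebra_simps)
  have "dir_v f g z' v' - dir_v f g z v
      = (hess_yy g z' *v v - hess_yy g z *v v) + hess_yy g z' *v (v' - v) - snd (grad f z' - grad f z)"
    by (simp add: dir_v_def grad_y_f matrix_vector_mult_diff_distrib)
  then have "norm (dir_v f g z' v' - dir_v f g z v)
      \<le> norm (hess_yy g z' *v v - hess_yy g z *v v) + norm (hess_yy g z' *v (v' - v)) + norm (snd (grad f z' - grad f z))"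
    by (simp only:) (intro order_trans[OF norm_triangle_ineq4] add_right_mono norm_triangle_ineq)
  then show "norm (dir_v f g z' v' - dir_v f g z v) \<le> (Lf + M * max Lgxy Lgyy) * norm (z' - z) + Lg * norm (v' - v)"
    using norm_snd_le'[of "grad f z' - grad f z"] lip_grad_f[of z' z] hess_lipschitz(2)[of z' v z] m
      norm_hess_yy[of z' "v' - v"] by (simp add: algebra_simps)
qed

text \<open>Origin of the constant M1: the square of a sum is split twice, and
  \<open>2 * (Lf + M * Lgg)^2\<close> is at most \<open>4 * Lf^2 + 4 * M^2 * Lgg^2\<close>.\<close>

lemma dir_lipschitz_power2:
  assumes "norm v \<le> M"
  defines "M1 \<equiv> 4 * Lf\<^sup>2 + 4 * M\<^sup>2 * (max Lgxy Lgyy)\<^sup>2"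
  shows "(norm (dir_x f g z' v' - dir_x f g z v))\<^sup>2 \<le> M1 * (norm (z' - z))\<^sup>2 + 2 * Lg\<^sup>2 * (norm (v' - v))\<^sup>2"
    and "(norm (dir_v f g z' v' - dir_v f g z v))\<^sup>2 \<le> M1 * (norm (z' - z))\<^sup>2 + 2 * Lg\<^sup>2 * (norm (v' - v))\<^sup>2"
proof -
  have *: "n\<^sup>2 \<le> M1 * (norm (z' - z))\<^sup>2 + 2 * Lg\<^sup>2 * (norm (v' - v))\<^sup>2"
    if "n \<le> (Lf + M * max Lgxy Lgyy) * norm (z' - z) + Lg * norm (v' - v)" "n \<ge> 0" for n
  proof -
    have "n\<^sup>2 \<le> ((Lf + M * max Lgxy Lgyy) * norm (z' - z) + Lg * norm (v' - v))\<^sup>2"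
      using that by (intro power_mono)
    also have "\<dots> \<le> 2 * ((Lf + M * max Lgxy Lgyy) * norm (z' - z))\<^sup>2 + 2 * (Lg * norm (v' - v))\<^sup>2"
      by (rule sum_power2_le)
    also have "\<dots> = 2 * (Lf + M * max Lgxy Lgyy)\<^sup>2 * (norm (z' - z))\<^sup>2 + 2 * Lg\<^sup>2 * (norm (v' - v))\<^sup>2"
      by (simp add: power_mult_distrib)
    also have "2 * (Lf + M * max Lgxy Lgyy)\<^sup>2 \<le> M1"
      using sum_power2_le[of Lf "M * max Lgxy Lgyy"] by (simp add: M1_def power_mult_distrib)
    finally show ?thesis by (simp add: mult_right_mono)
  qed
  show "(norm (dir_x f g z' v' - dir_x f g z v))\<^sup>2 \<le> M1 * (norm (z' - z))\<^sup>2 + 2 * Lg\<^sup>2 * (norm (v' - v))\<^sup>2"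
    by (rule *[OF dir_lipschitz(1)]) (use assms in auto)
  show "(norm (dir_v f g z' v' - dir_v f g z v))\<^sup>2 \<le> M1 * (norm (z' - z))\<^sup>2 + 2 * Lg\<^sup>2 * (norm (v' - v))\<^sup>2"
    by (rule *[OF dir_lipschitz(2)]) (use assms in auto)
qed

text \<open>The gradient of a Cf-Lipschitz function is bounded by Cf and the Hessian blocks by Lg,
  so a bound on v bounds the directions uniformly in x and y. This later supplies the refresh
  variance and the square integrability of the x- and v-directions.\<close>

lemma dir_bounded:
  assumes "norm v \<le> M"
  shows "norm (dir_x f g z v) \<le> Cf + Lg * M" and "norm (dir_v f g z v) \<le> Cf + Lg * M"
proof -
  have m: "Lg * norm v \<le> Lg * M" using assms Lg_nonneg by (rule mult_left_mono)
  show "norm (dir_x f g z v) \<le> Cf + Lg * M"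
    unfolding dir_x_def grad_x_f
    using norm_triangle_ineq4[of "fst (grad f z)" "hess_xy g z *v v"] norm_fst_le'[of "grad f z"]
      norm_grad_f[of z] norm_hess_xy[of z v] m by linarith
  show "norm (dir_v f g z v) \<le> Cf + Lg * M"
    unfolding dir_v_def grad_y_f
    using norm_triangle_ineq4[of "hess_yy g z *v v" "snd (grad f z)"] norm_snd_le'[of "grad f z"]
      norm_grad_f[of z] norm_hess_yy[of z v] m by linarith
qed

text \<open>Continuity for a fixed sample is what allows a random direction to be evaluated
  measurably at a random point; for the Hessian terms it comes from the continuous derivative in
  \<open>C2\<close>.\<close>

lemma dir_continuous:
  shows "continuous_on UNIV (\<lambda>(z, v). dir_x f g z v)" and "continuous_on UNIV (\<lambda>(z, v). dir_v f g z v)"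
proof -
  obtain h' where h': "\<And>z. (grad g has_derivative blinfun_apply (h' z)) (at z)" "continuous_on UNIV h'"
    using smooth unfolding smooth_pair_def C2_def C1_def by blast
  have D2h: "D2 z u = blinfun_apply (h' z) u" for z u
    using has_derivative_unique[OF D2 h'(1)] by metis
  have "Lf-lipschitz_on UNIV (grad f)" using lip by (simp add: lipschitz_pair_def)
  then have cf: "continuous_on UNIV (grad f)" by (rule lipschitz_on_continuous_on)
  note c = continuous_on_compose2[OF cf] continuous_on_compose2[OF h'(2)]
  show "continuous_on UNIV (\<lambda>(z, v). dir_x f g z v)"
    unfolding dir_x_def grad_x_f hess_xy_apply D2h case_prod_beta
    by (intro continuous_intros c) auto
  show "continuous_on UNIV (\<lambda>(z, v). dir_v f g z v)"
    unfolding dir_v_def grad_y_f hess_yy_apply D2h case_prod_beta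
    by (intro continuous_intros c) auto
qed

lemma dir_y_continuous: "continuous_on UNIV (dir_y g)"
proof (rule lipschitz_on_continuous_on[of Lg], rule lipschitz_onI)
  show "dist (dir_y g z) (dir_y g z') \<le> Lg * dist z z'" for z z'
    unfolding dist_norm by (rule dir_y_lipschitz)
qed (rule Lg_nonneg)

section \<open>Monotonicity and cocoercivity of the lower-level gradient and of its Hessian\<close>

lemma gderiv_g_y: "GDERIV (\<lambda>y. g (x, y)) y :> dir_y g (x, y)"
  using gderiv_partial(2)[OF gderiv_g[of "(x, y)"]] by (simp add: dir_y_eq)

lemma sc: "strongly_convex \<mu> (\<lambda>y. g (x, y))"
  using smooth by (simp add: smooth_pair_def)

lemma dir_y_monotone: "inner (dir_y g (x, y') - dir_y g (x, y)) (y' - y) \<ge> \<mu> * (norm (y' - y))\<^sup>2"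
  by (rule strongly_convex_strongly_monotone[OF sc gderiv_g_y gderiv_g_y])

lemma mu_le_Lg: "\<mu> \<le> Lg"
proof -
  obtain w :: "real ^ 'q" where w: "norm w = 1" using vector_choose_size zero_le_one by blast
  have "\<mu> * (norm w)\<^sup>2 \<le> inner (dir_y g (0, w) - dir_y g (0, 0)) w"
    using dir_y_monotone[of w 0 0] by simp
  also have "\<dots> \<le> norm (dir_y g (0, w) - dir_y g (0, 0)) * norm w" by (rule norm_cauchy_schwarz)
  also have "\<dots> \<le> Lg * norm ((0, w) - (0, 0) :: (real ^ 'p) \<times> (real ^ 'q)) * norm w"
    by (intro mult_right_mono dir_y_lipschitz) auto
  finally show ?thesis using w by (simp add: norm_Pair)
qed

lemma Lg_pos: "Lg > 0" using mu_le_Lg mu_pos by simp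

lemma dir_y_cocoercive:
  "inner (dir_y g (x, y') - dir_y g (x, y)) (y' - y) \<ge> (norm (dir_y g (x, y') - dir_y g (x, y)))\<^sup>2 / Lg"
proof (rule cocoercive[where h = "\<lambda>y. g (x, y)"])
  fix u v
  have "g (x, v) \<ge> g (x, u) + inner (dir_y g (x, u)) (v - u) + \<mu> / 2 * (norm (v - u))\<^sup>2"
    by (rule strongly_convex_first_order[OF sc gderiv_g_y])
  moreover have "\<mu> / 2 * (norm (v - u))\<^sup>2 \<ge> 0" using mu_pos by simp
  ultimately show "g (x, v) \<ge> g (x, u) + inner (dir_y g (x, u)) (v - u)" by linarith
next
  show "Lg-lipschitz_on UNIV (\<lambda>y. dir_y g (x, y))"
    using dir_y_lipschitz[of "(x, _)" "(x, _)"] Lg_nonneg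
    by (intro lipschitz_onI) (auto simp: dist_norm norm_Pair)
qed (use gderiv_g_y Lg_pos in auto)

text \<open>With \<open>q s\<close> the difference quotient of the lower-level gradient in direction
  w, monotonicity and cocoercivity both scale by s^2 and pass to the limit. The second inequality
  lets the linear system for v be treated by the same descent estimate as the lower-level
  problem.\<close>

lemma hess_yy_coercive:
  shows "inner (hess_yy g z *v w) w \<ge> \<mu> * (norm w)\<^sup>2"
    and "inner (hess_yy g z *v w) w \<ge> (norm (hess_yy g z *v w))\<^sup>2 / Lg"
proof -
  obtain x y where z: "z = (x, y)" by fastforce
  define q where "q s = (dir_y g (x, y + s *\<^sub>R w) - dir_y g (x, y)) /\<^sub>R s" for s :: real
  have "((\<lambda>s. snd ((grad g (z + s *\<^sub>R (0, w)) - grad g z) /\<^sub>R s)) \<longlongrightarrow> snd (D2 z (0, w))) (at 0)"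
    by (intro tendsto_snd directional_derivative D2)
  then have lim: "(q \<longlongrightarrow> hess_yy g z *v w) (at 0)"
    by (simp add: q_def[abs_def] dir_y_eq z hess_yy_apply)
  have eq: "inner (dir_y g (x, y + s *\<^sub>R w) - dir_y g (x, y)) (y + s *\<^sub>R w - y) = s\<^sup>2 * inner (q s) w"
    and eq2: "dir_y g (x, y + s *\<^sub>R w) - dir_y g (x, y) = s *\<^sub>R q s" if "s \<noteq> 0" for s
    using that by (simp_all add: q_def power2_eq_square)
  show "inner (hess_yy g z *v w) w \<ge> \<mu> * (norm w)\<^sup>2"
  proof (rule tendsto_lowerbound)
    show "((\<lambda>s. inner (q s) w) \<longlongrightarrow> inner (hess_yy g z *v w) w) (at 0)" by (intro tendsto_intros lim)
    have "inner (q s) w \<ge> \<mu> * (norm w)\<^sup>2" if "s \<noteq> 0" for s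
    proof -
      have "s\<^sup>2 * (\<mu> * (norm w)\<^sup>2) \<le> s\<^sup>2 * inner (q s) w"
        using dir_y_monotone[of "y + s *\<^sub>R w" y x] eq[OF that] by (simp add: power_mult_distrib mult_ac)
      then show ?thesis using that by simp
    qed
    then show "\<forall>\<^sub>F s in at 0. inner (q s) w \<ge> \<mu> * (norm w)\<^sup>2" by (auto simp: eventually_at_filter)
  qed simp
  show "inner (hess_yy g z *v w) w \<ge> (norm (hess_yy g z *v w))\<^sup>2 / Lg"
  proof (rule tendsto_le[of "at (0::real)"])
    show "((\<lambda>s. inner (q s) w) \<longlongrightarrow> inner (hess_yy g z *v w) w) (at 0)" by (intro tendsto_intros lim)
    show "((\<lambda>s. (norm (q s))\<^sup>2 / Lg) \<longlongrightarrow> (norm (hess_yy g z *v w))\<^sup>2 / Lg) (at 0)"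
      by (intro tendsto_intros lim) (use Lg_pos in auto)
    have "inner (q s) w \<ge> (norm (q s))\<^sup>2 / Lg" if "s \<noteq> 0" for s
    proof -
      have "s\<^sup>2 * ((norm (q s))\<^sup>2 / Lg) \<le> s\<^sup>2 * inner (q s) w"
        using dir_y_cocoercive[where x = x and y' = "y + s *\<^sub>R w" and y = y]
        unfolding eq[OF that] unfolding eq2[OF that] by (simp add: power_mult_distrib)
      then show ?thesis using that by (subst (asm) mult_le_cancel_left_pos) auto
    qed
    then show "\<forall>\<^sub>F s in at 0. (norm (q s))\<^sup>2 / Lg \<le> inner (q s) w" by (auto simp: eventually_at_filter)
  qed simp
qed

section \<open>The solution maps of the lower level and of the linear system\<close>

definition ystar where "ystar = lower_solution g"

lemma ystar: "dir_y g (x, ystar x) = 0"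
proof -
  obtain y where y: "\<And>z. g (x, y) \<le> g (x, z)" "dir_y g (x, y) = 0" "\<And>z. g (x, z) \<le> g (x, y) \<Longrightarrow> z = y"
  proof (rule strongly_convex_minimizer[of \<mu> "\<lambda>y. g (x, y)" "\<lambda>y. dir_y g (x, y)", OF sc mu_pos gderiv_g_y])
    fix y assume "\<And>z. g (x, y) \<le> g (x, z)" "dir_y g (x, y) = 0" "\<And>z. g (x, z) \<le> g (x, y) \<Longrightarrow> z = y"
    then show thesis by (rule that)
  qed
  have "is_arg_min (\<lambda>y. g (x, y)) (\<lambda>_. True) (ystar x)"
    unfolding ystar_def lower_solution_def arg_min_def
    by (rule someI[of "is_arg_min (\<lambda>y. g (x, y)) (\<lambda>_. True)" y])
       (simp add: is_arg_min_def not_less y(1))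
  then have "ystar x = y" using y(3) by (auto simp: is_arg_min_def not_less)
  then show ?thesis using y(2) by simp
qed

text \<open>The gradient at (x', ystar x') vanishes, so strong monotonicity between the two
  solutions leaves only the gradient at (x', ystar x), which differs from zero by a move in x
  alone.\<close>

lemma ystar_lipschitz: "norm (ystar x' - ystar x) \<le> Lg / \<mu> * norm (x' - x)"
proof -
  let ?d = "ystar x' - ystar x"
  have "\<mu> * (norm ?d)\<^sup>2 \<le> inner (dir_y g (x', ystar x') - dir_y g (x', ystar x)) ?d"
    by (rule dir_y_monotone)
  also have "\<dots> = inner (dir_y g (x, ystar x) - dir_y g (x', ystar x)) ?d" by (simp add: ystar)
  also have "\<dots> \<le> norm (dir_y g (x, ystar x) - dir_y g (x', ystar x)) * norm ?d" by (rule norm_cauchy_schwarz)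
  also have "\<dots> \<le> Lg * norm ((x, ystar x) - (x', ystar x)) * norm ?d"
    by (intro mult_right_mono dir_y_lipschitz) auto
  finally have "\<mu> * norm ?d * norm ?d \<le> Lg * norm (x' - x) * norm ?d"
    by (simp add: norm_Pair power2_eq_square norm_minus_commute mult_ac)
  then have "\<mu> * norm ?d \<le> Lg * norm (x' - x)"
    using Lg_nonneg by (cases "?d = 0") (auto simp: mult_le_cancel_right)
  then show ?thesis using mu_pos by (simp add: field_simps)
qed

definition zstar where "zstar x = (x, ystar x)"

lemma zstar_lipschitz: "norm (zstar x' - zstar x) \<le> (1 + Lg / \<mu>) * norm (x' - x)"
  unfolding zstar_def using ystar_lipschitz[of x' x] norm_Pair_le[of "x' - x" "ystar x' - ystar x"]
  by (simp add: algebra_simps)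

definition vstar where "vstar x = (SOME v. hess_yy g (zstar x) *v v = grad_y f (zstar x))"

text \<open>Coercivity makes the Hessian injective, hence surjective in finite dimension; this
  justifies the choice made in \<open>vstar\<close>.\<close>

lemma vstar: "hess_yy g (zstar x) *v vstar x = grad_y f (zstar x)"
proof -
  have "inj ((*v) (hess_yy g (zstar x)))"
  proof (rule injI)
    fix v w assume "hess_yy g (zstar x) *v v = hess_yy g (zstar x) *v w"
    then have "hess_yy g (zstar x) *v (v - w) = 0" by (simp add: matrix_vector_mult_diff_distrib)
    then have "\<mu> * (norm (v - w))\<^sup>2 \<le> 0" using hess_yy_coercive(1)[of "v - w" "zstar x"] by simp
    then show "v = w" using mu_pos by (simp add: mult_le_0_iff)
  qed
  then have "surj ((*v) (hess_yy g (zstar x)))"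
    by (intro linear_inj_imp_surj matrix_vector_mul_linear)
  then obtain v where "hess_yy g (zstar x) *v v = grad_y f (zstar x)" by (metis surj_def)
  then show ?thesis unfolding vstar_def by (rule someI)
qed

lemma dir_v_vstar: "dir_v f g (zstar x) (vstar x) = 0"
  by (simp add: dir_v_def vstar)

text \<open>The reason for the lower bound on M: every \<open>vstar x\<close> lies in the ball onto
  which the algorithm projects.\<close>

lemma norm_vstar: "norm (vstar x) \<le> Cf / \<mu>"
proof -
  have "\<mu> * (norm (vstar x))\<^sup>2 \<le> inner (hess_yy g (zstar x) *v vstar x) (vstar x)"
    by (rule hess_yy_coercive)
  also have "\<dots> \<le> norm (grad_y f (zstar x)) * norm (vstar x)" unfolding vstar by (rule norm_cauchy_schwarz)
  also have "\<dots> \<le> Cf * norm (vstar x)"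
    using norm_grad_f[of "zstar x"] norm_snd_le'[of "grad f (zstar x)"]
    by (intro mult_right_mono) (auto simp: grad_y_f)
  finally have "\<mu> * norm (vstar x) * norm (vstar x) \<le> Cf * norm (vstar x)"
    by (simp add: power2_eq_square mult_ac)
  then have "\<mu> * norm (vstar x) \<le> Cf"
    using Cf_nonneg by (cases "vstar x = 0") (auto simp: mult_le_cancel_right)
  then show ?thesis using mu_pos by (simp add: field_simps)
qed

lemma Lgg_nonneg: "max Lgxy Lgyy \<ge> 0"
proof -
  obtain w :: "real ^ 'q" where w: "norm w = 1" using vector_choose_size zero_le_one by blast
  have "0 \<le> max Lgxy Lgyy * norm ((0, w) - 0 :: (real ^ 'p) \<times> (real ^ 'q)) * norm w"
    using hess_lipschitz(1)[of "(0, w)" w 0] norm_ge_zero order_trans by blast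
  then show ?thesis using w by (simp add: norm_Pair)
qed

text \<open>Subtracting the two linear systems leaves the change of the right-hand side and the
  change of the Hessian applied to \<open>vstar x\<close>, both measured along \<open>zstar\<close>.
  Coercivity divides by \<mu>, and 1 + Lg / \<mu> is the Lipschitz constant of
  \<open>zstar\<close>.\<close>

lemma vstar_lipschitz:
  "norm (vstar x' - vstar x)
    \<le> (Lf / \<mu> + Cf * max Lgxy Lgyy / \<mu>\<^sup>2) * (1 + Lg / \<mu>) * norm (x' - x)" (is "_ \<le> ?Cv * _")
proof -
  let ?d = "vstar x' - vstar x"
  let ?n = "norm (zstar x' - zstar x)"
  have "hess_yy g (zstar x') *v ?d = snd (grad f (zstar x') - grad f (zstar x))
      - (hess_yy g (zstar x') *v vstar x - hess_yy g (zstar x) *v vstar x)"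
    by (simp add: matrix_vector_mult_diff_distrib vstar grad_y_f)
  then have "norm (hess_yy g (zstar x') *v ?d)
      \<le> norm (snd (grad f (zstar x') - grad f (zstar x)))
        + norm (hess_yy g (zstar x') *v vstar x - hess_yy g (zstar x) *v vstar x)"
    using norm_triangle_ineq4 by metis
  also have "\<dots> \<le> Lf * ?n + max Lgxy Lgyy * ?n * (Cf / \<mu>)"
  proof (intro add_mono)
    show "norm (snd (grad f (zstar x') - grad f (zstar x))) \<le> Lf * ?n"
      using norm_snd_le' lip_grad_f order_trans by blast
    show "norm (hess_yy g (zstar x') *v vstar x - hess_yy g (zstar x) *v vstar x) \<le> max Lgxy Lgyy * ?n * (Cf / \<mu>)"
      using Lgg_nonneg by (intro order_trans[OF hess_lipschitz(2)] mult_left_mono norm_vstar) auto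
  qed
  also have "\<dots> = (Lf + Cf * max Lgxy Lgyy / \<mu>) * ?n" by (simp add: algebra_simps)
  finally have H: "norm (hess_yy g (zstar x') *v ?d) \<le> (Lf + Cf * max Lgxy Lgyy / \<mu>) * ?n" .
  have "\<mu> * (norm ?d)\<^sup>2 \<le> inner (hess_yy g (zstar x') *v ?d) ?d" by (rule hess_yy_coercive)
  also have "\<dots> \<le> norm (hess_yy g (zstar x') *v ?d) * norm ?d" by (rule norm_cauchy_schwarz)
  also have "\<dots> \<le> (Lf + Cf * max Lgxy Lgyy / \<mu>) * ?n * norm ?d" by (intro mult_right_mono H) auto
  finally have "\<mu> * norm ?d * norm ?d \<le> (Lf + Cf * max Lgxy Lgyy / \<mu>) * ?n * norm ?d"
    by (simp add: power2_eq_square mult_ac)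
  moreover have nn: "Lf + Cf * max Lgxy Lgyy / \<mu> \<ge> 0"
    using Lf_nonneg Cf_nonneg Lgg_nonneg mu_pos by (intro add_nonneg_nonneg divide_nonneg_nonneg mult_nonneg_nonneg) auto
  ultimately have "\<mu> * norm ?d \<le> (Lf + Cf * max Lgxy Lgyy / \<mu>) * ?n"
    by (cases "?d = 0") (auto simp: mult_le_cancel_right)
  also have "\<dots> \<le> (Lf + Cf * max Lgxy Lgyy / \<mu>) * ((1 + Lg / \<mu>) * norm (x' - x))"
    using nn by (intro mult_left_mono zstar_lipschitz)
  finally have "norm ?d \<le> (Lf + Cf * max Lgxy Lgyy / \<mu>) * ((1 + Lg / \<mu>) * norm (x' - x)) / \<mu>"
    using mu_pos by (simp add: field_simps)
  also have "\<dots> = ?Cv * norm (x' - x)" using mu_pos by (simp add: field_simps power2_eq_square)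
  finally show ?thesis .
qed

section \<open>The hyperobjective and its gradient\<close>

abbreviation \<Phi> where "\<Phi> \<equiv> hyperobjective f g"

lemma Phi_eq: "\<Phi> x = f (zstar x)"
  by (simp add: hyperobjective_def zstar_def ystar_def)

lemma gderiv_Phi: "GDERIV \<Phi> x :> dir_x f g (zstar x) (vstar x)"
proof -
  text \<open>As the second component of the gradient of \<open>g\<close> vanishes along \<open>zstar\<close>, adding a multiple of
    it to \<open>f\<close> does not change \<open>\<Phi>\<close>; the multiplier \<open>vstar x\<close> makes the derivative independent of
    the \<open>y\<close>-direction, so that differentiability of \<open>ystar\<close> is not needed.\<close>
  define \<psi> where "\<psi> z = f z - inner (snd (grad g z)) (vstar x)" for z
  define d where "d = dir_x f g (zstar x) (vstar x)"
  \<comment> \<open>The derivative of \<psi> pairs the y-part of the second derivative with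
    \<open>vstar x\<close>. Symmetry moves the second derivative onto (0, vstar x), where its
    components are the two Hessian blocks applied to \<open>vstar x\<close>.\<close>
  have sym: "inner (snd (D2 (zstar x) u)) (vstar x) = inner u (D2 (zstar x) (0, vstar x))" for u
    using gradient_derivative_symmetric[OF gderiv_g D2, of "zstar x" u "(0, vstar x)"]
    by (simp add: inner_prod_def)
  have "(\<psi> has_derivative (\<lambda>u. inner u (grad f (zstar x)) - inner (snd (D2 (zstar x) u)) (vstar x))) (at (zstar x))"
    unfolding \<psi>_def using gderiv_f[of "zstar x"] unfolding gderiv_def
    by (intro has_derivative_diff has_derivative_inner_left has_derivative_snd D2)
  also have "(\<lambda>u. inner u (grad f (zstar x)) - inner (snd (D2 (zstar x) u)) (vstar x)) = (\<lambda>u. inner (fst u) d)"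
  proof
    fix u
    have "snd (D2 (zstar x) (0, vstar x)) = snd (grad f (zstar x))"
      using vstar[of x] by (simp add: hess_yy_apply grad_y_f)
    then show "inner u (grad f (zstar x)) - inner (snd (D2 (zstar x) u)) (vstar x) = inner (fst u) d"
      unfolding sym d_def dir_x_def hess_xy_apply grad_x_f by (simp add: inner_prod_def inner_diff_right)
  qed
  finally have \<psi>: "(\<psi> has_derivative (\<lambda>u. inner (fst u) d)) (at (zstar x))" .
  have Phi: "\<Phi> x' = \<psi> (zstar x')" for x'
    using ystar[of x'] by (simp add: \<psi>_def Phi_eq dir_y_eq zstar_def)
  have "(\<Phi> has_derivative (\<lambda>u. inner u d)) (at x)"
    unfolding has_derivative_at_alt
  proof (intro conjI allI impI)
    show "bounded_linear (\<lambda>u. inner u d)" by (rule bounded_linear_inner_left)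
    fix e :: real assume e: "e > 0"
    \<comment> \<open>Differentiability of \<psi> gives an error small relative to the move of
      \<open>zstar\<close>; the Lipschitz constant c of \<open>zstar\<close> makes it small relative
      to the move of x.\<close>
    define c where "c = 1 + Lg / \<mu>"
    have c: "c > 0" using Lg_nonneg mu_pos by (simp add: c_def add_pos_nonneg)
    obtain \<delta> where \<delta>: "\<delta> > 0" "\<And>z. norm (z - zstar x) < \<delta> \<Longrightarrow>
        norm (\<psi> z - \<psi> (zstar x) - inner (fst (z - zstar x)) d) \<le> e / c * norm (z - zstar x)"
      using \<psi> e c unfolding has_derivative_at_alt by (metis divide_pos_pos)
    show "\<exists>\<delta>>0. \<forall>y. norm (y - x) < \<delta> \<longrightarrow> norm (\<Phi> y - \<Phi> x - inner (y - x) d) \<le> e * norm (y - x)"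
    proof (intro exI[of _ "\<delta> / c"] conjI allI impI)
      show "\<delta> / c > 0" using \<delta>(1) c by simp
      fix y assume y: "norm (y - x) < \<delta> / c"
      have n: "norm (zstar y - zstar x) \<le> c * norm (y - x)"
        unfolding c_def by (rule zstar_lipschitz)
      also have "\<dots> < \<delta>" using y c by (simp add: field_simps)
      finally have "norm (\<psi> (zstar y) - \<psi> (zstar x) - inner (fst (zstar y - zstar x)) d)
          \<le> e / c * norm (zstar y - zstar x)" by (rule \<delta>(2))
      also have "\<dots> \<le> e / c * (c * norm (y - x))" using e c by (intro mult_left_mono n) auto
      finally show "norm (\<Phi> y - \<Phi> x - inner (y - x) d) \<le> e * norm (y - x)"
        using c by (simp add: Phi zstar_def)
    qed
  qed
  then show ?thesis by (simp add: gderiv_def d_def)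
qed

lemma grad_Phi: "grad \<Phi> x = dir_x f g (zstar x) (vstar x)"
  by (rule grad_eqI[OF gderiv_Phi])

text \<open>The direction estimate is applied along \<open>zstar\<close> and \<open>vstar\<close>,
  with Cf / \<mu> in the place of M. The constant obtained is
  \<open>(Lf + Cf * Lgg / \<mu>) * (1 + Lg / \<mu>)^2\<close>, with Lgg the maximum of Lgxy and
  Lgyy; the stated one is its expansion.\<close>

lemma grad_Phi_lipschitz:
  "(Lf + (2 * Lf * Lg + Cf * max Lgxy Lgyy) / \<mu> + (Lf * Lg\<^sup>2 + 2 * Cf * Lg * max Lgxy Lgyy) / \<mu>\<^sup>2
      + Cf * Lg\<^sup>2 * max Lgxy Lgyy / \<mu> ^ 3)-lipschitz_on UNIV (grad \<Phi>)" (is "?L-lipschitz_on _ _")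
proof (rule lipschitz_onI)
  let ?Lgg = "max Lgxy Lgyy"
  show "?L \<ge> 0" using Lf_nonneg Lg_nonneg Cf_nonneg Lgg_nonneg mu_pos
    by (intro add_nonneg_nonneg divide_nonneg_nonneg mult_nonneg_nonneg) auto
  fix x x'
  have "norm (grad \<Phi> x' - grad \<Phi> x)
      \<le> (Lf + Cf / \<mu> * ?Lgg) * norm (zstar x' - zstar x) + Lg * norm (vstar x' - vstar x)"
    unfolding grad_Phi by (rule dir_lipschitz(1)[OF norm_vstar])
  also have "\<dots> \<le> (Lf + Cf / \<mu> * ?Lgg) * ((1 + Lg / \<mu>) * norm (x' - x))
      + Lg * ((Lf / \<mu> + Cf * ?Lgg / \<mu>\<^sup>2) * (1 + Lg / \<mu>) * norm (x' - x))"
    using Lf_nonneg Lg_nonneg Cf_nonneg Lgg_nonneg mu_pos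
    by (intro add_mono mult_left_mono zstar_lipschitz vstar_lipschitz add_nonneg_nonneg
        divide_nonneg_nonneg mult_nonneg_nonneg) auto
  also have "\<dots> = ?L * norm (x' - x)"
    by (simp add: divide_inverse algebra_simps power2_eq_square power3_eq_cube)
  finally show "dist (grad \<Phi> x) (grad \<Phi> x') \<le> ?L * dist x x'"
    by (simp add: dist_norm norm_minus_commute)
qed

lemma norm_grad_Phi: "norm (grad \<Phi> x) \<le> Cf + Lg * (Cf / \<mu>)"
  unfolding grad_Phi by (rule dir_bounded(1)[OF norm_vstar])

lemma Phi_lipschitz: "\<bar>\<Phi> x' - \<Phi> x\<bar> \<le> Cf * (1 + Lg / \<mu>) * norm (x' - x)"
  using lip_f[of "zstar x'" "zstar x"] mult_left_mono[OF zstar_lipschitz Cf_nonneg, of x' x]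
  by (simp add: Phi_eq mult.assoc)

end

section \<open>Variance-reduced estimators\<close>

text \<open>Measurability in the sample at each fixed point and continuity in the point for each
  fixed sample combine to joint measurability by approximating the random point with simple
  functions. This is what permits evaluating a fresh sample at an iterate.\<close>

lemma measurable_caratheodory:
  fixes h :: "'s \<Rightarrow> 'p::{metric_space, second_countable_topology} \<Rightarrow> 'e::{metric_space, second_countable_topology}"
  assumes u: "u \<in> borel_measurable N"
    and h: "\<And>p. (\<lambda>s. h s p) \<in> borel_measurable D"
    and cont: "\<And>s. s \<in> space D \<Longrightarrow> continuous_on UNIV (h s)"
  shows "(\<lambda>(\<omega>, s). h s (u \<omega>)) \<in> borel_measurable (N \<Otimes>\<^sub>M D)"
proof -
  obtain w where w: "\<And>i. simple_function N (w i)" "\<And>\<omega>. \<omega> \<in> space N \<Longrightarrow> (\<lambda>i. w i \<omega>) \<longlonglongrightarrow> u \<omega>"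
    using borel_measurable_implies_sequence_metric[OF u] by metis
  show ?thesis
  proof (rule borel_measurable_LIMSEQ_metric)
    fix i
    have "(\<lambda>p. h (snd p) (w i (fst p))) \<in> borel_measurable (N \<Otimes>\<^sub>M D)"
    proof (rule measurable_compose_countable'[where I = "w i ` space N" and f = "\<lambda>c p. h (snd p) c"])
      show "countable (w i ` space N)"
        using w(1) by (simp add: simple_function_def countable_finite)
      have "w i \<in> N \<rightarrow>\<^sub>M count_space UNIV" by (rule measurable_simple_function[OF w(1)])
      then have "w i \<in> N \<rightarrow>\<^sub>M count_space (w i ` space N)"
        by (auto simp: measurable_def)
      then show "(\<lambda>p. w i (fst p)) \<in> N \<Otimes>\<^sub>M D \<rightarrow>\<^sub>M count_space (w i ` space N)"
        by (rule measurable_compose[OF measurable_fst])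
    qed (use measurable_compose[OF measurable_snd h] in auto)
    then show "(\<lambda>(\<omega>, s). h s (w i \<omega>)) \<in> borel_measurable (N \<Otimes>\<^sub>M D)"
      by (simp add: case_prod_beta)
  next
    fix p assume p: "p \<in> space (N \<Otimes>\<^sub>M D)"
    then have "isCont (h (snd p)) (u (fst p))"
      using cont by (simp add: space_pair_measure mem_Times_iff continuous_on_eq_continuous_at)
    then have "(\<lambda>i. h (snd p) (w i (fst p))) \<longlonglongrightarrow> h (snd p) (u (fst p))"
      by (rule isCont_tendsto_compose) (use p w(2) in \<open>simp add: space_pair_measure mem_Times_iff\<close>)
    then show "(\<lambda>i. case p of (\<omega>, s) \<Rightarrow> h s (w i \<omega>)) \<longlonglongrightarrow> (case p of (\<omega>, s) \<Rightarrow> h s (u \<omega>))"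
      by (simp add: case_prod_beta)
  qed
qed

section \<open>Square-integrable random variables\<close>

lemma norm_add_power2_le: "(norm (a + b))\<^sup>2 \<le> 2 * (norm a)\<^sup>2 + 2 * (norm (b::'a::real_normed_vector))\<^sup>2"
  by (rule order_trans[OF power_mono[OF norm_triangle_ineq norm_ge_zero] sum_power2_le])

lemma norm_diff_power2_le: "(norm (a - b))\<^sup>2 \<le> 2 * (norm a)\<^sup>2 + 2 * (norm (b::'a::real_normed_vector))\<^sup>2"
  using norm_add_power2_le[of a "- b"] by simp

lemma norm_power2_add_eq: "(norm (a + b))\<^sup>2 = (norm a)\<^sup>2 + 2 * inner a b + (norm (b::'a::real_inner))\<^sup>2"
  by (simp add: power2_norm_eq_inner inner_add_left inner_add_right inner_commute)

text \<open>Measurability of U is a separate clause because it does not follow from measurability of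
  the squared norm.\<close>

definition sq_integrable :: "'s measure \<Rightarrow> ('s \<Rightarrow> 'e::{real_normed_vector, second_countable_topology}) \<Rightarrow> bool" where
  "sq_integrable P U \<longleftrightarrow> U \<in> borel_measurable P \<and> integrable P (\<lambda>\<omega>. (norm (U \<omega>))\<^sup>2)"

lemma sq_integrable_bound:
  assumes "U \<in> borel_measurable P" and "integrable P B" and "\<And>\<omega>. \<omega> \<in> space P \<Longrightarrow> (norm (U \<omega>))\<^sup>2 \<le> B \<omega>"
  shows "sq_integrable P U"
  unfolding sq_integrable_def
proof
  show "integrable P (\<lambda>\<omega>. (norm (U \<omega>))\<^sup>2)"
    by (rule Bochner_Integration.integrable_bound[OF assms(2)])
       (use assms in \<open>auto intro!: AE_I2 intro: order_trans[OF _ abs_ge_self]\<close>)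
qed (rule assms)

lemma sq_integrable_add:
  assumes "sq_integrable P U" and "sq_integrable P V"
  shows "sq_integrable P (\<lambda>\<omega>. U \<omega> + V \<omega>)"
  by (rule sq_integrable_bound[where B = "\<lambda>\<omega>. 2 * (norm (U \<omega>))\<^sup>2 + 2 * (norm (V \<omega>))\<^sup>2"])
     (use assms norm_add_power2_le in \<open>auto simp: sq_integrable_def\<close>)

lemma sq_integrable_diff:
  assumes "sq_integrable P U" and "sq_integrable P V"
  shows "sq_integrable P (\<lambda>\<omega>. U \<omega> - V \<omega>)"
  by (rule sq_integrable_bound[where B = "\<lambda>\<omega>. 2 * (norm (U \<omega>))\<^sup>2 + 2 * (norm (V \<omega>))\<^sup>2"])
     (use assms norm_diff_power2_le in \<open>auto simp: sq_integrable_def\<close>)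

lemma sq_integrable_scaleR: "sq_integrable P U \<Longrightarrow> sq_integrable P (\<lambda>\<omega>. c *\<^sub>R U \<omega>)"
  by (auto simp: sq_integrable_def power_mult_distrib)

lemma sq_integrable_Pair:
  assumes "sq_integrable P U" and "sq_integrable P V"
  shows "sq_integrable P (\<lambda>\<omega>. (U \<omega>, V \<omega>))"
  using assms by (auto simp: sq_integrable_def norm_Pair)

lemma (in prob_space) sq_integrable_bounded:
  assumes "U \<in> borel_measurable M" and "\<And>\<omega>. \<omega> \<in> space M \<Longrightarrow> norm (U \<omega>) \<le> B"
  shows "sq_integrable M U"
  by (rule sq_integrable_bound[where B = "\<lambda>_. B\<^sup>2"]) (use assms in \<open>auto intro: power_mono\<close>)

lemma (in prob_space) sq_integrable_const: "sq_integrable M (\<lambda>_. c)"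
  by (simp add: sq_integrable_def)

text \<open>A Lipschitz map grows at most linearly, which controls second moments even when the
  argument is unbounded.\<close>

lemma (in prob_space) sq_integrable_lipschitz:
  fixes h :: "'b::{real_normed_vector, second_countable_topology} \<Rightarrow> 'c::{real_normed_vector, second_countable_topology}"
  assumes "sq_integrable M U" and "L-lipschitz_on UNIV h"
  shows "sq_integrable M (\<lambda>\<omega>. h (U \<omega>))"
proof (rule sq_integrable_bound)
  have "h \<in> borel_measurable borel"
    using assms(2) by (intro borel_measurable_continuous_onI lipschitz_on_continuous_on)
  then show "(\<lambda>\<omega>. h (U \<omega>)) \<in> borel_measurable M"
    using assms(1) by (auto simp: sq_integrable_def intro: measurable_compose)
  show "integrable M (\<lambda>\<omega>. 2 * L\<^sup>2 * (norm (U \<omega>))\<^sup>2 + 2 * (norm (h 0))\<^sup>2)"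
    using assms(1) by (simp add: sq_integrable_def)
  fix \<omega>
  have "norm (h (U \<omega>) - h 0) \<le> L * norm (U \<omega>)"
    using lipschitz_onD[OF assms(2), of "U \<omega>" 0] by (simp add: dist_norm)
  then have "(norm (h (U \<omega>) - h 0))\<^sup>2 \<le> L\<^sup>2 * (norm (U \<omega>))\<^sup>2"
    using power_mono[of _ _ 2] by (fastforce simp: power_mult_distrib)
  then show "(norm (h (U \<omega>)))\<^sup>2 \<le> 2 * L\<^sup>2 * (norm (U \<omega>))\<^sup>2 + 2 * (norm (h 0))\<^sup>2"
    using norm_add_power2_le[of "h (U \<omega>) - h 0" "h 0"] by simp
qed

lemma sq_integrable_inner:
  fixes U V :: "'s \<Rightarrow> 'e::euclidean_space"
  assumes "sq_integrable P U" and "sq_integrable P V"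
  shows "integrable P (\<lambda>\<omega>. inner (U \<omega>) (V \<omega>))"
proof (rule Bochner_Integration.integrable_bound)
  show "integrable P (\<lambda>\<omega>. (norm (U \<omega>))\<^sup>2 + (norm (V \<omega>))\<^sup>2)" using assms by (simp add: sq_integrable_def)
  show "(\<lambda>\<omega>. inner (U \<omega>) (V \<omega>)) \<in> borel_measurable P" using assms by (auto simp: sq_integrable_def)
  have "\<bar>inner a b\<bar> \<le> (norm a)\<^sup>2 + (norm b)\<^sup>2" for a b :: 'e
  proof -
    have "\<bar>inner a b\<bar> \<le> norm a * norm b" by (rule Cauchy_Schwarz_ineq2)
    moreover have "0 \<le> (norm a - norm b)\<^sup>2" by simp
    moreover have "0 \<le> norm a * norm b" by simp
    ultimately show ?thesis by (simp add: power2_eq_square algebra_simps)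
  qed
  then show "AE \<omega> in P. norm (inner (U \<omega>) (V \<omega>)) \<le> norm ((norm (U \<omega>))\<^sup>2 + (norm (V \<omega>))\<^sup>2)"
    by (auto intro!: AE_I2)
qed

lemma (in prob_space) variance_le_second_moment:
  fixes X :: "'a \<Rightarrow> 'e::euclidean_space"
  assumes "sq_integrable M X" and "integrable M X"
  shows "sq_integrable M (\<lambda>s. X s - expectation X)"
    and "(\<integral>s. (norm (X s - expectation X))\<^sup>2 \<partial>M) \<le> (\<integral>s. (norm (X s))\<^sup>2 \<partial>M)"
proof -
  show "sq_integrable M (\<lambda>s. X s - expectation X)"
    by (intro sq_integrable_diff assms sq_integrable_const)
  have "(norm (X s - expectation X))\<^sup>2 = (norm (X s))\<^sup>2 - 2 * inner (X s) (expectation X) + (norm (expectation X))\<^sup>2" for s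
    using norm_power2_add_eq[of "X s" "- expectation X"] by simp
  moreover have "(\<integral>s. (norm (X s))\<^sup>2 - 2 * inner (X s) (expectation X) + (norm (expectation X))\<^sup>2 \<partial>M)
      = (\<integral>s. (norm (X s))\<^sup>2 \<partial>M) - 2 * inner (expectation X) (expectation X) + (norm (expectation X))\<^sup>2"
    using assms by (simp add: sq_integrable_def prob_space)
  ultimately show "(\<integral>s. (norm (X s - expectation X))\<^sup>2 \<partial>M) \<le> (\<integral>s. (norm (X s))\<^sup>2 \<partial>M)"
    by (simp add: power2_norm_eq_inner)
qed

section \<open>Fresh samples and the information carried by earlier ones\<close>

locale iid_family = prob_space P for P :: "'s measure" +
  fixes D :: "'d measure" and Z :: "'i \<Rightarrow> 's \<Rightarrow> 'd" and I :: "'i set"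
  assumes D: "prob_space D"
    and indep: "indep_vars (\<lambda>_. D) Z I"
    and distr_Z: "\<And>i. i \<in> I \<Longrightarrow> distr P D (Z i) = D"
begin

text \<open>\<open>past A\<close> carries the \<open>\<sigma>\<close>-algebra generated by the samples with index in \<open>A\<close>; its measure is never used.\<close>

definition past :: "'i set \<Rightarrow> 's measure" where
  "past A = vimage_algebra (space P) (\<lambda>\<omega>. \<lambda>i\<in>A. Z i \<omega>) (PiM A (\<lambda>_. D))"

lemma space_past [simp]: "space (past A) = space P"
  by (simp add: past_def)

lemma Z_random: "i \<in> I \<Longrightarrow> random_variable D (Z i)"
  using indep by (simp add: indep_vars_def)

lemma restrict_random: "A \<subseteq> I \<Longrightarrow> random_variable (PiM A (\<lambda>_. D)) (\<lambda>\<omega>. \<lambda>i\<in>A. Z i \<omega>)"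
  by (intro measurable_restrict Z_random) auto

lemma restrict_past: "A \<subseteq> I \<Longrightarrow> (\<lambda>\<omega>. \<lambda>i\<in>A. Z i \<omega>) \<in> past A \<rightarrow>\<^sub>M PiM A (\<lambda>_. D)"
  unfolding past_def by (rule measurable_vimage_algebra1) (use measurable_space[OF restrict_random] in auto)

lemma Z_past:
  assumes "i \<in> A" "A \<subseteq> I"
  shows "Z i \<in> past A \<rightarrow>\<^sub>M D"
proof -
  have "(\<lambda>\<omega>. (\<lambda>i\<in>A. Z i \<omega>) i) \<in> past A \<rightarrow>\<^sub>M D"
    by (rule measurable_compose[OF restrict_past[OF assms(2)] measurable_component_singleton[OF assms(1)]])
  then show ?thesis using assms(1) by simp
qed

lemma past_mono:
  assumes "f \<in> past A \<rightarrow>\<^sub>M N" "A \<subseteq> B" "B \<subseteq> I"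
  shows "f \<in> past B \<rightarrow>\<^sub>M N"
proof -
  have "(\<lambda>\<omega>. \<omega>) \<in> past B \<rightarrow>\<^sub>M past A"
    unfolding past_def[of A]
    by (rule measurable_vimage_algebra2) (use assms in \<open>auto intro!: measurable_restrict Z_past\<close>)
  from measurable_compose[OF this assms(1)] show ?thesis by simp
qed

lemma id_past: "A \<subseteq> I \<Longrightarrow> (\<lambda>\<omega>. \<omega>) \<in> P \<rightarrow>\<^sub>M past A"
  unfolding past_def by (rule measurable_vimage_algebra2, simp, rule restrict_random)

lemma past_random:
  assumes "f \<in> past A \<rightarrow>\<^sub>M N" "A \<subseteq> I"
  shows "random_variable N f"
  by (rule measurable_compose[OF id_past[OF assms(2)] assms(1)])

text \<open>The substitute for conditional expectation: the first component is seen only through the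
  samples in A, and a sample outside A is independent of that information. It suffices to compare
  rectangles. A set of the past is the preimage of an event about the samples in A, so independence
  of disjoint index sets applies.\<close>

lemma past_pair_distr:
  assumes "A \<subseteq> I" "i \<in> I" "i \<notin> A"
  shows "distr P (past A) (\<lambda>\<omega>. \<omega>) \<Otimes>\<^sub>M D = distr P (past A \<Otimes>\<^sub>M D) (\<lambda>\<omega>. (\<omega>, Z i \<omega>))"
proof (rule pair_measure_eqI)
  note id = id_past[OF assms(1)] and Zi = Z_random[OF assms(2)]
  show "sigma_finite_measure (distr P (past A) (\<lambda>\<omega>. \<omega>))"
    by (intro prob_space_imp_sigma_finite prob_space_distr id)
  show "sigma_finite_measure D" by (intro prob_space_imp_sigma_finite D)
  show "sets (distr P (past A) (\<lambda>\<omega>. \<omega>) \<Otimes>\<^sub>M D) = sets (distr P (past A \<Otimes>\<^sub>M D) (\<lambda>\<omega>. (\<omega>, Z i \<omega>)))"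
    by (simp cong: sets_pair_measure_cong)
  fix X Y assume X: "X \<in> sets (distr P (past A) (\<lambda>\<omega>. \<omega>))" and Y: "Y \<in> sets D"
  obtain X' where X': "X' \<in> sets (PiM A (\<lambda>_. D))" "X = (\<lambda>\<omega>. \<lambda>i\<in>A. Z i \<omega>) -` X' \<inter> space P"
  proof -
    have "sets (past A) = {(\<lambda>\<omega>. \<lambda>i\<in>A. Z i \<omega>) -` B \<inter> space P |B. B \<in> sets (PiM A (\<lambda>_. D))}"
      unfolding past_def
      by (rule sets_vimage_algebra2) (use measurable_space[OF restrict_random[OF assms(1)]] in auto)
    then show thesis using X that by auto
  qed
  define Y' where "Y' = (\<lambda>x. x i) -` Y \<inter> space (PiM {i} (\<lambda>_. D))"
  have Y': "Y' \<in> sets (PiM {i} (\<lambda>_. D))"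
    unfolding Y'_def using Y by (intro measurable_sets[OF measurable_component_singleton]) auto
  have YZ: "(\<lambda>\<omega>. \<lambda>j\<in>{i}. Z j \<omega>) -` Y' \<inter> space P = Z i -` Y \<inter> space P"
    unfolding Y'_def using measurable_space[OF Zi] by (auto simp: space_PiM)
  have "indep_var (PiM A (\<lambda>_. D)) (\<lambda>\<omega>. \<lambda>i\<in>A. Z i \<omega>) (PiM {i} (\<lambda>_. D)) (\<lambda>\<omega>. \<lambda>j\<in>{i}. Z j \<omega>)"
    by (rule indep_var_restrict[OF indep]) (use assms in auto)
  from indep_varD[OF this X'(1) Y']
  have "prob (X \<inter> (Z i -` Y \<inter> space P)) = prob X * prob (Z i -` Y \<inter> space P)"
  proof -
    have "(\<lambda>\<omega>. (\<lambda>i\<in>A. Z i \<omega>, \<lambda>j\<in>{i}. Z j \<omega>)) -` (X' \<times> Y') \<inter> space P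
        = X \<inter> ((\<lambda>\<omega>. \<lambda>j\<in>{i}. Z j \<omega>) -` Y' \<inter> space P)"
      unfolding X'(2) by auto
    then show "prob ((\<lambda>\<omega>. (\<lambda>i\<in>A. Z i \<omega>, \<lambda>j\<in>{i}. Z j \<omega>)) -` (X' \<times> Y') \<inter> space P)
        = prob ((\<lambda>\<omega>. \<lambda>i\<in>A. Z i \<omega>) -` X' \<inter> space P) * prob ((\<lambda>\<omega>. \<lambda>j\<in>{i}. Z j \<omega>) -` Y' \<inter> space P)
      \<Longrightarrow> prob (X \<inter> (Z i -` Y \<inter> space P)) = prob X * prob (Z i -` Y \<inter> space P)"
      unfolding YZ X'(2)[symmetric] by simp
  qed
  moreover have "emeasure D Y = prob (Z i -` Y \<inter> space P)"
    using distr_Z[OF assms(2)] emeasure_distr[OF Zi Y] by (simp add: emeasure_eq_measure)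
  moreover have "emeasure (distr P (past A) (\<lambda>\<omega>. \<omega>)) X = prob X"
    using X X'(2) emeasure_distr[OF id, of X] by (simp add: emeasure_eq_measure Int_assoc)
  moreover have "emeasure (distr P (past A \<Otimes>\<^sub>M D) (\<lambda>\<omega>. (\<omega>, Z i \<omega>))) (X \<times> Y) = prob (X \<inter> (Z i -` Y \<inter> space P))"
  proof -
    have "(\<lambda>\<omega>. (\<omega>, Z i \<omega>)) -` (X \<times> Y) \<inter> space P = X \<inter> (Z i -` Y \<inter> space P)" by auto
    moreover have "X \<times> Y \<in> sets (past A \<Otimes>\<^sub>M D)" using X Y by auto
    ultimately show ?thesis
      by (subst emeasure_distr[OF measurable_Pair[OF id Zi]]) (auto simp: emeasure_eq_measure)
  qed
  ultimately show "emeasure (distr P (past A) (\<lambda>\<omega>. \<omega>)) X * emeasure D Y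
      = emeasure (distr P (past A \<Otimes>\<^sub>M D) (\<lambda>\<omega>. (\<omega>, Z i \<omega>))) (X \<times> Y)"
    by (simp add: ennreal_mult)
qed

text \<open>One step of a martingale. For a frozen \<omega> the map \<open>h \<omega>\<close> has
  mean zero in the sample, and e depends on the past only, so the cross term integrates to zero and
  second moments add. In the applications c is the reciprocal of the batch size.\<close>

lemma fresh_sample_noise:
  fixes e :: "'s \<Rightarrow> 'e::euclidean_space" and h :: "'s \<Rightarrow> 'd \<Rightarrow> 'e" and c :: real
  assumes A: "A \<subseteq> I" "i \<in> I" "i \<notin> A"
    and e: "e \<in> borel_measurable (past A)" "sq_integrable P e"
    and h: "(\<lambda>(\<omega>, s). h \<omega> s) \<in> borel_measurable (past A \<Otimes>\<^sub>M D)"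
    and mean: "\<And>\<omega>. \<omega> \<in> space P \<Longrightarrow> (\<integral>s. h \<omega> s \<partial>D) = 0"
    and int2: "\<And>\<omega>. \<omega> \<in> space P \<Longrightarrow> integrable D (\<lambda>s. (norm (h \<omega> s))\<^sup>2)"
    and bound: "\<And>\<omega>. \<omega> \<in> space P \<Longrightarrow> (\<integral>s. (norm (h \<omega> s))\<^sup>2 \<partial>D) \<le> B \<omega>"
    and B: "integrable P B"
  defines "W \<equiv> \<lambda>\<omega>. e \<omega> + c *\<^sub>R h \<omega> (Z i \<omega>)"
  shows "W \<in> borel_measurable (past (insert i A))" and "sq_integrable P W"
    and "(\<integral>\<omega>. (norm (W \<omega>))\<^sup>2 \<partial>P) \<le> (\<integral>\<omega>. (norm (e \<omega>))\<^sup>2 \<partial>P) + c\<^sup>2 * (\<integral>\<omega>. B \<omega> \<partial>P)"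
proof -
  interpret D: prob_space D by (rule D)
  define Q where "Q = distr P (past A) (\<lambda>\<omega>. \<omega>)"
  have idQ: "(\<lambda>\<omega>. \<omega>) \<in> P \<rightarrow>\<^sub>M past A" by (rule id_past[OF A(1)])
  interpret Q: prob_space Q unfolding Q_def by (rule prob_space_distr[OF idQ])
  interpret QD: pair_prob_space Q D ..
  have setsQ: "sets (Q \<Otimes>\<^sub>M D) = sets (past A \<Otimes>\<^sub>M D)"
    by (intro sets_pair_measure_cong) (auto simp: Q_def)
  have spaceQ: "space Q = space P" by (simp add: Q_def)
  define J where "J \<omega> = (\<omega>, Z i \<omega>)" for \<omega>
  have J: "J \<in> P \<rightarrow>\<^sub>M past A \<Otimes>\<^sub>M D"
    unfolding J_def by (intro measurable_Pair idQ Z_random A)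
  have joint: "Q \<Otimes>\<^sub>M D = distr P (past A \<Otimes>\<^sub>M D) J"
    unfolding Q_def J_def by (rule past_pair_distr[OF A])
  have iA: "insert i A \<subseteq> I" using A by auto
  have Jpast: "J \<in> past (insert i A) \<rightarrow>\<^sub>M past A \<Otimes>\<^sub>M D"
  proof -
    have "(\<lambda>\<omega>. \<omega>) \<in> past A \<rightarrow>\<^sub>M past A" by simp
    from past_mono[OF this subset_insertI iA] show ?thesis
      unfolding J_def by (rule measurable_Pair) (use iA in \<open>auto intro: Z_past\<close>)
  qed
  define H where "H \<omega> = h \<omega> (Z i \<omega>)" for \<omega>
  have Hpast: "H \<in> borel_measurable (past (insert i A))"
    using measurable_compose[OF Jpast h] by (simp add: J_def H_def[abs_def])
  then show Wpast: "W \<in> borel_measurable (past (insert i A))"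
    unfolding W_def H_def[symmetric]
    by (intro borel_measurable_add borel_measurable_scaleR past_mono[OF e(1)] iA) auto
  note Hm = past_random[OF Hpast iA]
  have h': "(\<lambda>(\<omega>, s). h \<omega> s) \<in> borel_measurable (Q \<Otimes>\<^sub>M D)"
    using h measurable_cong_sets[OF setsQ refl] by blast
  have hm: "h \<omega> \<in> borel_measurable D" if "\<omega> \<in> space P" for \<omega>
    using measurable_compose[OF measurable_Pair1'[of \<omega> Q D] h'] that by (simp add: spaceQ)
  \<comment> \<open>Nonnegative integrals come first, because square integrability of the noise is
    itself to be shown; Tonelli applies before it is known.\<close>
  have nn: "(\<integral>\<^sup>+\<omega>. ennreal ((norm (H \<omega>))\<^sup>2) \<partial>P) \<le> ennreal (\<integral>\<omega>. B \<omega> \<partial>P)"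
  proof -
    have B0: "B \<omega> \<ge> 0" if "\<omega> \<in> space P" for \<omega>
      by (rule order_trans[OF _ bound[OF that]]) simp
    have "(\<integral>\<^sup>+\<omega>. ennreal ((norm (H \<omega>))\<^sup>2) \<partial>P)
        = (\<integral>\<^sup>+p. ennreal ((norm (case p of (\<omega>, s) \<Rightarrow> h \<omega> s))\<^sup>2) \<partial>(Q \<Otimes>\<^sub>M D))"
      unfolding joint using h by (subst nn_integral_distr[OF J]) (auto simp: J_def H_def)
    also have "\<dots> = (\<integral>\<^sup>+\<omega>. \<integral>\<^sup>+s. ennreal ((norm (h \<omega> s))\<^sup>2) \<partial>D \<partial>Q)"
      using h' by (subst D.nn_integral_fst[symmetric]) auto
    also have "\<dots> \<le> (\<integral>\<^sup>+\<omega>. ennreal (\<integral>s. (norm (h \<omega> s))\<^sup>2 \<partial>D) \<partial>Q)"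
      using int2 by (intro nn_integral_mono) (simp add: spaceQ nn_integral_eq_integral)
    also have "\<dots> = (\<integral>\<^sup>+\<omega>. ennreal (\<integral>s. (norm (h \<omega> s))\<^sup>2 \<partial>D) \<partial>P)"
    proof -
      have "(\<lambda>\<omega>. \<integral>s. (norm (case (\<omega>, s) of (\<omega>, s) \<Rightarrow> h \<omega> s))\<^sup>2 \<partial>D) \<in> borel_measurable (past A)"
        by (rule D.borel_measurable_lebesgue_integral) (use h in \<open>simp add: case_prod_beta\<close>)
      then show ?thesis unfolding Q_def by (subst nn_integral_distr[OF idQ]) auto
    qed
    also have "\<dots> \<le> (\<integral>\<^sup>+\<omega>. ennreal (B \<omega>) \<partial>P)"
      using bound by (intro nn_integral_mono) (auto intro: ennreal_leI)
    also have "\<dots> = ennreal (\<integral>\<omega>. B \<omega> \<partial>P)"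
      by (rule nn_integral_eq_integral[OF B]) (use B0 in auto)
    finally show ?thesis .
  qed
  have Hsq: "sq_integrable P H"
    unfolding sq_integrable_def
  proof
    show "integrable P (\<lambda>\<omega>. (norm (H \<omega>))\<^sup>2)"
      by (rule integrableI_bounded) (use Hm nn in \<open>auto simp: le_less_trans ennreal_less_top\<close>)
  qed (rule Hm)
  have H2: "(\<integral>\<omega>. (norm (H \<omega>))\<^sup>2 \<partial>P) \<le> (\<integral>\<omega>. B \<omega> \<partial>P)"
  proof -
    have "(\<integral>\<omega>. B \<omega> \<partial>P) \<ge> 0"
      by (intro integral_nonneg_AE AE_I2 order_trans[OF _ bound]) simp_all
    moreover have "ennreal (\<integral>\<omega>. (norm (H \<omega>))\<^sup>2 \<partial>P) \<le> ennreal (\<integral>\<omega>. B \<omega> \<partial>P)"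
      using nn Hsq by (simp add: nn_integral_eq_integral sq_integrable_def)
    ultimately show ?thesis by (simp add: ennreal_le_iff)
  qed
  have cross: "(\<integral>\<omega>. inner (e \<omega>) (H \<omega>) \<partial>P) = 0"
  proof -
    define k where "k p = inner (e (fst p)) (h (fst p) (snd p))" for p
    have km: "k \<in> borel_measurable (past A \<Otimes>\<^sub>M D)"
      unfolding k_def using h measurable_compose[OF measurable_fst e(1)]
      by (intro borel_measurable_inner) (auto simp: case_prod_beta)
    have kJ: "k (J \<omega>) = inner (e \<omega>) (H \<omega>)" for \<omega> by (simp add: k_def J_def H_def)
    have "integrable P (\<lambda>\<omega>. k (J \<omega>))" unfolding kJ by (rule sq_integrable_inner[OF e(2) Hsq])
    then have ki: "integrable (Q \<Otimes>\<^sub>M D) k" unfolding joint by (simp add: integrable_distr_eq[OF J km])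
    have "(\<integral>\<omega>. inner (e \<omega>) (H \<omega>) \<partial>P) = integral\<^sup>L (Q \<Otimes>\<^sub>M D) k"
      unfolding joint by (subst integral_distr[OF J km]) (simp add: kJ)
    also have "\<dots> = (\<integral>\<omega>. (\<integral>s. k (\<omega>, s) \<partial>D) \<partial>Q)" by (rule QD.integral_fst'[OF ki, symmetric])
    also have "\<dots> = (\<integral>\<omega>. 0 \<partial>Q)"
    proof (rule Bochner_Integration.integral_cong[OF refl])
      fix \<omega> assume "\<omega> \<in> space Q"
      then have \<omega>: "\<omega> \<in> space P" by (simp add: spaceQ)
      have "integrable D (h \<omega>)"
      proof (rule Bochner_Integration.integrable_bound)
        show "integrable D (\<lambda>s. 1 + (norm (h \<omega> s))\<^sup>2)" using int2[OF \<omega>] by simp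
        \<comment> \<open>On a probability space a finite second moment gives a finite first moment
          through this elementary bound.\<close>
        have "norm x \<le> 1 + (norm x)\<^sup>2" for x :: 'e
          using zero_le_power2[of "norm x - 1/2"] by (simp add: power2_eq_square algebra_simps)
        then show "AE s in D. norm (h \<omega> s) \<le> norm (1 + (norm (h \<omega> s))\<^sup>2)"
          by (auto intro!: AE_I2 intro: order_trans[OF _ abs_ge_self])
      qed (rule hm[OF \<omega>])
      then show "(\<integral>s. k (\<omega>, s) \<partial>D) = 0" using mean[OF \<omega>] by (simp add: k_def)
    qed
    finally show ?thesis by simp
  qed
  have Wsq: "(norm (W \<omega>))\<^sup>2 = (norm (e \<omega>))\<^sup>2 + 2 * c * inner (e \<omega>) (H \<omega>) + c\<^sup>2 * (norm (H \<omega>))\<^sup>2" for \<omega>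
    unfolding W_def H_def by (simp add: norm_power2_add_eq power_mult_distrib)
  show "sq_integrable P W"
    unfolding W_def H_def[symmetric] by (intro sq_integrable_add sq_integrable_scaleR e Hsq)
  have "(\<integral>\<omega>. (norm (W \<omega>))\<^sup>2 \<partial>P)
      = (\<integral>\<omega>. (norm (e \<omega>))\<^sup>2 \<partial>P) + 2 * c * (\<integral>\<omega>. inner (e \<omega>) (H \<omega>) \<partial>P) + c\<^sup>2 * (\<integral>\<omega>. (norm (H \<omega>))\<^sup>2 \<partial>P)"
    unfolding Wsq using e(2) Hsq sq_integrable_inner[OF e(2) Hsq] by (simp add: sq_integrable_def)
  also have "\<dots> \<le> (\<integral>\<omega>. (norm (e \<omega>))\<^sup>2 \<partial>P) + c\<^sup>2 * (\<integral>\<omega>. B \<omega> \<partial>P)"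
    using cross H2 by (simp add: mult_left_mono)
  finally show "(\<integral>\<omega>. (norm (W \<omega>))\<^sup>2 \<partial>P) \<le> (\<integral>\<omega>. (norm (e \<omega>))\<^sup>2 \<partial>P) + c\<^sup>2 * (\<integral>\<omega>. B \<omega> \<partial>P)" .
qed

lemma measurable_past_pair_mono:
  assumes "f \<in> past A \<Otimes>\<^sub>M D \<rightarrow>\<^sub>M N" "A \<subseteq> B" "B \<subseteq> I"
  shows "f \<in> past B \<Otimes>\<^sub>M D \<rightarrow>\<^sub>M N"
proof -
  have "(\<lambda>p. (fst p, snd p)) \<in> past B \<Otimes>\<^sub>M D \<rightarrow>\<^sub>M past A \<Otimes>\<^sub>M D"
    by (intro measurable_Pair measurable_snd measurable_compose[OF measurable_fst] past_mono[OF _ assms(2,3)])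
       (simp add: measurable_ident)
  from measurable_compose[OF this assms(1)] show ?thesis by simp
qed

text \<open>The samples of a batch are revealed one at a time. The partial sum joins the past before
  the next sample is added, while h depends only on the past before the batch, so each sample
  contributes at most c^2 times the integral of B.\<close>

lemma batch_noise:
  fixes e :: "'s \<Rightarrow> 'e::euclidean_space" and h :: "'s \<Rightarrow> 'd \<Rightarrow> 'e" and idx :: "nat \<Rightarrow> 'i" and c :: real
  assumes A: "A \<subseteq> I" and idx: "inj idx" "\<And>j. j < n \<Longrightarrow> idx j \<in> I - A"
    and e: "e \<in> borel_measurable (past A)" "sq_integrable P e"
    and h: "(\<lambda>(\<omega>, s). h \<omega> s) \<in> borel_measurable (past A \<Otimes>\<^sub>M D)"
    and mean: "\<And>\<omega>. \<omega> \<in> space P \<Longrightarrow> (\<integral>s. h \<omega> s \<partial>D) = 0"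
    and int2: "\<And>\<omega>. \<omega> \<in> space P \<Longrightarrow> integrable D (\<lambda>s. (norm (h \<omega> s))\<^sup>2)"
    and bound: "\<And>\<omega>. \<omega> \<in> space P \<Longrightarrow> (\<integral>s. (norm (h \<omega> s))\<^sup>2 \<partial>D) \<le> B \<omega>"
    and B: "integrable P B"
  defines "W \<equiv> \<lambda>n \<omega>. e \<omega> + c *\<^sub>R (\<Sum>j<n. h \<omega> (Z (idx j) \<omega>))"
  shows "W n \<in> borel_measurable (past (A \<union> idx ` {..<n})) \<and> sq_integrable P (W n)
    \<and> (\<integral>\<omega>. (norm (W n \<omega>))\<^sup>2 \<partial>P) \<le> (\<integral>\<omega>. (norm (e \<omega>))\<^sup>2 \<partial>P) + real n * (c\<^sup>2 * (\<integral>\<omega>. B \<omega> \<partial>P))"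
  using idx(2)
proof (induction n)
  case 0
  then show ?case using e by (simp add: W_def)
next
  case (Suc n)
  let ?A = "A \<union> idx ` {..<n}"
  have IH: "W n \<in> borel_measurable (past ?A)" "sq_integrable P (W n)"
    "(\<integral>\<omega>. (norm (W n \<omega>))\<^sup>2 \<partial>P) \<le> (\<integral>\<omega>. (norm (e \<omega>))\<^sup>2 \<partial>P) + real n * (c\<^sup>2 * (\<integral>\<omega>. B \<omega> \<partial>P))"
    using Suc by auto
  have A': "?A \<subseteq> I" "idx n \<in> I" "idx n \<notin> ?A"
    using A Suc.prems[of n] Suc.prems[OF less_SucI] by (auto simp: inj_eq[OF idx(1)])
  have eq: "W (Suc n) = (\<lambda>\<omega>. W n \<omega> + c *\<^sub>R h \<omega> (Z (idx n) \<omega>))"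
    by (simp add: W_def scaleR_add_right add.assoc)
  have ins: "A \<union> idx ` {..<Suc n} = insert (idx n) ?A" by (auto simp: less_Suc_eq)
  note step = fresh_sample_noise[OF A' IH(1,2) measurable_past_pair_mono[OF h _ A'(1)] mean int2 bound B, where c = c]
  show ?case
    unfolding eq ins using step IH(3) by (auto simp: algebra_simps)
qed

text \<open>The new error is the old error plus the batch average of the increments
  \<open>h s (u' \<omega>) - h s (u \<omega>)\<close>, centred by their mean. Both points use the
  same samples, which is what makes the increments small. Centring does not increase the second
  moment, so each contributes at most B, and averaging n of them divides by n.\<close>

lemma spider_update:
  fixes h :: "'d \<Rightarrow> 'p::{metric_space, second_countable_topology} \<Rightarrow> 'e::euclidean_space" and H :: "'p \<Rightarrow> 'e"
    and idx :: "nat \<Rightarrow> 'i"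
  assumes A: "A \<subseteq> I" and idx: "inj idx" "\<And>j. j < n \<Longrightarrow> idx j \<in> I - A" and "n > 0"
    and cont: "\<And>s. s \<in> space D \<Longrightarrow> continuous_on UNIV (h s)" and Hcont: "continuous_on UNIV H"
    and mean: "\<And>p. integrable D (\<lambda>s. h s p)" "\<And>p. (\<integral>s. h s p \<partial>D) = H p"
    and u: "u \<in> borel_measurable (past A)" and u': "u' \<in> borel_measurable (past A)"
    and d: "d \<in> borel_measurable (past A)" "sq_integrable P (\<lambda>\<omega>. d \<omega> - H (u \<omega>))"
    and B: "integrable P B"
    and bound: "\<And>\<omega> s. \<omega> \<in> space P \<Longrightarrow> s \<in> space D \<Longrightarrow> (norm (h s (u' \<omega>) - h s (u \<omega>)))\<^sup>2 \<le> B \<omega>"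
  defines "d' \<equiv> \<lambda>\<omega>. (\<Sum>j<n. h (Z (idx j) \<omega>) (u' \<omega>)) /\<^sub>R real n + (d \<omega> - (\<Sum>j<n. h (Z (idx j) \<omega>) (u \<omega>)) /\<^sub>R real n)"
  shows "d' \<in> borel_measurable (past (A \<union> idx ` {..<n}))"
    and "sq_integrable P (\<lambda>\<omega>. d' \<omega> - H (u' \<omega>))"
    and "(\<integral>\<omega>. (norm (d' \<omega> - H (u' \<omega>)))\<^sup>2 \<partial>P) \<le> (\<integral>\<omega>. (norm (d \<omega> - H (u \<omega>)))\<^sup>2 \<partial>P) + (\<integral>\<omega>. B \<omega> \<partial>P) / real n"
proof -
  interpret D: prob_space D by (rule D)
  have Hb: "H \<in> borel_measurable borel" using Hcont by (rule borel_measurable_continuous_onI)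
  have hm: "(\<lambda>s. h s p) \<in> borel_measurable D" for p using mean(1) by (rule borel_measurable_integrable)
  define k where "k \<omega> s = (h s (u' \<omega>) - h s (u \<omega>)) - (H (u' \<omega>) - H (u \<omega>))" for \<omega> s
  have kh: "(\<lambda>(\<omega>, s). k \<omega> s) \<in> borel_measurable (past A \<Otimes>\<^sub>M D)"
  proof -
    have "(\<lambda>p. H (w (fst p))) \<in> borel_measurable (past A \<Otimes>\<^sub>M D)" if "w \<in> borel_measurable (past A)" for w
      by (rule measurable_compose[OF measurable_compose[OF measurable_fst that] Hb])
    then show ?thesis
      unfolding k_def using measurable_caratheodory[OF u hm cont] measurable_caratheodory[OF u' hm cont] u u'
      by (simp add: case_prod_beta)
  qed
  have diff: "sq_integrable D (\<lambda>s. h s (u' \<omega>) - h s (u \<omega>))" if "\<omega> \<in> space P" for \<omega>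
    by (rule sq_integrable_bound[where B = "\<lambda>_. B \<omega>"]) (use bound[OF that] hm in auto)
  have diff_mean: "integrable D (\<lambda>s. h s (u' \<omega>) - h s (u \<omega>))"
    "(\<integral>s. h s (u' \<omega>) - h s (u \<omega>) \<partial>D) = H (u' \<omega>) - H (u \<omega>)" for \<omega>
    using mean by auto
  have k_mean: "(\<integral>s. k \<omega> s \<partial>D) = 0" for \<omega>
    unfolding k_def using diff_mean[of \<omega>] by (simp add: D.prob_space)
  have k_sq: "integrable D (\<lambda>s. (norm (k \<omega> s))\<^sup>2)" "(\<integral>s. (norm (k \<omega> s))\<^sup>2 \<partial>D) \<le> B \<omega>" if "\<omega> \<in> space P" for \<omega>
  proof -
    note v = D.variance_le_second_moment[OF diff[OF that] diff_mean(1)]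
    show "integrable D (\<lambda>s. (norm (k \<omega> s))\<^sup>2)" using v(1) by (simp add: k_def diff_mean(2) sq_integrable_def)
    have "(\<integral>s. (norm (k \<omega> s))\<^sup>2 \<partial>D) \<le> (\<integral>s. (norm (h s (u' \<omega>) - h s (u \<omega>)))\<^sup>2 \<partial>D)"
      using v(2) by (simp add: k_def diff_mean(2))
    also have "\<dots> \<le> (\<integral>s. B \<omega> \<partial>D)"
      using diff[OF that] bound[OF that] by (intro integral_mono) (auto simp: sq_integrable_def)
    finally show "(\<integral>s. (norm (k \<omega> s))\<^sup>2 \<partial>D) \<le> B \<omega>" by (simp add: D.prob_space)
  qed
  have e: "(\<lambda>\<omega>. d \<omega> - H (u \<omega>)) \<in> borel_measurable (past A)"
    using d(1) measurable_compose[OF u Hb] by simp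
  note noise = batch_noise[OF A idx e d(2) kh k_mean k_sq B, where c = "1 / real n"]
  define W where "W \<omega> = (d \<omega> - H (u \<omega>)) + (1 / real n) *\<^sub>R (\<Sum>j<n. k \<omega> (Z (idx j) \<omega>))" for \<omega>
  have W: "d' \<omega> - H (u' \<omega>) = W \<omega>" for \<omega>
  proof -
    have "(1 / real n) *\<^sub>R (\<Sum>j<n. k \<omega> (Z (idx j) \<omega>))
        = (1 / real n) *\<^sub>R ((\<Sum>j<n. h (Z (idx j) \<omega>) (u' \<omega>)) - (\<Sum>j<n. h (Z (idx j) \<omega>) (u \<omega>)))
          - (H (u' \<omega>) - H (u \<omega>))"
      using \<open>n > 0\<close> unfolding k_def sum_subtractf
      by (simp add: scaleR_diff_right sum_constant_scaleR)
    then show ?thesis unfolding W_def d'_def by (simp add: scaleR_diff_right divide_inverse)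
  qed
  have n: "W \<in> borel_measurable (past (A \<union> idx ` {..<n}))" "sq_integrable P W"
    "(\<integral>\<omega>. (norm (W \<omega>))\<^sup>2 \<partial>P) \<le> (\<integral>\<omega>. (norm (d \<omega> - H (u \<omega>)))\<^sup>2 \<partial>P) + real n * ((1 / real n)\<^sup>2 * (\<integral>\<omega>. B \<omega> \<partial>P))"
    using noise by (auto simp: W_def[abs_def])
  have sub: "A \<union> idx ` {..<n} \<subseteq> I" using A idx(2) by auto
  have "(\<lambda>\<omega>. H (u' \<omega>)) \<in> borel_measurable (past (A \<union> idx ` {..<n}))"
    by (rule past_mono[OF measurable_compose[OF u' Hb] _ sub]) auto
  then have "(\<lambda>\<omega>. W \<omega> + H (u' \<omega>)) \<in> borel_measurable (past (A \<union> idx ` {..<n}))" using n(1) by simp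
  then show "d' \<in> borel_measurable (past (A \<union> idx ` {..<n}))" unfolding W[symmetric] by simp
  show "sq_integrable P (\<lambda>\<omega>. d' \<omega> - H (u' \<omega>))" using n(2) by (simp add: W)
  show "(\<integral>\<omega>. (norm (d' \<omega> - H (u' \<omega>)))\<^sup>2 \<partial>P) \<le> (\<integral>\<omega>. (norm (d \<omega> - H (u \<omega>)))\<^sup>2 \<partial>P) + (\<integral>\<omega>. B \<omega> \<partial>P) / real n"
    using n(3) \<open>n > 0\<close> by (simp add: W power2_eq_square)
qed

text \<open>Nothing is inherited: the error is an average of n centred samples, started from the
  zero error.\<close>

lemma spider_refresh:
  fixes h :: "'d \<Rightarrow> 'p::{metric_space, second_countable_topology} \<Rightarrow> 'e::euclidean_space" and H :: "'p \<Rightarrow> 'e"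
    and idx :: "nat \<Rightarrow> 'i"
  assumes A: "A \<subseteq> I" and idx: "inj idx" "\<And>j. j < n \<Longrightarrow> idx j \<in> I - A" and "n > 0"
    and cont: "\<And>s. s \<in> space D \<Longrightarrow> continuous_on UNIV (h s)" and Hcont: "continuous_on UNIV H"
    and mean: "\<And>p. integrable D (\<lambda>s. h s p)" "\<And>p. (\<integral>s. h s p \<partial>D) = H p"
    and u: "u \<in> borel_measurable (past A)"
    and var: "\<And>\<omega>. \<omega> \<in> space P \<Longrightarrow> integrable D (\<lambda>s. (norm (h s (u \<omega>) - H (u \<omega>)))\<^sup>2)"
      "\<And>\<omega>. \<omega> \<in> space P \<Longrightarrow> (\<integral>s. (norm (h s (u \<omega>) - H (u \<omega>)))\<^sup>2 \<partial>D) \<le> V"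
  defines "d \<equiv> \<lambda>\<omega>. (\<Sum>j<n. h (Z (idx j) \<omega>) (u \<omega>)) /\<^sub>R real n"
  shows "d \<in> borel_measurable (past (A \<union> idx ` {..<n}))"
    and "sq_integrable P (\<lambda>\<omega>. d \<omega> - H (u \<omega>))"
    and "(\<integral>\<omega>. (norm (d \<omega> - H (u \<omega>)))\<^sup>2 \<partial>P) \<le> V / real n"
proof -
  interpret D: prob_space D by (rule D)
  have Hb: "H \<in> borel_measurable borel" using Hcont by (rule borel_measurable_continuous_onI)
  have hm: "(\<lambda>s. h s p) \<in> borel_measurable D" for p using mean(1) by (rule borel_measurable_integrable)
  define k where "k \<omega> s = h s (u \<omega>) - H (u \<omega>)" for \<omega> s
  have kh: "(\<lambda>(\<omega>, s). k \<omega> s) \<in> borel_measurable (past A \<Otimes>\<^sub>M D)"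
    unfolding k_def using measurable_caratheodory[OF u hm cont]
      measurable_compose[OF measurable_compose[OF measurable_fst u] Hb, of D]
    by (simp add: case_prod_beta)
  have k_mean: "(\<integral>s. k \<omega> s \<partial>D) = 0" for \<omega>
    unfolding k_def using mean by (simp add: D.prob_space)
  have e: "(\<lambda>_. 0 :: 'e) \<in> borel_measurable (past A)" "sq_integrable P (\<lambda>_. 0 :: 'e)"
    by (auto simp: sq_integrable_def)
  note noise = batch_noise[OF A idx e kh k_mean var[folded k_def], where c = "1 / real n"]
  define W where "W \<omega> = (1 / real n) *\<^sub>R (\<Sum>j<n. k \<omega> (Z (idx j) \<omega>))" for \<omega>
  have W: "d \<omega> - H (u \<omega>) = W \<omega>" for \<omega>
    using \<open>n > 0\<close> unfolding k_def W_def d_def sum_subtractf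
    by (simp add: scaleR_diff_right sum_constant_scaleR divide_inverse)
  have n: "W \<in> borel_measurable (past (A \<union> idx ` {..<n}))" "sq_integrable P W"
    "(\<integral>\<omega>. (norm (W \<omega>))\<^sup>2 \<partial>P) \<le> real n * ((1 / real n)\<^sup>2 * V)"
    using noise by (auto simp: W_def[abs_def] prob_space)
  have sub: "A \<union> idx ` {..<n} \<subseteq> I" using A idx(2) by auto
  have "(\<lambda>\<omega>. H (u \<omega>)) \<in> borel_measurable (past (A \<union> idx ` {..<n}))"
    by (rule past_mono[OF measurable_compose[OF u Hb] _ sub]) auto
  then have "(\<lambda>\<omega>. W \<omega> + H (u \<omega>)) \<in> borel_measurable (past (A \<union> idx ` {..<n}))" using n(1) by simp
  then show "d \<in> borel_measurable (past (A \<union> idx ` {..<n}))" unfolding W[symmetric] by simp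
  show "sq_integrable P (\<lambda>\<omega>. d \<omega> - H (u \<omega>))" using n(2) by (simp add: W)
  show "(\<integral>\<omega>. (norm (d \<omega> - H (u \<omega>)))\<^sup>2 \<partial>P) \<le> V / real n"
    using n(3) \<open>n > 0\<close> by (simp add: W power2_eq_square)
qed

end

section \<open>Decrease along one iteration\<close>

lemma norm_power2_diff_eq: "(norm (a - b))\<^sup>2 = (norm a)\<^sup>2 - 2 * inner a b + (norm (b::'a::real_inner))\<^sup>2"
  using norm_power2_add_eq[of a "- b"] by simp

text \<open>Of twice the inner product with the exact w, one half gives the contraction by
  monotonicity and the other, by cocoercivity, the squared norm of w over L. The latter is at least
  3/4 of the squared norm of D minus three squared errors; the quadratic term of the step takes back
  1/2 by the bound on a, leaving 1/4. The error coefficient 5 / \<mu> is 2 / \<mu> from Young's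
  inequality plus 3 / L, which is at most 3 / \<mu>.\<close>

lemma inexact_gradient_step:
  fixes y s D w :: "'a::real_inner"
  assumes mono: "inner w (y - s) \<ge> \<mu> * (norm (y - s))\<^sup>2" and coco: "inner w (y - s) \<ge> (norm w)\<^sup>2 / L"
    and \<mu>: "0 < \<mu>" "\<mu> \<le> L" and a: "0 < a" "a * (2 * L) \<le> 1"
  shows "(norm (y - a *\<^sub>R D - s))\<^sup>2
    \<le> (1 - a * \<mu> / 2) * (norm (y - s))\<^sup>2 - a / (4 * L) * (norm D)\<^sup>2 + 5 * a / \<mu> * (norm (D - w))\<^sup>2"
proof -
  define e where "e = D - w"
  define r where "r = (norm (y - s))\<^sup>2"
  have L: "L > 0" using \<mu> by simp
  have exp: "(norm (y - a *\<^sub>R D - s))\<^sup>2 = r - 2 * a * inner D (y - s) + a\<^sup>2 * (norm D)\<^sup>2"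
    using norm_power2_add_eq[of "y - s" "- (a *\<^sub>R D)"]
    by (simp add: r_def algebra_simps power_mult_distrib inner_commute)
  have in1: "inner D (y - s) = inner w (y - s) + inner e (y - s)" by (simp add: e_def inner_diff_left)
  have young: "- 2 * inner e (y - s) \<le> \<mu> / 2 * r + 2 / \<mu> * (norm e)\<^sup>2"
  proof -
    have "0 \<le> (norm (sqrt (\<mu> / 2) *\<^sub>R (y - s) + sqrt (2 / \<mu>) *\<^sub>R e))\<^sup>2" by simp
    also have "\<dots> = \<mu> / 2 * r + 2 * (sqrt (\<mu> / 2) * sqrt (2 / \<mu>)) * inner e (y - s) + 2 / \<mu> * (norm e)\<^sup>2"
      using \<mu> by (simp add: norm_power2_add_eq r_def power_mult_distrib inner_commute)
    also have "sqrt (\<mu> / 2) * sqrt (2 / \<mu>) = 1" using \<mu> by (simp flip: real_sqrt_mult)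
    finally show ?thesis by simp
  qed
  have wD: "3 / 4 * (norm D)\<^sup>2 - 3 * (norm e)\<^sup>2 \<le> (norm w)\<^sup>2"
  proof -
    have "0 \<le> (norm ((1 / 2) *\<^sub>R D - 2 *\<^sub>R e))\<^sup>2" by simp
    also have "\<dots> = 1 / 4 * (norm D)\<^sup>2 - 2 * inner D e + 4 * (norm e)\<^sup>2"
      by (simp add: norm_power2_diff_eq power_mult_distrib power_divide)
    finally have "2 * inner D e \<le> 1 / 4 * (norm D)\<^sup>2 + 4 * (norm e)\<^sup>2" by simp
    moreover have "(norm w)\<^sup>2 = (norm D)\<^sup>2 - 2 * inner D e + (norm e)\<^sup>2"
      using norm_power2_diff_eq[of D e] by (simp add: e_def)
    ultimately show ?thesis by simp
  qed
  have "2 * inner w (y - s) \<ge> \<mu> * r + (norm w)\<^sup>2 / L" using mono coco by (simp add: r_def)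
  moreover have "(norm w)\<^sup>2 / L \<ge> (3 / 4 * (norm D)\<^sup>2 - 3 * (norm e)\<^sup>2) / L"
    using wD L by (intro divide_right_mono) auto
  moreover have "3 * (norm e)\<^sup>2 / L \<le> 3 * (norm e)\<^sup>2 / \<mu>" using \<mu> L by (intro divide_left_mono) auto
  ultimately have "- 2 * inner D (y - s) \<le> - \<mu> / 2 * r - 3 / 4 * (norm D)\<^sup>2 / L + 5 / \<mu> * (norm e)\<^sup>2"
    using young unfolding in1 by (simp add: diff_divide_distrib)
  then have "a * (- 2 * inner D (y - s)) \<le> a * (- \<mu> / 2 * r - 3 / 4 * (norm D)\<^sup>2 / L + 5 / \<mu> * (norm e)\<^sup>2)"
    using a by (intro mult_left_mono) auto
  moreover have "a\<^sup>2 * (norm D)\<^sup>2 \<le> a / (2 * L) * (norm D)\<^sup>2"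
    using a L by (intro mult_right_mono) (auto simp: power2_eq_square field_simps)
  ultimately show ?thesis unfolding exp e_def[symmetric] r_def[symmetric]
    by (simp add: algebra_simps)
qed

text \<open>Young's inequality with weight c / 4 gives half of the contraction away, since
  \<open>(1 + c / 4) * (1 - c / 2)\<close> is at most 1 - c / 4. The price is 1 + 4 / c, at most 5 /
  c, on the shift and 1 + c / 4 on E; the generous 6 / 5 for the latter turns the 5 of the step
  estimate into a 6.\<close>

lemma moving_target:
  fixes y s s' :: "'a::real_inner"
  assumes c: "0 < c" "c \<le> 1 / 4" and step: "(norm (y - s))\<^sup>2 \<le> (1 - c / 2) * r - A + E"
    and nonneg: "r \<ge> 0" "A \<ge> 0" "E \<ge> 0"
  shows "(norm (y - s'))\<^sup>2 \<le> (1 - c / 4) * r - A + 6 / 5 * E + 5 / c * (norm (s' - s))\<^sup>2"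
proof -
  have "0 \<le> (norm (sqrt (c / 4) *\<^sub>R (y - s) + sqrt (4 / c) *\<^sub>R (s' - s)))\<^sup>2" by simp
  also have "\<dots> = c / 4 * (norm (y - s))\<^sup>2 + 2 * (sqrt (c / 4) * sqrt (4 / c)) * inner (y - s) (s' - s) + 4 / c * (norm (s' - s))\<^sup>2"
    using c by (simp add: norm_power2_add_eq power_mult_distrib)
  also have "sqrt (c / 4) * sqrt (4 / c) = 1" using c by (simp flip: real_sqrt_mult)
  finally have "- 2 * inner (y - s) (s' - s) \<le> c / 4 * (norm (y - s))\<^sup>2 + 4 / c * (norm (s' - s))\<^sup>2" by simp
  moreover have "(norm (y - s'))\<^sup>2 = (norm (y - s))\<^sup>2 - 2 * inner (y - s) (s' - s) + (norm (s' - s))\<^sup>2"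
    using norm_power2_diff_eq[of "y - s" "s' - s"] by simp
  ultimately have "(norm (y - s'))\<^sup>2 \<le> (1 + c / 4) * (norm (y - s))\<^sup>2 + (1 + 4 / c) * (norm (s' - s))\<^sup>2"
    by (simp add: algebra_simps)
  also have "\<dots> \<le> (1 + c / 4) * ((1 - c / 2) * r - A + E) + 5 / c * (norm (s' - s))\<^sup>2"
    using c step by (intro add_mono mult_left_mono mult_right_mono) (auto simp: field_simps)
  also have "(1 + c / 4) * ((1 - c / 2) * r - A + E) \<le> (1 - c / 4) * r - A + 6 / 5 * E"
  proof -
    have "(1 + c / 4) * ((1 - c / 2) * r - A + E) = (1 - c / 4) * r - A + E - c\<^sup>2 / 8 * r - c / 4 * A + c / 4 * E"
      by (simp add: algebra_simps power2_eq_square)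
    moreover have "c / 4 * E \<le> 1 / 5 * E" using c nonneg by (intro mult_right_mono) auto
    moreover have "c\<^sup>2 / 8 * r \<ge> 0" "c / 4 * A \<ge> 0" using c nonneg by auto
    ultimately show ?thesis by linarith
  qed
  finally show ?thesis by simp
qed

text \<open>Step 0 alone carries B and the factor 6 / 5, being the step whose target moves; the rest
  telescopes. The factor is then granted to every E t for a uniform bound.\<close>

lemma loop_sum:
  fixes p A E :: "nat \<Rightarrow> real"
  assumes "p 1 \<le> B - A 0 + 6 / 5 * E 0" and "\<And>t. 1 \<le> t \<Longrightarrow> t < n \<Longrightarrow> p (Suc t) \<le> p t - A t + E t"
    and "\<And>t. E t \<ge> 0" and "n > 0"
  shows "p n \<le> B - (\<Sum>t<n. A t) + 6 / 5 * (\<Sum>t<n. E t)"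
  using \<open>n > 0\<close> assms(2)
proof (induction n)
  case (Suc n)
  show ?case
  proof (cases "n = 0")
    case True
    then show ?thesis using assms(1) by simp
  next
    case False
    then have "p n \<le> B - (\<Sum>t<n. A t) + 6 / 5 * (\<Sum>t<n. E t)" using Suc by simp
    moreover have "p (Suc n) \<le> p n - A n + E n" using Suc.prems(2)[of n] False by simp
    ultimately show ?thesis using assms(3)[of n] by (simp only: sum.lessThan_Suc distrib_left)
  qed
qed simp

section \<open>One iteration: the y-loop, the v-loop, the step in x, and their combination\<close>

context smooth_lipschitz_pair
begin

text \<open>Step 0 uses a direction estimated at the old x, so it contracts towards
  \<open>ystar x\<close> and is then compared with \<open>ystar x'\<close>. Later steps already aim
  at \<open>ystar x'\<close>; their contraction is dropped, their negative squared directions are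
  kept.\<close>

lemma y_loop_decrease:
  fixes y D :: "nat \<Rightarrow> real ^ 'q" and x x' :: "real ^ 'p"
  assumes a: "0 < a" "a * (2 * (Lg + \<mu>)) \<le> 1" and T: "T > 0"
    and y: "\<And>t. t < T \<Longrightarrow> y (Suc t) = y t - a *\<^sub>R D t"
  defines "e \<equiv> \<lambda>t. D t - dir_y g (if t = 0 then x else x', y t)"
  shows "(norm (y T - ystar x'))\<^sup>2 \<le> (1 - a * \<mu> / 4) * (norm (y 0 - ystar x))\<^sup>2
    - a / (4 * Lg) * (\<Sum>t<T. (norm (D t))\<^sup>2) + 6 * a / \<mu> * (\<Sum>t<T. (norm (e t))\<^sup>2)
    + 5 / (a * \<mu>) * (norm (ystar x' - ystar x))\<^sup>2"
proof -
  define xt where "xt t = (if t = (0::nat) then x else x')" for t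
  have aL: "a * (2 * Lg) \<le> 1" and am: "a * \<mu> \<le> 1 / 4"
  proof -
    have "a * \<mu> \<ge> 0" "a * \<mu> \<le> a * Lg" using a mu_pos mu_le_Lg by (auto intro: mult_left_mono)
    moreover have "2 * (a * Lg) + 2 * (a * \<mu>) \<le> 1" using a by (simp add: algebra_simps)
    ultimately show "a * (2 * Lg) \<le> 1" "a * \<mu> \<le> 1 / 4" by linarith+
  qed
  define A where "A t = a / (4 * Lg) * (norm (D t))\<^sup>2" for t
  define E where "E t = 5 * a / \<mu> * (norm (e t))\<^sup>2" for t
  have A0: "A t \<ge> 0" and E0: "E t \<ge> 0" for t using a mu_pos Lg_pos by (auto simp: A_def E_def)
  have step: "(norm (y (Suc t) - ystar (xt t)))\<^sup>2 \<le> (1 - a * \<mu> / 2) * (norm (y t - ystar (xt t)))\<^sup>2 - A t + E t"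
    if "t < T" for t
  proof -
    have "inner (dir_y g (xt t, y t)) (y t - ystar (xt t)) \<ge> \<mu> * (norm (y t - ystar (xt t)))\<^sup>2"
      using dir_y_monotone[of "y t" "ystar (xt t)" "xt t"] by (simp add: ystar)
    moreover have "inner (dir_y g (xt t, y t)) (y t - ystar (xt t)) \<ge> (norm (dir_y g (xt t, y t)))\<^sup>2 / Lg"
      using dir_y_cocoercive[of "xt t" "y t" "ystar (xt t)"] by (simp add: ystar)
    ultimately show ?thesis
      unfolding y[OF that] A_def E_def e_def xt_def[symmetric]
      by (rule inexact_gradient_step[OF _ _ mu_pos mu_le_Lg a(1) aL])
  qed
  have "(norm (y T - ystar x'))\<^sup>2 \<le> ((1 - a * \<mu> / 4) * (norm (y 0 - ystar x))\<^sup>2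
      + 5 / (a * \<mu>) * (norm (ystar x' - ystar x))\<^sup>2) - (\<Sum>t<T. A t) + 6 / 5 * (\<Sum>t<T. E t)"
  proof (rule loop_sum[OF _ _ E0 T])
    have "(norm (y 1 - ystar x'))\<^sup>2 \<le> (1 - a * \<mu> / 4) * (norm (y 0 - ystar x))\<^sup>2 - A 0 + 6 / 5 * E 0
        + 5 / (a * \<mu>) * (norm (ystar x' - ystar x))\<^sup>2"
      by (rule moving_target) (use step[OF T] am a mu_pos A0 E0 in \<open>auto simp: xt_def\<close>)
    then show "(norm (y 1 - ystar x'))\<^sup>2 \<le> (1 - a * \<mu> / 4) * (norm (y 0 - ystar x))\<^sup>2
      + 5 / (a * \<mu>) * (norm (ystar x' - ystar x))\<^sup>2 - A 0 + 6 / 5 * E 0" by simp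
    fix t assume t: "1 \<le> t" "t < T"
    have "(1 - a * \<mu> / 2) * (norm (y t - ystar x'))\<^sup>2 \<le> 1 * (norm (y t - ystar x'))\<^sup>2"
      using a mu_pos by (intro mult_right_mono) auto
    then show "(norm (y (Suc t) - ystar x'))\<^sup>2 \<le> (norm (y t - ystar x'))\<^sup>2 - A t + E t"
      using step[OF t(2)] t(1) by (simp add: xt_def)
  qed
  moreover have "(\<Sum>t<T. A t) = a / (4 * Lg) * (\<Sum>t<T. (norm (D t))\<^sup>2)"
    unfolding A_def by (rule sum_distrib_left[symmetric])
  moreover have "(\<Sum>t<T. E t) = 5 * a / \<mu> * (\<Sum>t<T. (norm (e t))\<^sup>2)"
    unfolding E_def by (rule sum_distrib_left[symmetric])
  ultimately show ?thesis by simp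
qed

text \<open>The direction at (x, y, v) is the Hessian at (x, y) applied to v - vstar x plus the
  residual r of \<open>vstar x\<close> at that point. The residual vanishes at y = ystar x, so it
  costs a multiple of the lower-level error. Keeping the Hessian at (x, y) makes its coercivity
  directly applicable.\<close>

lemma dir_v_error:
  assumes M: "Cf / \<mu> \<le> M"
  defines "M1 \<equiv> 4 * Lf\<^sup>2 + 4 * M\<^sup>2 * (max Lgxy Lgyy)\<^sup>2"
  shows "(norm (D - hess_yy g (x, y) *v (v - vstar x)))\<^sup>2
    \<le> 2 * (norm (D - dir_v f g (x, y) v))\<^sup>2 + M1 * (norm (y - ystar x))\<^sup>2"
proof -
  define r where "r = dir_v f g (x, y) (vstar x)"
  have "norm (r - dir_v f g (zstar x) (vstar x))
      \<le> (Lf + M * max Lgxy Lgyy) * norm ((x, y) - zstar x) + Lg * norm (vstar x - vstar x)"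
    unfolding r_def by (rule dir_lipschitz(2)) (use norm_vstar[of x] M in linarith)
  then have "norm r \<le> (Lf + M * max Lgxy Lgyy) * norm (y - ystar x)"
    by (simp add: dir_v_vstar[unfolded zstar_def] zstar_def norm_Pair)
  then have "(norm r)\<^sup>2 \<le> (Lf + M * max Lgxy Lgyy)\<^sup>2 * (norm (y - ystar x))\<^sup>2"
    by (metis norm_ge_zero power_mono power_mult_distrib)
  also have "2 * (Lf + M * max Lgxy Lgyy)\<^sup>2 \<le> M1"
    using sum_power2_le[of Lf "M * max Lgxy Lgyy"] by (simp add: M1_def power_mult_distrib)
  then have "(Lf + M * max Lgxy Lgyy)\<^sup>2 * (norm (y - ystar x))\<^sup>2 \<le> M1 / 2 * (norm (y - ystar x))\<^sup>2"
    by (intro mult_right_mono) auto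
  finally have "2 * (norm r)\<^sup>2 \<le> M1 * (norm (y - ystar x))\<^sup>2" by simp
  moreover have "D - hess_yy g (x, y) *v (v - vstar x) = (D - dir_v f g (x, y) v) + r"
    by (simp add: r_def dir_v_def matrix_vector_mult_diff_distrib)
  ultimately show ?thesis using norm_add_power2_le[of "D - dir_v f g (x, y) v" r] by (simp only:)
qed

text \<open>The hypothesis on v expresses the projected step: projecting does not increase the
  distance to points of the ball, and \<open>vstar\<close> takes its values there. Every step pays
  for the lower-level error at its own point, the old one for index 0 and the new one for the other
  J - 1.\<close>

lemma v_loop_decrease:
  fixes v D :: "nat \<Rightarrow> real ^ 'q" and x x' :: "real ^ 'p" and y y' :: "real ^ 'q"
  assumes M: "Cf / \<mu> \<le> M" and b: "0 < b" "b * (2 * (Lg + \<mu>)) \<le> 1" and J: "J > 0"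
    and v: "\<And>j w. j < J \<Longrightarrow> norm w \<le> M \<Longrightarrow> norm (v (Suc j) - w) \<le> norm (v j - b *\<^sub>R D j - w)"
  defines "M1 \<equiv> 4 * Lf\<^sup>2 + 4 * M\<^sup>2 * (max Lgxy Lgyy)\<^sup>2"
  defines "e \<equiv> \<lambda>j. D j - dir_v f g (if j = 0 then (x, y) else (x', y')) (v j)"
  shows "(norm (v J - vstar x'))\<^sup>2 \<le> (1 - b * \<mu> / 4) * (norm (v 0 - vstar x))\<^sup>2
    - b / (4 * Lg) * (\<Sum>j<J. (norm (D j))\<^sup>2)
    + 6 * b / \<mu> * (2 * (\<Sum>j<J. (norm (e j))\<^sup>2)
        + M1 * ((norm (y - ystar x))\<^sup>2 + real (J - 1) * (norm (y' - ystar x'))\<^sup>2))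
    + 5 / (b * \<mu>) * (norm (vstar x' - vstar x))\<^sup>2"
proof -
  define xt where "xt t = (if t = (0::nat) then x else x')" for t
  define yt where "yt t = (if t = (0::nat) then y else y')" for t
  have bL: "b * (2 * Lg) \<le> 1" and bm: "b * \<mu> \<le> 1 / 4"
  proof -
    have "b * \<mu> \<ge> 0" "b * \<mu> \<le> b * Lg" using b mu_pos mu_le_Lg by (auto intro: mult_left_mono)
    moreover have "2 * (b * Lg) + 2 * (b * \<mu>) \<le> 1" using b by (simp add: algebra_simps)
    ultimately show "b * (2 * Lg) \<le> 1" "b * \<mu> \<le> 1 / 4" by linarith+
  qed
  have M1: "M1 \<ge> 0" by (simp add: M1_def)
  define A where "A t = b / (4 * Lg) * (norm (D t))\<^sup>2" for t
  define E where "E t = 5 * b / \<mu> * (2 * (norm (e t))\<^sup>2 + M1 * (norm (yt t - ystar (xt t)))\<^sup>2)" for t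
  have A0: "A t \<ge> 0" and E0: "E t \<ge> 0" for t using b mu_pos Lg_pos M1 by (auto simp: A_def E_def)
  have et: "e t = D t - dir_v f g (xt t, yt t) (v t)" for t by (simp add: e_def xt_def yt_def)
  have step: "(norm (v (Suc t) - vstar (xt t)))\<^sup>2 \<le> (1 - b * \<mu> / 2) * (norm (v t - vstar (xt t)))\<^sup>2 - A t + E t"
    if "t < J" for t
  proof -
    let ?w = "hess_yy g (xt t, yt t) *v (v t - vstar (xt t))"
    have "norm (vstar (xt t)) \<le> M" using norm_vstar[of "xt t"] M by linarith
    then have "(norm (v (Suc t) - vstar (xt t)))\<^sup>2 \<le> (norm (v t - b *\<^sub>R D t - vstar (xt t)))\<^sup>2"
      using v[OF that] by (intro power_mono) auto
    also have "\<dots> \<le> (1 - b * \<mu> / 2) * (norm (v t - vstar (xt t)))\<^sup>2 - b / (4 * Lg) * (norm (D t))\<^sup>2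
        + 5 * b / \<mu> * (norm (D t - ?w))\<^sup>2"
      by (rule inexact_gradient_step) (use hess_yy_coercive mu_pos mu_le_Lg b bL in auto)
    also have "5 * b / \<mu> * (norm (D t - ?w))\<^sup>2 \<le> E t"
      unfolding E_def et M1_def using dir_v_error[OF M] b mu_pos by (intro mult_left_mono) auto
    finally show ?thesis by (simp add: A_def)
  qed
  have "(norm (v J - vstar x'))\<^sup>2 \<le> ((1 - b * \<mu> / 4) * (norm (v 0 - vstar x))\<^sup>2
      + 5 / (b * \<mu>) * (norm (vstar x' - vstar x))\<^sup>2) - (\<Sum>t<J. A t) + 6 / 5 * (\<Sum>t<J. E t)"
  proof (rule loop_sum[OF _ _ E0 J])
    have "(norm (v 1 - vstar x'))\<^sup>2 \<le> (1 - b * \<mu> / 4) * (norm (v 0 - vstar x))\<^sup>2 - A 0 + 6 / 5 * E 0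
        + 5 / (b * \<mu>) * (norm (vstar x' - vstar x))\<^sup>2"
      by (rule moving_target) (use step[OF J] bm b mu_pos A0 E0 in \<open>auto simp: xt_def\<close>)
    then show "(norm (v 1 - vstar x'))\<^sup>2 \<le> (1 - b * \<mu> / 4) * (norm (v 0 - vstar x))\<^sup>2
      + 5 / (b * \<mu>) * (norm (vstar x' - vstar x))\<^sup>2 - A 0 + 6 / 5 * E 0" by simp
    fix t assume t: "1 \<le> t" "t < J"
    have "(1 - b * \<mu> / 2) * (norm (v t - vstar x'))\<^sup>2 \<le> 1 * (norm (v t - vstar x'))\<^sup>2"
      using b mu_pos by (intro mult_right_mono) auto
    then show "(norm (v (Suc t) - vstar x'))\<^sup>2 \<le> (norm (v t - vstar x'))\<^sup>2 - A t + E t"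
      using step[OF t(2)] t(1) by (simp add: xt_def)
  qed
  moreover have "(\<Sum>t<J. (norm (yt t - ystar (xt t)))\<^sup>2)
      = (norm (y - ystar x))\<^sup>2 + real (J - 1) * (norm (y' - ystar x'))\<^sup>2"
  proof -
    have "{..<J} = insert 0 {1..<J}" using J by auto
    then show ?thesis by (simp add: xt_def yt_def)
  qed
  then have "(\<Sum>t<J. E t) = 5 * b / \<mu> * (2 * (\<Sum>j<J. (norm (e j))\<^sup>2)
        + M1 * ((norm (y - ystar x))\<^sup>2 + real (J - 1) * (norm (y' - ystar x'))\<^sup>2))"
    unfolding E_def sum_distrib_left[symmetric] sum.distrib by simp
  moreover have "(\<Sum>t<J. A t) = b / (4 * Lg) * (\<Sum>j<J. (norm (D j))\<^sup>2)"
    unfolding A_def by (rule sum_distrib_left[symmetric])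
  ultimately show ?thesis by simp
qed

definition L\<Phi> where
  "L\<Phi> = Lf + (2 * Lf * Lg + Cf * max Lgxy Lgyy) / \<mu> + (Lf * Lg\<^sup>2 + 2 * Cf * Lg * max Lgxy Lgyy) / \<mu>\<^sup>2
      + Cf * Lg\<^sup>2 * max Lgxy Lgyy / \<mu> ^ 3"

text \<open>The inner product of gradient and direction is split by polarization. Of the resulting
  coefficient \<alpha> / 2 of the squared direction, the smoothness term takes back at most \<alpha>
  / 12, leaving 5 / 12. The deviation from the gradient consists of the estimation error and the
  distances of y and v from their targets.\<close>

lemma Phi_decrease:
  assumes M: "Cf / \<mu> \<le> M" and \<alpha>: "0 < \<alpha>" "\<alpha> * L\<Phi> \<le> 1 / 6"
  defines "M1 \<equiv> 4 * Lf\<^sup>2 + 4 * M\<^sup>2 * (max Lgxy Lgyy)\<^sup>2"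
  shows "\<Phi> (x - \<alpha> *\<^sub>R D) \<le> \<Phi> x - \<alpha> / 2 * (norm (grad \<Phi> x))\<^sup>2 - 5 / 12 * \<alpha> * (norm D)\<^sup>2
    + \<alpha> * (norm (D - dir_x f g (x, y) v))\<^sup>2 + \<alpha> * M1 * (norm (y - ystar x))\<^sup>2 + 2 * \<alpha> * Lg\<^sup>2 * (norm (v - vstar x))\<^sup>2"
proof -
  define d where "d = grad \<Phi> x"
  have "\<Phi> (x + (- \<alpha> *\<^sub>R D)) \<le> \<Phi> x + inner d (- \<alpha> *\<^sub>R D) + L\<Phi> / 2 * (norm (- \<alpha> *\<^sub>R D))\<^sup>2"
    unfolding d_def using gderiv_Phi
    by (intro smooth_upper_bound grad_Phi_lipschitz[folded L\<Phi>_def]) (simp add: grad_Phi)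
  then have 1: "\<Phi> (x - \<alpha> *\<^sub>R D) \<le> \<Phi> x - \<alpha> * inner d D + \<alpha> * L\<Phi> / 2 * \<alpha> * (norm D)\<^sup>2"
    by (simp add: power_mult_distrib power2_eq_square mult_ac)
  have 2: "\<alpha> * L\<Phi> / 2 * \<alpha> * (norm D)\<^sup>2 \<le> 1 / 12 * \<alpha> * (norm D)\<^sup>2"
    using \<alpha> by (intro mult_right_mono) auto
  have "- inner d D = 1 / 2 * (norm (D - d))\<^sup>2 - 1 / 2 * (norm D)\<^sup>2 - 1 / 2 * (norm d)\<^sup>2"
    unfolding norm_power2_diff_eq[of D d] by (simp add: inner_commute field_simps)
  then have "\<alpha> * (- inner d D) = \<alpha> * (1 / 2 * (norm (D - d))\<^sup>2 - 1 / 2 * (norm D)\<^sup>2 - 1 / 2 * (norm d)\<^sup>2)"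
    by (rule arg_cong)
  then have 3: "- \<alpha> * inner d D = \<alpha> / 2 * (norm (D - d))\<^sup>2 - \<alpha> / 2 * (norm D)\<^sup>2 - \<alpha> / 2 * (norm d)\<^sup>2"
    by (simp add: algebra_simps)
  have "(norm (dir_x f g (x, y) v - d))\<^sup>2 \<le> M1 * (norm ((x, y) - zstar x))\<^sup>2 + 2 * Lg\<^sup>2 * (norm (v - vstar x))\<^sup>2"
    unfolding d_def grad_Phi M1_def by (rule dir_lipschitz_power2(1)) (use norm_vstar[of x] M in linarith)
  then have "(norm (D - d))\<^sup>2 \<le> 2 * (norm (D - dir_x f g (x, y) v))\<^sup>2
      + 2 * (M1 * (norm (y - ystar x))\<^sup>2 + 2 * Lg\<^sup>2 * (norm (v - vstar x))\<^sup>2)"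
    using norm_add_power2_le[of "D - dir_x f g (x, y) v" "dir_x f g (x, y) v - d"]
    by (simp add: zstar_def norm_Pair)
  then have "\<alpha> / 2 * (norm (D - d))\<^sup>2 \<le> \<alpha> / 2 * (2 * (norm (D - dir_x f g (x, y) v))\<^sup>2
      + 2 * (M1 * (norm (y - ystar x))\<^sup>2 + 2 * Lg\<^sup>2 * (norm (v - vstar x))\<^sup>2))"
    using \<alpha> by (intro mult_left_mono) auto
  then show ?thesis using 1 2 3 unfolding d_def[symmetric] by (simp add: algebra_simps)
qed

definition lyapunov where
  "lyapunov x y v = \<Phi> x + (norm (y - ystar x))\<^sup>2 + (norm (v - vstar x))\<^sup>2"

text \<open>The contractions a * \<mu> / 4 and b * \<mu> / 4 dominate what the other estimates put
  back on the errors of y and v. Of the coefficient 5 / 12 of the squared x-direction, the shifts of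
  \<open>ystar\<close> and \<open>vstar\<close> use 5 / 96 and 5 / 48; this leaves 25 / 96, and the
  excess over 1 / 4 absorbs the part of the x-move that returns through the v-loop.\<close>

lemma lyapunov_decrease:
  fixes y Dy v Dv :: "nat \<Rightarrow> real ^ 'q" and x Dx :: "real ^ 'p"
  assumes M: "Cf / \<mu> \<le> M" and T: "T > 0" and J: "J > 0"
    and a: "0 < a" "a * (2 * (Lg + \<mu>)) \<le> 1" and b: "0 < b" "b * (2 * (Lg + \<mu>)) \<le> 1"
    and \<alpha>: "0 < \<alpha>" "\<alpha> * L\<Phi> \<le> 1 / 6"
  defines "M1 \<equiv> 4 * Lf\<^sup>2 + 4 * M\<^sup>2 * (max Lgxy Lgyy)\<^sup>2"
    and "Cv \<equiv> (Lf / \<mu> + Cf * max Lgxy Lgyy / \<mu>\<^sup>2) * (1 + Lg / \<mu>)"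
  assumes bJ: "128 * (b * M1 * real J) \<le> a * \<mu>\<^sup>2"
    and \<alpha>1: "\<alpha> * (8 * M1) \<le> a * \<mu>" and \<alpha>2: "\<alpha> * (48 * Lg\<^sup>2) \<le> b * \<mu>"
    and \<alpha>3: "\<alpha> * (96 * (Lg / \<mu>)\<^sup>2) \<le> a * \<mu>" and \<alpha>4: "\<alpha> * (48 * Cv\<^sup>2) \<le> b * \<mu>"
    and y: "\<And>t. t < T \<Longrightarrow> y (Suc t) = y t - a *\<^sub>R Dy t"
    and v: "\<And>j w. j < J \<Longrightarrow> norm w \<le> M \<Longrightarrow> norm (v (Suc j) - w) \<le> norm (v j - b *\<^sub>R Dv j - w)"
  defines "x' \<equiv> x - \<alpha> *\<^sub>R Dx"
  defines "r\<^sub>y \<equiv> \<lambda>t. Dy t - dir_y g (if t = 0 then x else x', y t)"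
    and "r\<^sub>v \<equiv> \<lambda>j. Dv j - dir_v f g (if j = 0 then (x, y 0) else (x', y T)) (v j)"
    and "r\<^sub>x \<equiv> Dx - dir_x f g (x, y 0) (v 0)"
  shows "lyapunov x' (y T) (v J) \<le> lyapunov x (y 0) (v 0) - \<alpha> / 2 * (norm (grad \<Phi> x))\<^sup>2
    - \<alpha> / 4 * (norm Dx)\<^sup>2 - a / (4 * Lg) * (\<Sum>t<T. (norm (Dy t))\<^sup>2) - b / (4 * Lg) * (\<Sum>j<J. (norm (Dv j))\<^sup>2)
    + \<alpha> * (norm r\<^sub>x)\<^sup>2 + 7 * a / \<mu> * (\<Sum>t<T. (norm (r\<^sub>y t))\<^sup>2) + 12 * b / \<mu> * (\<Sum>j<J. (norm (r\<^sub>v j))\<^sup>2)"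
proof -
  define \<delta> \<delta>' w w' where "\<delta> = (norm (y 0 - ystar x))\<^sup>2" and "\<delta>' = (norm (y T - ystar x'))\<^sup>2"
    and "w = (norm (v 0 - vstar x))\<^sup>2" and "w' = (norm (v J - vstar x'))\<^sup>2"
  define n where "n = (norm Dx)\<^sup>2"
  \<comment> \<open>The coefficient 6 is that of the y-loop; the 7 in the conclusion makes room for
    the share of \<open>Ey\<close> that enters again through the v-loop.\<close>
  define Ey where "Ey = 6 * a / \<mu> * (\<Sum>t<T. (norm (r\<^sub>y t))\<^sup>2)"
  define SDy where "SDy = a / (4 * Lg) * (\<Sum>t<T. (norm (Dy t))\<^sup>2)"
  define SDv where "SDv = b / (4 * Lg) * (\<Sum>j<J. (norm (Dv j))\<^sup>2)"
  define Sev where "Sev = 12 * b / \<mu> * (\<Sum>j<J. (norm (r\<^sub>v j))\<^sup>2)"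
  define \<kappa> where "\<kappa> = 6 * b / \<mu> * M1"
  have nonneg: "\<delta> \<ge> 0" "\<delta>' \<ge> 0" "w \<ge> 0" "n \<ge> 0" "Ey \<ge> 0" "SDy \<ge> 0" "\<kappa> \<ge> 0"
    using a b mu_pos Lg_pos by (auto simp: \<delta>_def \<delta>'_def w_def n_def Ey_def SDy_def \<kappa>_def M1_def
      intro!: mult_nonneg_nonneg divide_nonneg_nonneg sum_nonneg add_nonneg_nonneg)
  have am: "0 < a * \<mu>" "a * \<mu> \<le> 1 / 4" and bm: "0 < b * \<mu>"
  proof -
    have "a * \<mu> \<le> a * Lg" using a mu_le_Lg by (auto intro: mult_left_mono)
    moreover have "2 * (a * Lg) + 2 * (a * \<mu>) \<le> 1" using a by (simp add: algebra_simps)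
    ultimately show "a * \<mu> \<le> 1 / 4" by linarith
  qed (use a b mu_pos in auto)
  \<comment> \<open>\<kappa> is the weight of the lower-level error in the v-loop. The bound on b
    makes its J-fold multiple small against the contraction of y, and at most 6 / 512 because a *
    \<mu> is at most 1 / 4.\<close>
  have \<kappa>J: "\<kappa> * real J \<le> 6 / 128 * (a * \<mu>)"
  proof -
    have "\<kappa> * real J = 6 / 128 * (128 * (b * M1 * real J)) / \<mu>" by (simp add: \<kappa>_def)
    also have "\<dots> \<le> 6 / 128 * (a * \<mu>\<^sup>2) / \<mu>" using bJ mu_pos by (intro divide_right_mono mult_left_mono) auto
    finally show ?thesis using mu_pos by (simp add: power2_eq_square)
  qed
  have shy: "5 / (a * \<mu>) * (norm (ystar x' - ystar x))\<^sup>2 \<le> 5 / 96 * \<alpha> * n"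
  proof -
    have "(norm (ystar x' - ystar x))\<^sup>2 \<le> (Lg / \<mu> * norm (x' - x))\<^sup>2"
      by (intro power_mono ystar_lipschitz) auto
    also have "\<dots> = (Lg / \<mu>)\<^sup>2 * \<alpha> * (\<alpha> * n)"
      by (simp add: x'_def n_def power_mult_distrib power2_eq_square)
    also have "\<dots> \<le> a * \<mu> / 96 * (\<alpha> * n)"
      using \<alpha>3 \<alpha> nonneg by (intro mult_right_mono) (auto simp: mult_ac)
    finally have "5 / (a * \<mu>) * (norm (ystar x' - ystar x))\<^sup>2 \<le> 5 / (a * \<mu>) * (a * \<mu> / 96 * (\<alpha> * n))"
      using am by (intro mult_left_mono) auto
    then show ?thesis using a mu_pos by simp
  qed
  have shv: "5 / (b * \<mu>) * (norm (vstar x' - vstar x))\<^sup>2 \<le> 5 / 48 * \<alpha> * n"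
  proof -
    have "(norm (vstar x' - vstar x))\<^sup>2 \<le> (Cv * norm (x' - x))\<^sup>2"
      unfolding Cv_def by (intro power_mono vstar_lipschitz) auto
    also have "\<dots> = Cv\<^sup>2 * \<alpha> * (\<alpha> * n)"
      by (simp add: x'_def n_def power_mult_distrib power2_eq_square)
    also have "\<dots> \<le> b * \<mu> / 48 * (\<alpha> * n)"
      using \<alpha>4 \<alpha> nonneg by (intro mult_right_mono) (auto simp: mult_ac)
    finally have "5 / (b * \<mu>) * (norm (vstar x' - vstar x))\<^sup>2 \<le> 5 / (b * \<mu>) * (b * \<mu> / 48 * (\<alpha> * n))"
      using bm by (intro mult_left_mono) auto
    then show ?thesis using b mu_pos by simp
  qed
  have Y: "\<delta>' \<le> (1 - a * \<mu> / 4) * \<delta> - SDy + Ey + 5 / 96 * \<alpha> * n"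
    using y_loop_decrease[where y = y and D = Dy, OF a T y, of x' x] shy
    unfolding \<delta>_def \<delta>'_def SDy_def Ey_def r\<^sub>y_def by simp
  have V: "w' \<le> (1 - b * \<mu> / 4) * w - SDv + Sev + \<kappa> * (\<delta> + real (J - 1) * \<delta>') + 5 / 48 * \<alpha> * n"
    using v_loop_decrease[where v = v and D = Dv, OF M b J v, of x' x "y 0" "y T"] shv
    unfolding \<delta>_def \<delta>'_def w_def w'_def SDv_def Sev_def r\<^sub>v_def \<kappa>_def M1_def by (simp add: algebra_simps)
  have F: "\<Phi> x' \<le> \<Phi> x - \<alpha> / 2 * (norm (grad \<Phi> x))\<^sup>2 - 5 / 12 * \<alpha> * n + \<alpha> * (norm r\<^sub>x)\<^sup>2 + \<alpha> * M1 * \<delta> + 2 * \<alpha> * Lg\<^sup>2 * w"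
    using Phi_decrease[OF M \<alpha>, of x Dx "y 0" "v 0"]
    unfolding x'_def r\<^sub>x_def n_def \<delta>_def w_def M1_def by simp
  have "(1 - a * \<mu> / 4) * \<delta> \<le> 1 * \<delta>" using nonneg am by (intro mult_right_mono) auto
  then have "\<delta>' \<le> \<delta> + (Ey + 5 / 96 * \<alpha> * n)" using Y nonneg by linarith
  then have "real (J - 1) * \<delta>' \<le> real (J - 1) * (\<delta> + (Ey + 5 / 96 * \<alpha> * n))"
    by (intro mult_left_mono) auto
  then have "\<delta> + real (J - 1) * \<delta>' \<le> real J * \<delta> + real (J - 1) * (Ey + 5 / 96 * \<alpha> * n)"
    using J by (simp add: of_nat_diff algebra_simps)
  also have "\<dots> \<le> real J * \<delta> + real J * (Ey + 5 / 96 * \<alpha> * n)"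
    using nonneg \<alpha> by (intro add_left_mono mult_right_mono) auto
  finally have "\<kappa> * (\<delta> + real (J - 1) * \<delta>') \<le> \<kappa> * (real J * \<delta> + real J * (Ey + 5 / 96 * \<alpha> * n))"
    using nonneg by (intro mult_left_mono)
  also have "\<dots> = \<kappa> * real J * \<delta> + \<kappa> * real J * (Ey + 5 / 96 * \<alpha> * n)" by (simp add: algebra_simps)
  also have "\<dots> \<le> 6 / 128 * (a * \<mu>) * \<delta> + 6 / 512 * (Ey + 5 / 96 * \<alpha> * n)"
    using \<kappa>J am nonneg \<alpha> by (intro add_mono mult_right_mono) auto
  finally have K: "\<kappa> * (\<delta> + real (J - 1) * \<delta>') \<le> 6 / 128 * (a * \<mu>) * \<delta> + 6 / 512 * (Ey + 5 / 96 * \<alpha> * n)" .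
  have c1: "\<alpha> * M1 * \<delta> \<le> a * \<mu> / 8 * \<delta>" using \<alpha>1 nonneg by (intro mult_right_mono) auto
  have c2: "2 * \<alpha> * Lg\<^sup>2 * w \<le> b * \<mu> / 24 * w" using \<alpha>2 nonneg by (intro mult_right_mono) auto
  have c3: "a * \<mu> * \<delta> \<ge> 0" "b * \<mu> * w \<ge> 0" "\<alpha> * n \<ge> 0" using am bm nonneg \<alpha> by auto
  have r\<^sub>y: "7 * a / \<mu> * (\<Sum>t<T. (norm (r\<^sub>y t))\<^sup>2) = 7 / 6 * Ey" by (simp add: Ey_def)
  show ?thesis
    using Y V F K c1 c2 c3 nonneg(5) unfolding r\<^sub>y lyapunov_def n_def[symmetric] SDy_def[symmetric] SDv_def[symmetric]
      Sev_def[symmetric] \<delta>_def[symmetric] \<delta>'_def[symmetric] w_def[symmetric] w'_def[symmetric]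
    by (simp add: algebra_simps)
qed

end

section \<open>The algorithm\<close>

text \<open>In the proof, \<open>W\<close> bounds the drift accumulated since the last refresh; it is spent over the remaining
  \<open>q - K mod q\<close> indices of the current period.\<close>

lemma refresh_period_sum:
  fixes \<epsilon> Q :: "nat \<Rightarrow> real"
  assumes "q > 0" and Q: "\<And>k. Q k \<ge> 0"
    and refresh: "\<And>k. k < K \<Longrightarrow> k mod q = 0 \<Longrightarrow> \<epsilon> k \<le> s"
    and step: "\<And>k. Suc k < K \<Longrightarrow> Suc k mod q \<noteq> 0 \<Longrightarrow> \<epsilon> (Suc k) \<le> \<epsilon> k + Q k / real q"
  shows "(\<Sum>k<K. \<epsilon> k + Q k / real q) \<le> real K * s + (\<Sum>k<K. Q k)"
proof -
  define W where "W = rec_nat 0 (\<lambda>k w. if Suc k mod q = 0 then 0 else w + Q k)"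
  have W0: "W 0 = 0" and WS: "W (Suc k) = (if Suc k mod q = 0 then 0 else W k + Q k)" for k
    by (simp_all add: W_def)
  have W_nonneg: "W k \<ge> 0" for k by (induction k) (use Q in \<open>auto simp: W0 WS\<close>)
  have \<epsilon>: "\<epsilon> k \<le> s + W k / real q" if "k < K" for k
    using that
  proof (induction k)
    case 0
    then show ?case using refresh[of 0] by (simp add: W0)
  next
    case (Suc k)
    show ?case
    proof (cases "Suc k mod q = 0")
      case True
      then show ?thesis using refresh[OF Suc.prems] by (simp add: WS)
    next
      case False
      then show ?thesis using step[OF Suc.prems False] Suc by (simp add: WS add_divide_distrib)
    qed
  qed
  have "(\<Sum>k<n. \<epsilon> k + Q k / real q) + (real q - real (n mod q)) * W n / real q \<le> real n * s + (\<Sum>k<n. Q k)"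
    if "n \<le> K" for n
    using that
  proof (induction n)
    case 0
    then show ?case by (simp add: W0)
  next
    case (Suc n)
    have le: "n mod q + 1 \<le> q" using \<open>q > 0\<close> by (simp add: Suc_leI)
    define m where "m = real q - real (n mod q)"
    have new: "\<epsilon> n + Q n / real q \<le> s + (W n + Q n) / real q"
      using \<epsilon>[of n] Suc.prems by (simp add: add_divide_distrib)
    have rest: "(W n + Q n) / real q + (real q - real (Suc n mod q)) * W (Suc n) / real q \<le> m * W n / real q + Q n"
    proof (cases "Suc n mod q = 0")
      case True
      \<comment> \<open>At the last index of a period one share of W is left, which pays for the
        current term; then the refresh resets W.\<close>
      then have "n mod q = q - 1" using \<open>q > 0\<close> by (metis Suc_pred' mod_Suc nat.distinct(1) diff_Suc_1)
      then have "m = 1" using \<open>q > 0\<close> by (simp add: m_def of_nat_diff)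
      moreover have "Q n / real q \<le> Q n" using Q[of n] \<open>q > 0\<close> by (simp add: divide_le_eq mult_le_cancel_left1)
      ultimately show ?thesis using True by (simp add: WS add_divide_distrib)
    next
      case False
      then have "real (Suc n mod q) = real (n mod q) + 1" by (simp add: mod_Suc split: if_splits)
      then have "(W n + Q n) / real q + (real q - real (Suc n mod q)) * W (Suc n) / real q
          = m * (W n + Q n) / real q"
        using False by (simp add: WS m_def algebra_simps diff_divide_distrib add_divide_distrib)
      also have "\<dots> = m * W n / real q + m / real q * Q n" by (simp add: add_divide_distrib distrib_left)
      also have "m / real q * Q n \<le> 1 * Q n"
        using Q[of n] \<open>q > 0\<close> by (intro mult_right_mono) (auto simp: m_def)
      finally show ?thesis by simp
    qed
    show ?case using Suc new rest unfolding m_def by (simp add: algebra_simps)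
  qed
  from this[of K] have "(\<Sum>k<K. \<epsilon> k + Q k / real q) + (real q - real (K mod q)) * W K / real q \<le> real K * s + (\<Sum>k<K. Q k)"
    by simp
  moreover have "(real q - real (K mod q)) * W K / real q \<ge> 0"
    using W_nonneg[of K] \<open>q > 0\<close> by (simp add: less_imp_le)
  ultimately show ?thesis by linarith
qed

lemma (in prob_space) distr_pair_snd:
  assumes "prob_space N"
  shows "distr (N \<Otimes>\<^sub>M M) M snd = M"
proof (rule measure_eqI)
  interpret N: prob_space N by fact
  fix A assume A: "A \<in> sets (distr (N \<Otimes>\<^sub>M M) M snd)"
  then have "snd -` A \<inter> space (N \<Otimes>\<^sub>M M) = space N \<times> A"
    using sets.sets_into_space[of A M] by (auto simp: space_pair_measure)
  then show "emeasure (distr (N \<Otimes>\<^sub>M M) M snd) A = emeasure M A"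
    using A by (simp add: emeasure_distr emeasure_pair_measure_Times N.emeasure_space_1)
qed simp

text \<open>Cauchy-Schwarz; applied to the total move of y in an inner loop, it is the source of the
  factor T in the drift of the x- and v-directions.\<close>

lemma norm_sum_power2_le:
  fixes f :: "nat \<Rightarrow> 'a::real_normed_vector"
  shows "(norm (\<Sum>t<n. f t))\<^sup>2 \<le> real n * (\<Sum>t<n. (norm (f t))\<^sup>2)"
proof -
  have "(norm (\<Sum>t<n. f t))\<^sup>2 \<le> (\<Sum>t<n. norm (f t))\<^sup>2" by (intro power_mono norm_sum) auto
  also have "\<dots> \<le> (\<Sum>t<n. (norm (f t))\<^sup>2) * card {..<n}" by (rule sum_squared_le_sum_of_squares)
  finally show ?thesis by (simp add: mult.commute)
qed

text \<open>\<open>rank\<close> is the position of a sample set in the order of drawing.\<close>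

fun rank :: "nat \<Rightarrow> nat \<Rightarrow> sample_set \<Rightarrow> nat" where
  "rank T J (Outer d k) = k * (T + J + 1)"
| "rank T J (Inner d k t) = k * (T + J + 1) + 1 + (if d = Y_dir then 0 else T) + t"

text \<open>S2 is already replaced by q1, which thus serves both as the size of an inner batch and
  as the length of a refresh period. Samples live on the product space, where each direction is a
  function of one pair.\<close>

locale als_run =
  smooth_lipschitz_pair f g \<mu> Cf Lf Lg Lgxy Lgyy +
  iid_family P "D\<^sub>\<xi> \<Otimes>\<^sub>M D\<^sub>\<zeta>" smp "drawn K T J q1 S1 q1"
  for f g :: "(real ^ 'p) \<times> (real ^ 'q) \<Rightarrow> real" and \<mu> Cf Lf Lg Lgxy Lgyy :: real
    and P :: "'s measure" and D\<^sub>\<xi> :: "'u measure" and D\<^sub>\<zeta> :: "'w measure"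
    and smp :: "sample_set \<times> nat \<Rightarrow> 's \<Rightarrow> 'u \<times> 'w" and K T J q1 S1 :: nat +
  fixes F :: "'u \<Rightarrow> (real ^ 'p) \<times> (real ^ 'q) \<Rightarrow> real" and G :: "'w \<Rightarrow> (real ^ 'p) \<times> (real ^ 'q) \<Rightarrow> real"
    and \<sigma>g M lam1 lam2 \<alpha> \<beta> \<eta> :: real
    and x0 :: "real ^ 'p" and y0 v0 :: "real ^ 'q"
  assumes prob_xi: "prob_space D\<^sub>\<xi>" and prob_zeta: "prob_space D\<^sub>\<zeta>"
    and sample_pair: "\<And>\<xi> \<zeta>. \<xi> \<in> space D\<^sub>\<xi> \<Longrightarrow> \<zeta> \<in> space D\<^sub>\<zeta> \<Longrightarrow>
      smooth_lipschitz_pair (F \<xi>) (G \<zeta>) \<mu> Cf Lf Lg Lgxy Lgyy"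
    and mean_F: "\<And>z. integrable D\<^sub>\<xi> (\<lambda>\<xi>. grad (F \<xi>) z)" "\<And>z. (\<integral>\<xi>. grad (F \<xi>) z \<partial>D\<^sub>\<xi>) = grad f z"
    and mean_G: "\<And>z. integrable D\<^sub>\<zeta> (\<lambda>\<zeta>. grad (G \<zeta>) z)" "\<And>z. (\<integral>\<zeta>. grad (G \<zeta>) z \<partial>D\<^sub>\<zeta>) = grad g z"
    and var_G: "\<And>z. integrable D\<^sub>\<zeta> (\<lambda>\<zeta>. (norm (grad (G \<zeta>) z - grad g z))\<^sup>2)"
      "\<And>z. (\<integral>\<zeta>. (norm (grad (G \<zeta>) z - grad g z))\<^sup>2 \<partial>D\<^sub>\<zeta>) \<le> \<sigma>g\<^sup>2"
    and mean_xy: "\<And>z. integrable D\<^sub>\<zeta> (\<lambda>\<zeta>. hess_xy (G \<zeta>) z)" "\<And>z. (\<integral>\<zeta>. hess_xy (G \<zeta>) z \<partial>D\<^sub>\<zeta>) = hess_xy g z"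
    and mean_yy: "\<And>z. integrable D\<^sub>\<zeta> (\<lambda>\<zeta>. hess_yy (G \<zeta>) z)" "\<And>z. (\<integral>\<zeta>. hess_yy (G \<zeta>) z \<partial>D\<^sub>\<zeta>) = hess_yy g z"
    and M: "Cf / \<mu> \<le> M" and v0: "norm v0 \<le> M"
    and T: "T > 0" and J: "J > 0" and q1: "q1 > 0" and S1: "S1 > 0"
    and a: "0 < lam1 * \<beta>" and b: "0 < lam2 * \<eta>" and \<alpha>: "0 < \<alpha>"
begin

abbreviation "I \<equiv> drawn K T J q1 S1 q1"
abbreviation "D \<equiv> D\<^sub>\<xi> \<Otimes>\<^sub>M D\<^sub>\<zeta>"
abbreviation "a \<equiv> lam1 * \<beta>"
abbreviation "b \<equiv> lam2 * \<eta>"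
abbreviation "Lgg \<equiv> max Lgxy Lgyy"
definition "M1 = 4 * Lf\<^sup>2 + 4 * M\<^sup>2 * Lgg\<^sup>2"

sublocale xi: prob_space D\<^sub>\<xi> by (rule prob_xi)
sublocale zeta: prob_space D\<^sub>\<zeta> by (rule prob_zeta)
sublocale D: prob_space D by (rule D)

lemma M_nonneg: "M \<ge> 0"
  using v0 norm_ge_zero order_trans by blast

lemma M1_nonneg: "M1 \<ge> 0" by (simp add: M1_def)

subsection \<open>Single-sample directions\<close>

text \<open>The sample comes first and the point (z, v) is packed into one argument, the shape in
  which the estimator lemmas take a sampled map.\<close>

definition hx where "hx s p = dir_x (F (fst s)) (G (snd s)) (fst p) (snd p)"
definition hy where "hy s z = dir_y (G (snd s)) z"
definition hv where "hv s p = dir_v (F (fst s)) (G (snd s)) (fst p) (snd p)"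
definition Hx where "Hx p = dir_x f g (fst p) (snd p)"
definition Hv where "Hv p = dir_v f g (fst p) (snd p)"

lemma sample_pair': "s \<in> space D \<Longrightarrow> smooth_lipschitz_pair (F (fst s)) (G (snd s)) \<mu> Cf Lf Lg Lgxy Lgyy"
  by (rule sample_pair) (auto simp: space_pair_measure)

lemma h_continuous:
  assumes "s \<in> space D"
  shows "continuous_on UNIV (hx s)" "continuous_on UNIV (hy s)" "continuous_on UNIV (hv s)"
proof -
  interpret s: smooth_lipschitz_pair "F (fst s)" "G (snd s)" \<mu> Cf Lf Lg Lgxy Lgyy
    by (rule sample_pair'[OF assms])
  show "continuous_on UNIV (hx s)" "continuous_on UNIV (hv s)"
    using s.dir_continuous by (simp_all add: hx_def[abs_def] hv_def[abs_def] case_prod_beta)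
  show "continuous_on UNIV (hy s)" using s.dir_y_continuous by (simp add: hy_def[abs_def])
qed

lemma H_continuous: "continuous_on UNIV Hx" "continuous_on UNIV Hv"
  using dir_continuous by (simp_all add: Hx_def[abs_def] Hv_def[abs_def] case_prod_beta)

lemma integral_fst_component:
  fixes \<phi> :: "'u \<Rightarrow> 'e::{banach, second_countable_topology}"
  assumes "integrable D\<^sub>\<xi> \<phi>"
  shows "integrable D (\<lambda>s. \<phi> (fst s))" and "(\<integral>s. \<phi> (fst s) \<partial>D) = (\<integral>\<xi>. \<phi> \<xi> \<partial>D\<^sub>\<xi>)"
proof -
  have d: "distr D D\<^sub>\<xi> fst = D\<^sub>\<xi>" by (rule zeta.distr_pair_fst)
  show "integrable D (\<lambda>s. \<phi> (fst s))"
    by (rule integrable_distr[OF measurable_fst]) (simp add: d assms)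
  show "(\<integral>s. \<phi> (fst s) \<partial>D) = (\<integral>\<xi>. \<phi> \<xi> \<partial>D\<^sub>\<xi>)"
    using integral_distr[of fst D D\<^sub>\<xi> \<phi>] assms by (simp add: d)
qed

lemma integral_snd_component:
  fixes \<phi> :: "'w \<Rightarrow> 'e::{banach, second_countable_topology}"
  assumes "integrable D\<^sub>\<zeta> \<phi>"
  shows "integrable D (\<lambda>s. \<phi> (snd s))" and "(\<integral>s. \<phi> (snd s) \<partial>D) = (\<integral>\<zeta>. \<phi> \<zeta> \<partial>D\<^sub>\<zeta>)"
proof -
  have d: "distr D D\<^sub>\<zeta> snd = D\<^sub>\<zeta>" by (rule zeta.distr_pair_snd[OF prob_xi])
  show "integrable D (\<lambda>s. \<phi> (snd s))"
    by (rule integrable_distr[OF measurable_snd]) (simp add: d assms)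
  show "(\<integral>s. \<phi> (snd s) \<partial>D) = (\<integral>\<zeta>. \<phi> \<zeta> \<partial>D\<^sub>\<zeta>)"
    using integral_distr[of snd D D\<^sub>\<zeta> \<phi>] assms by (simp add: d)
qed

lemma bounded_linear_matrix_apply: "bounded_linear (\<lambda>A :: real ^ 'n ^ 'm. A *v v)"
  by (intro linear_conv_bounded_linear[THEN iffD1] linearI)
     (simp_all add: matrix_vector_mult_add_rdistrib scaleR_matrix_vector_assoc)

lemma hy_mean: "integrable D (\<lambda>s. hy s z)" "(\<integral>s. hy s z \<partial>D) = dir_y g z"
proof -
  note i = integrable_bounded_linear[OF bounded_linear_snd integral_snd_component(1)[OF mean_G(1)]]
  have eq: "hy s z = snd (grad (G (snd s)) z)" if "s \<in> space D" for s
    using smooth_lipschitz_pair.dir_y_eq[OF sample_pair'[OF that]] by (simp add: hy_def)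
  show "integrable D (\<lambda>s. hy s z)"
    using i[of z] by (subst Bochner_Integration.integrable_cong[OF refl eq])
  have "(\<integral>s. hy s z \<partial>D) = (\<integral>s. snd (grad (G (snd s)) z) \<partial>D)"
    by (rule Bochner_Integration.integral_cong[OF refl eq])
  also have "\<dots> = snd (\<integral>s. grad (G (snd s)) z \<partial>D)"
    by (rule integral_bounded_linear[OF bounded_linear_snd integral_snd_component(1)[OF mean_G(1)]])
  also have "\<dots> = dir_y g z" by (simp add: integral_snd_component(2)[OF mean_G(1)] mean_G(2) dir_y_eq)
  finally show "(\<integral>s. hy s z \<partial>D) = dir_y g z" .
qed

lemma hx_mean: "integrable D (\<lambda>s. hx s p)" "(\<integral>s. hx s p \<partial>D) = Hx p"
proof -
  obtain z v where p: "p = (z, v)" by fastforce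
  note iF = integral_fst_component[OF mean_F(1)[of z]] and iG = integral_snd_component[OF mean_xy(1)[of z]]
  note i = integrable_bounded_linear[OF bounded_linear_fst iF(1)]
    integrable_bounded_linear[OF bounded_linear_matrix_apply[of v] iG(1)]
  have eq: "hx s p = fst (grad (F (fst s)) z) - hess_xy (G (snd s)) z *v v" if "s \<in> space D" for s
    using smooth_lipschitz_pair.grad_x_f[OF sample_pair'[OF that]] by (simp add: hx_def dir_x_def p)
  show "integrable D (\<lambda>s. hx s p)"
    using Bochner_Integration.integrable_diff[OF i] by (subst Bochner_Integration.integrable_cong[OF refl eq])
  have "(\<integral>s. hx s p \<partial>D) = (\<integral>s. fst (grad (F (fst s)) z) - hess_xy (G (snd s)) z *v v \<partial>D)"
    by (rule Bochner_Integration.integral_cong[OF refl eq])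
  also have "\<dots> = fst (\<integral>s. grad (F (fst s)) z \<partial>D) - (\<integral>s. hess_xy (G (snd s)) z \<partial>D) *v v"
    by (simp only: Bochner_Integration.integral_diff[OF i] integral_bounded_linear[OF bounded_linear_fst iF(1)]
      integral_bounded_linear[OF bounded_linear_matrix_apply iG(1)])
  also have "\<dots> = Hx p" unfolding iF(2) iG(2) by (simp add: mean_F(2) mean_xy(2) Hx_def dir_x_def grad_x_f p)
  finally show "(\<integral>s. hx s p \<partial>D) = Hx p" .
qed

lemma hv_mean: "integrable D (\<lambda>s. hv s p)" "(\<integral>s. hv s p \<partial>D) = Hv p"
proof -
  obtain z v where p: "p = (z, v)" by fastforce
  note iF = integral_fst_component[OF mean_F(1)[of z]] and iG = integral_snd_component[OF mean_yy(1)[of z]]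
  note i = integrable_bounded_linear[OF bounded_linear_matrix_apply[of v] iG(1)]
    integrable_bounded_linear[OF bounded_linear_snd iF(1)]
  have eq: "hv s p = hess_yy (G (snd s)) z *v v - snd (grad (F (fst s)) z)" if "s \<in> space D" for s
    using smooth_lipschitz_pair.grad_y_f[OF sample_pair'[OF that]] by (simp add: hv_def dir_v_def p)
  show "integrable D (\<lambda>s. hv s p)"
    using Bochner_Integration.integrable_diff[OF i] by (subst Bochner_Integration.integrable_cong[OF refl eq])
  have "(\<integral>s. hv s p \<partial>D) = (\<integral>s. hess_yy (G (snd s)) z *v v - snd (grad (F (fst s)) z) \<partial>D)"
    by (rule Bochner_Integration.integral_cong[OF refl eq])
  also have "\<dots> = (\<integral>s. hess_yy (G (snd s)) z \<partial>D) *v v - snd (\<integral>s. grad (F (fst s)) z \<partial>D)"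
    by (simp only: Bochner_Integration.integral_diff[OF i] integral_bounded_linear[OF bounded_linear_snd iF(1)]
      integral_bounded_linear[OF bounded_linear_matrix_apply iG(1)])
  also have "\<dots> = Hv p" unfolding iF(2) iG(2) by (simp add: mean_F(2) mean_yy(2) Hv_def dir_v_def grad_y_f p)
  finally show "(\<integral>s. hv s p \<partial>D) = Hv p" .
qed

lemma hy_lipschitz:
  assumes "s \<in> space D"
  shows "(norm (hy s z' - hy s z))\<^sup>2 \<le> Lg\<^sup>2 * (norm (z' - z))\<^sup>2"
  using power_mono[OF smooth_lipschitz_pair.dir_y_lipschitz[OF sample_pair'[OF assms]] norm_ge_zero, of z' z 2]
  by (simp add: hy_def power_mult_distrib)

lemma h_lipschitz:
  assumes "s \<in> space D" and "norm (snd p) \<le> M"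
  shows "(norm (hx s p' - hx s p))\<^sup>2 \<le> M1 * (norm (fst p' - fst p))\<^sup>2 + 2 * Lg\<^sup>2 * (norm (snd p' - snd p))\<^sup>2"
    and "(norm (hv s p' - hv s p))\<^sup>2 \<le> M1 * (norm (fst p' - fst p))\<^sup>2 + 2 * Lg\<^sup>2 * (norm (snd p' - snd p))\<^sup>2"
  using smooth_lipschitz_pair.dir_lipschitz_power2[OF sample_pair'[OF assms(1)] assms(2)]
  by (simp_all add: hx_def hv_def M1_def)

text \<open>For v in the ball a sampled direction and its mean are both bounded by Cf + Lg * M; the
  square of twice this bound dominates the variance.\<close>

definition "dir_var = (2 * (Cf + Lg * M))\<^sup>2"

lemma h_variance:
  assumes "norm (snd p) \<le> M"
  shows "integrable D (\<lambda>s. (norm (hx s p - Hx p))\<^sup>2)" "(\<integral>s. (norm (hx s p - Hx p))\<^sup>2 \<partial>D) \<le> dir_var"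
    and "integrable D (\<lambda>s. (norm (hv s p - Hv p))\<^sup>2)" "(\<integral>s. (norm (hv s p - Hv p))\<^sup>2 \<partial>D) \<le> dir_var"
proof -
  have *: "integrable D (\<lambda>s. (norm (h s))\<^sup>2) \<and> (\<integral>s. (norm (h s))\<^sup>2 \<partial>D) \<le> dir_var"
    if h: "h \<in> borel_measurable D" and bound: "\<And>s. s \<in> space D \<Longrightarrow> norm (h s) \<le> 2 * (Cf + Lg * M)"
    for h :: "'u \<times> 'w \<Rightarrow> 'e::euclidean_space"
  proof
    show i: "integrable D (\<lambda>s. (norm (h s))\<^sup>2)"
      using D.sq_integrable_bounded[OF h bound] by (simp add: sq_integrable_def)
    have "(\<integral>s. (norm (h s))\<^sup>2 \<partial>D) \<le> (\<integral>s. dir_var \<partial>D)"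
      using bound by (intro integral_mono i) (auto simp: dir_var_def intro!: power_mono)
    then show "(\<integral>s. (norm (h s))\<^sup>2 \<partial>D) \<le> dir_var" by (simp add: D.prob_space)
  qed
  have "norm (hx s p - Hx p) \<le> 2 * (Cf + Lg * M)" "norm (hv s p - Hv p) \<le> 2 * (Cf + Lg * M)" if "s \<in> space D" for s
    using norm_triangle_ineq4[of "hx s p" "Hx p"] norm_triangle_ineq4[of "hv s p" "Hv p"]
      smooth_lipschitz_pair.dir_bounded[OF sample_pair'[OF that] assms, of "fst p"] dir_bounded[OF assms, of "fst p"]
    by (simp_all add: hx_def hv_def Hx_def Hv_def)
  then show "integrable D (\<lambda>s. (norm (hx s p - Hx p))\<^sup>2)" "(\<integral>s. (norm (hx s p - Hx p))\<^sup>2 \<partial>D) \<le> dir_var"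
    "integrable D (\<lambda>s. (norm (hv s p - Hv p))\<^sup>2)" "(\<integral>s. (norm (hv s p - Hv p))\<^sup>2 \<partial>D) \<le> dir_var"
    using *[of "\<lambda>s. hx s p - Hx p"] *[of "\<lambda>s. hv s p - Hv p"]
      borel_measurable_integrable[OF hx_mean(1)] borel_measurable_integrable[OF hv_mean(1)] by auto
qed

text \<open>The y-direction has no uniform bound, so its variance comes from A3: it is a component
  of the full gradient, and passing to a component does not increase the norm.\<close>

lemma hy_variance:
  shows "integrable D (\<lambda>s. (norm (hy s z - dir_y g z))\<^sup>2)" "(\<integral>s. (norm (hy s z - dir_y g z))\<^sup>2 \<partial>D) \<le> \<sigma>g\<^sup>2"
proof -
  note v = integral_snd_component[OF var_G(1)[of z]]
  have le: "(norm (hy s z - dir_y g z))\<^sup>2 \<le> (norm (grad (G (snd s)) z - grad g z))\<^sup>2" if "s \<in> space D" for s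
    using smooth_lipschitz_pair.dir_y_eq[OF sample_pair'[OF that]] norm_snd_le'[of "grad (G (snd s)) z - grad g z"]
    by (intro power_mono) (auto simp: hy_def dir_y_eq)
  show i: "integrable D (\<lambda>s. (norm (hy s z - dir_y g z))\<^sup>2)"
    using sq_integrable_bound[OF _ v(1) le] borel_measurable_integrable[OF hy_mean(1)]
    by (simp add: sq_integrable_def)
  show "(\<integral>s. (norm (hy s z - dir_y g z))\<^sup>2 \<partial>D) \<le> \<sigma>g\<^sup>2"
    using integral_mono[OF i v(1) le] v(2) var_G(2)[of z] by linarith
qed

subsection \<open>The iterates as random variables\<close>

definition params where
  "params = \<lparr>als_T = T, als_J = J, als_q1 = q1, als_S1 = S1, als_S2 = q1,
      als_lam1 = lam1, als_lam2 = lam2, als_alpha = \<alpha>, als_beta = \<beta>, als_eta = \<eta>,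
      als_tau_x = 0, als_tau_y = 0, als_tau_v = 0, als_M = M\<rparr>"

definition state where "state k \<omega> = als_state params F G x0 y0 v0 (\<lambda>S i. smp (S, i) \<omega>) k"

definition X where "X k \<omega> = fst (fst (state k \<omega>))"
definition Y where "Y k \<omega> = fst (snd (fst (state k \<omega>)))"
definition V where "V k \<omega> = snd (snd (fst (state k \<omega>)))"

text \<open>The direction in force in iteration k, after a possible refresh; \<open>state\<close>
  stores the estimate carried over.\<close>

definition DX where
  "DX k \<omega> = (if k mod q1 = 0 then (\<Sum>j<S1. hx (smp (Outer X_dir k, j) \<omega>) ((X k \<omega>, Y k \<omega>), V k \<omega>)) /\<^sub>R real S1
    else fst (snd (state k \<omega>)))"
definition DY where
  "DY k \<omega> = (if k mod q1 = 0 then (\<Sum>j<S1. hy (smp (Outer Y_dir k, j) \<omega>) (X k \<omega>, Y k \<omega>)) /\<^sub>R real S1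
    else fst (snd (snd (state k \<omega>))))"
definition DV where
  "DV k \<omega> = (if k mod q1 = 0 then (\<Sum>j<S1. hv (smp (Outer V_dir k, j) \<omega>) ((X k \<omega>, Y k \<omega>), V k \<omega>)) /\<^sub>R real S1
    else snd (snd (snd (state k \<omega>))))"

definition yloop where
  "yloop k t \<omega> = y_loop params G (\<lambda>S i. smp (S, i) \<omega>) k (X k \<omega>) (X k \<omega> - \<alpha> *\<^sub>R DX k \<omega>) (Y k \<omega>) (DY k \<omega>) t"
definition vloop where
  "vloop k j \<omega> = v_loop params F G (\<lambda>S i. smp (S, i) \<omega>) k (X k \<omega>, Y k \<omega>)
    (X k \<omega> - \<alpha> *\<^sub>R DX k \<omega>, fst (yloop k T \<omega>)) (V k \<omega>) (DX k \<omega>) (DV k \<omega>) j"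

definition yl where "yl k t \<omega> = fst (yloop k t \<omega>)"
definition dyl where "dyl k t \<omega> = snd (yloop k t \<omega>)"
definition vl where "vl k j \<omega> = fst (vloop k j \<omega>)"
definition dxl where "dxl k j \<omega> = fst (snd (vloop k j \<omega>))"
definition dvl where "dvl k j \<omega> = snd (snd (vloop k j \<omega>))"

text \<open>As loop indices are shifted by one, \<open>zy k t\<close> and \<open>zv k j\<close> are
  the points at which \<open>dyl k t\<close>, \<open>dxl k j\<close> and \<open>dvl k j\<close>
  estimate the directions; index 0 is the point before the outer step.\<close>

definition zy where "zy k t \<omega> = (if t = 0 then X k \<omega> else X (Suc k) \<omega>, yl k t \<omega>)"
definition zv where
  "zv k j \<omega> = (if j = 0 then (X k \<omega>, Y k \<omega>) else (X (Suc k) \<omega>, Y (Suc k) \<omega>), vl k j \<omega>)"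

lemma state_Suc:
  "state (Suc k) \<omega> = ((X k \<omega> - \<alpha> *\<^sub>R DX k \<omega>, yl k T \<omega>, vl k J \<omega>), (dxl k J \<omega>, dyl k T \<omega>, dvl k J \<omega>))"
  unfolding yl_def vl_def dxl_def dyl_def dvl_def vloop_def yloop_def DX_def DY_def DV_def X_def Y_def V_def
    state_def als_state.simps
  by (simp add: Let_def case_prod_beta params_def batch_avg_def hx_def hy_def hv_def)

lemma X_0: "X 0 \<omega> = x0" and Y_0: "Y 0 \<omega> = y0" and V_0: "V 0 \<omega> = v0"
  by (simp_all add: X_def Y_def V_def state_def)

lemma X_Suc: "X (Suc k) \<omega> = X k \<omega> - \<alpha> *\<^sub>R DX k \<omega>" and Y_Suc: "Y (Suc k) \<omega> = yl k T \<omega>"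
  and V_Suc: "V (Suc k) \<omega> = vl k J \<omega>"
  by (simp_all add: X_def Y_def V_def state_Suc)

lemma carry_over:
  assumes "Suc k mod q1 \<noteq> 0"
  shows "DX (Suc k) \<omega> = dxl k J \<omega>" "DY (Suc k) \<omega> = dyl k T \<omega>" "DV (Suc k) \<omega> = dvl k J \<omega>"
  using assms by (simp_all add: DX_def DY_def DV_def state_Suc)

lemma loop_0: "yl k 0 \<omega> = Y k \<omega>" "dyl k 0 \<omega> = DY k \<omega>" "vl k 0 \<omega> = V k \<omega>" "dxl k 0 \<omega> = DX k \<omega>" "dvl k 0 \<omega> = DV k \<omega>"
  by (simp_all add: yl_def dyl_def vl_def dxl_def dvl_def yloop_def vloop_def)

lemma yl_Suc: "yl k (Suc t) \<omega> = yl k t \<omega> - a *\<^sub>R dyl k t \<omega>"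
  by (simp add: yl_def dyl_def yloop_def Let_def case_prod_beta params_def)

lemma dyl_Suc:
  "dyl k (Suc t) \<omega> = (\<Sum>j<q1. hy (smp (Inner Y_dir k t, j) \<omega>) (zy k (Suc t) \<omega>)) /\<^sub>R real q1
    + (dyl k t \<omega> - (\<Sum>j<q1. hy (smp (Inner Y_dir k t, j) \<omega>) (zy k t \<omega>)) /\<^sub>R real q1)"
  unfolding zy_def X_Suc yl_Suc
  by (simp add: yl_def dyl_def yloop_def Let_def case_prod_beta params_def batch_avg_def hy_def)

lemma vl_Suc: "vl k (Suc j) \<omega> = closest_point (cball 0 M) (vl k j \<omega> - b *\<^sub>R dvl k j \<omega>)"
  by (simp add: vl_def dvl_def vloop_def Let_def case_prod_beta params_def)

lemma dxl_Suc:
  "dxl k (Suc j) \<omega> = (\<Sum>i<q1. hx (smp (Inner X_dir k j, i) \<omega>) (zv k (Suc j) \<omega>)) /\<^sub>R real q1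
    + (dxl k j \<omega> - (\<Sum>i<q1. hx (smp (Inner X_dir k j, i) \<omega>) (zv k j \<omega>)) /\<^sub>R real q1)"
  unfolding zv_def X_Suc Y_Suc vl_Suc
  by (simp add: vl_def dvl_def dxl_def yl_def vloop_def Let_def case_prod_beta params_def batch_avg_def hx_def)

lemma dvl_Suc:
  "dvl k (Suc j) \<omega> = (\<Sum>i<q1. hv (smp (Inner V_dir k j, i) \<omega>) (zv k (Suc j) \<omega>)) /\<^sub>R real q1
    + (dvl k j \<omega> - (\<Sum>i<q1. hv (smp (Inner V_dir k j, i) \<omega>) (zv k j \<omega>)) /\<^sub>R real q1)"
  unfolding zv_def X_Suc Y_Suc vl_Suc
  by (simp add: vl_def dvl_def dxl_def yl_def vloop_def Let_def case_prod_beta params_def batch_avg_def hv_def)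

lemma proj_le: "norm (closest_point (cball 0 M) p) \<le> M"
  using closest_point_in_set[of "cball 0 M" p] M_nonneg by (simp add: dist_norm)

lemma proj_nonexpansive:
  fixes p w :: "real ^ 'q"
  assumes "norm w \<le> M"
  shows "norm (closest_point (cball 0 M) p - w) \<le> norm (p - w)"
proof -
  have "closest_point (cball 0 M) w = w" using assms by (intro closest_point_self) (simp add: dist_norm)
  then show ?thesis
    using closest_point_lipschitz[of "cball 0 M" p w] M_nonneg by (simp add: dist_norm)
qed

lemma vl_bound: "norm (V k \<omega>) \<le> M \<Longrightarrow> norm (vl k j \<omega>) \<le> M"
  by (cases j) (auto simp: loop_0 vl_Suc proj_le)

lemma V_bound: "norm (V k \<omega>) \<le> M"
  by (induction k) (auto simp: V_0 v0 V_Suc vl_bound)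

lemma zv_bound: "norm (snd (zv k j \<omega>)) \<le> M"
  by (simp add: zv_def vl_bound V_bound)

subsection \<open>Measurability and second moments\<close>

abbreviation "N \<equiv> T + J + 1"
text \<open>The filtration of the run, with time measured by the rank of a sample set rather than by
  the iteration.\<close>

definition "drawn_before n = {i \<in> I. rank T J (fst i) < n}"
definition "adapted n U \<longleftrightarrow> U \<in> borel_measurable (past (drawn_before n))"

lemma drawn_before_sub: "drawn_before n \<subseteq> I" by (auto simp: drawn_before_def)

lemma adapted_mono: "adapted n U \<Longrightarrow> n \<le> m \<Longrightarrow> adapted m U"
  unfolding adapted_def by (rule past_mono) (auto simp: drawn_before_def)

lemma adapted_random: "adapted n U \<Longrightarrow> random_variable borel U"
  unfolding adapted_def by (rule past_random[OF _ drawn_before_sub])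

text \<open>A set of rank n is fresh at time n and known at time n + 1. Sets sharing a rank, such as
  the x- and v-sets of one inner step, are all fresh against the same past, so no order among them
  is needed.\<close>

lemma batch_indices:
  assumes "\<And>j. j < n \<Longrightarrow> (S, j) \<in> I"
  shows "inj (Pair S)" and "\<And>j. j < n \<Longrightarrow> (S, j) \<in> I - drawn_before (rank T J S)"
    and "drawn_before (rank T J S) \<union> Pair S ` {..<n} \<subseteq> drawn_before (Suc (rank T J S))"
  using assms by (auto simp: drawn_before_def inj_def)

lemma drawn_batches:
  assumes "k < K"
  shows "k mod q1 = 0 \<Longrightarrow> j < S1 \<Longrightarrow> (Outer d k, j) \<in> I"
    and "t < T \<Longrightarrow> i < q1 \<Longrightarrow> (Inner Y_dir k t, i) \<in> I"
    and "t < J \<Longrightarrow> i < q1 \<Longrightarrow> (Inner X_dir k t, i) \<in> I"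
    and "t < J \<Longrightarrow> i < q1 \<Longrightarrow> (Inner V_dir k t, i) \<in> I"
  using assms by (auto simp: drawn_def)

definition err_y where "err_y k t \<omega> = dyl k t \<omega> - dir_y g (zy k t \<omega>)"
definition err_x where "err_x k j \<omega> = dxl k j \<omega> - Hx (zv k j \<omega>)"
definition err_v where "err_v k j \<omega> = dvl k j \<omega> - Hv (zv k j \<omega>)"

lemma y_step:
  assumes k: "k < K" "t < T" and n: "n = k * N + 1 + t"
    and z: "adapted n (zy k t)" "adapted n (zy k (Suc t))" and d: "adapted n (dyl k t)" "sq_integrable P (err_y k t)"
    and i: "integrable P (\<lambda>\<omega>. (norm (zy k (Suc t) \<omega> - zy k t \<omega>))\<^sup>2)"
  shows "adapted (Suc n) (dyl k (Suc t))" and "sq_integrable P (err_y k (Suc t))"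
    and "(\<integral>\<omega>. (norm (err_y k (Suc t) \<omega>))\<^sup>2 \<partial>P) \<le> (\<integral>\<omega>. (norm (err_y k t \<omega>))\<^sup>2 \<partial>P)
      + Lg\<^sup>2 * (\<integral>\<omega>. (norm (zy k (Suc t) \<omega> - zy k t \<omega>))\<^sup>2 \<partial>P) / real q1"
proof -
  let ?S = "Inner Y_dir k t"
  have r: "rank T J ?S = n" by (simp add: n)
  have mem: "\<And>j. j < q1 \<Longrightarrow> (?S, j) \<in> I" using k by (rule drawn_batches)
  note step = spider_update[OF drawn_before_sub[of n] batch_indices(1,2)[of q1 ?S, OF mem, unfolded r] q1
      h_continuous(2) dir_y_continuous hy_mean z[unfolded adapted_def] d(1)[unfolded adapted_def]
      d(2)[unfolded err_y_def] integrable_mult_right[OF i, of "Lg\<^sup>2"] hy_lipschitz, folded dyl_Suc]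
  show "adapted (Suc n) (dyl k (Suc t))"
    unfolding adapted_def using past_mono[OF step(1) batch_indices(3)[of q1 ?S, OF mem, unfolded r] drawn_before_sub] by simp
  show "sq_integrable P (err_y k (Suc t))" using step(2) by (simp add: err_y_def[abs_def])
  show "(\<integral>\<omega>. (norm (err_y k (Suc t) \<omega>))\<^sup>2 \<partial>P) \<le> (\<integral>\<omega>. (norm (err_y k t \<omega>))\<^sup>2 \<partial>P)
      + Lg\<^sup>2 * (\<integral>\<omega>. (norm (zy k (Suc t) \<omega> - zy k t \<omega>))\<^sup>2 \<partial>P) / real q1"
    using step(3) by (simp add: err_y_def)
qed

text \<open>The x- and v-estimates are updated between the same two points and obey the same
  Lipschitz bound, so a single B serves both; both updates start from the information before rank
  n.\<close>

lemma v_step: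
  assumes k: "k < K" "j < J" and n: "n = k * N + 1 + T + j"
    and z: "adapted n (zv k j)" "adapted n (zv k (Suc j))"
    and d: "adapted n (dxl k j)" "adapted n (dvl k j)" "sq_integrable P (err_x k j)" "sq_integrable P (err_v k j)"
    and i: "integrable P B" and B: "\<And>\<omega>. \<omega> \<in> space P \<Longrightarrow>
      M1 * (norm (fst (zv k (Suc j) \<omega>) - fst (zv k j \<omega>)))\<^sup>2
        + 2 * Lg\<^sup>2 * (norm (snd (zv k (Suc j) \<omega>) - snd (zv k j \<omega>)))\<^sup>2 \<le> B \<omega>"
  shows "adapted (Suc n) (dxl k (Suc j))" "adapted (Suc n) (dvl k (Suc j))"
    and "sq_integrable P (err_x k (Suc j))" "sq_integrable P (err_v k (Suc j))"
    and "(\<integral>\<omega>. (norm (err_x k (Suc j) \<omega>))\<^sup>2 \<partial>P) \<le> (\<integral>\<omega>. (norm (err_x k j \<omega>))\<^sup>2 \<partial>P) + (\<integral>\<omega>. B \<omega> \<partial>P) / real q1"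
    and "(\<integral>\<omega>. (norm (err_v k (Suc j) \<omega>))\<^sup>2 \<partial>P) \<le> (\<integral>\<omega>. (norm (err_v k j \<omega>))\<^sup>2 \<partial>P) + (\<integral>\<omega>. B \<omega> \<partial>P) / real q1"
proof -
  have r: "rank T J (Inner X_dir k j) = n" "rank T J (Inner V_dir k j) = n" by (simp_all add: n)
  have memx: "\<And>i. i < q1 \<Longrightarrow> (Inner X_dir k j, i) \<in> I" using k by (rule drawn_batches)
  have memv: "\<And>i. i < q1 \<Longrightarrow> (Inner V_dir k j, i) \<in> I" using k by (rule drawn_batches)
  note bx = order_trans[OF h_lipschitz(1)[OF _ zv_bound] B] and bv = order_trans[OF h_lipschitz(2)[OF _ zv_bound] B]
  note sx = spider_update[OF drawn_before_sub[of n] batch_indices(1,2)[of q1 "Inner X_dir k j", OF memx, unfolded r] q1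
      h_continuous(1) H_continuous(1) hx_mean z[unfolded adapted_def] d(1)[unfolded adapted_def] d(3)[unfolded err_x_def] i bx,
      folded dxl_Suc]
  note sv = spider_update[OF drawn_before_sub[of n] batch_indices(1,2)[of q1 "Inner V_dir k j", OF memv, unfolded r] q1
      h_continuous(3) H_continuous(2) hv_mean z[unfolded adapted_def] d(2)[unfolded adapted_def] d(4)[unfolded err_v_def] i bv,
      folded dvl_Suc]
  show "adapted (Suc n) (dxl k (Suc j))"
    unfolding adapted_def using past_mono[OF sx(1) batch_indices(3)[of q1 "Inner X_dir k j", OF memx, unfolded r] drawn_before_sub] by simp
  show "adapted (Suc n) (dvl k (Suc j))"
    unfolding adapted_def using past_mono[OF sv(1) batch_indices(3)[of q1 "Inner V_dir k j", OF memv, unfolded r] drawn_before_sub] by simp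
  show "sq_integrable P (err_x k (Suc j))" "sq_integrable P (err_v k (Suc j))"
    using sx(2) sv(2) by (simp_all add: err_x_def[abs_def] err_v_def[abs_def])
  show "(\<integral>\<omega>. (norm (err_x k (Suc j) \<omega>))\<^sup>2 \<partial>P) \<le> (\<integral>\<omega>. (norm (err_x k j \<omega>))\<^sup>2 \<partial>P) + (\<integral>\<omega>. B \<omega> \<partial>P) / real q1"
    "(\<integral>\<omega>. (norm (err_v k (Suc j) \<omega>))\<^sup>2 \<partial>P) \<le> (\<integral>\<omega>. (norm (err_v k j \<omega>))\<^sup>2 \<partial>P) + (\<integral>\<omega>. B \<omega> \<partial>P) / real q1"
    using sx(3) sv(3) by (simp_all add: err_x_def err_v_def)
qed

lemma move_y:
  "(norm (zy k (Suc t) \<omega> - zy k t \<omega>))\<^sup>2 = (if t = 0 then \<alpha>\<^sup>2 * (norm (DX k \<omega>))\<^sup>2 else 0) + a\<^sup>2 * (norm (dyl k t \<omega>))\<^sup>2"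
  by (simp add: zy_def X_Suc yl_Suc norm_Pair power_mult_distrib)

lemma yl_sum: "yl k t \<omega> = Y k \<omega> - a *\<^sub>R (\<Sum>i<t. dyl k i \<omega>)"
  by (induction t) (simp_all add: loop_0 yl_Suc scaleR_add_right)

text \<open>Bounds the squared increment of a sampled x- or v-direction in inner step j. The pair
  (x, y) moves only in step 0, by the outer step and the entire y-loop at once; afterwards only v
  moves.\<close>

definition Bv where
  "Bv k j \<omega> = (if j = 0 then M1 * (\<alpha>\<^sup>2 * (norm (DX k \<omega>))\<^sup>2 + a\<^sup>2 * (real T * (\<Sum>t<T. (norm (dyl k t \<omega>))\<^sup>2))) else 0)
    + 2 * Lg\<^sup>2 * (b\<^sup>2 * (norm (dvl k j \<omega>))\<^sup>2)"

text \<open>Nonexpansiveness of the projection, applied at the current v, which already lies in the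
  ball, bounds the move of v by the unprojected step.\<close>

lemma move_v:
  "M1 * (norm (fst (zv k (Suc j) \<omega>) - fst (zv k j \<omega>)))\<^sup>2
    + 2 * Lg\<^sup>2 * (norm (snd (zv k (Suc j) \<omega>) - snd (zv k j \<omega>)))\<^sup>2 \<le> Bv k j \<omega>"
proof -
  have "norm (vl k (Suc j) \<omega> - vl k j \<omega>) \<le> norm (vl k j \<omega> - b *\<^sub>R dvl k j \<omega> - vl k j \<omega>)"
    unfolding vl_Suc by (rule proj_nonexpansive) (rule vl_bound[OF V_bound])
  then have "(norm (vl k (Suc j) \<omega> - vl k j \<omega>))\<^sup>2 \<le> (norm (b *\<^sub>R dvl k j \<omega>))\<^sup>2"
    by (intro power_mono) auto
  then have "2 * Lg\<^sup>2 * (norm (snd (zv k (Suc j) \<omega>) - snd (zv k j \<omega>)))\<^sup>2 \<le> 2 * Lg\<^sup>2 * (b\<^sup>2 * (norm (dvl k j \<omega>))\<^sup>2)"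
    unfolding zv_def by (intro mult_left_mono) (simp_all add: power_mult_distrib)
  moreover have "M1 * (norm (fst (zv k (Suc 0) \<omega>) - fst (zv k 0 \<omega>)))\<^sup>2
      \<le> M1 * (\<alpha>\<^sup>2 * (norm (DX k \<omega>))\<^sup>2 + a\<^sup>2 * (real T * (\<Sum>t<T. (norm (dyl k t \<omega>))\<^sup>2)))"
  proof (rule mult_left_mono[OF _ M1_nonneg])
    have "(norm (fst (zv k (Suc 0) \<omega>) - fst (zv k 0 \<omega>)))\<^sup>2
        = \<alpha>\<^sup>2 * (norm (DX k \<omega>))\<^sup>2 + a\<^sup>2 * (norm (\<Sum>t<T. dyl k t \<omega>))\<^sup>2"
      unfolding zv_def X_Suc Y_Suc yl_sum by (simp add: norm_Pair power_mult_distrib)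
    also have "\<dots> \<le> \<alpha>\<^sup>2 * (norm (DX k \<omega>))\<^sup>2 + a\<^sup>2 * (real T * (\<Sum>t<T. (norm (dyl k t \<omega>))\<^sup>2))"
      by (intro add_left_mono mult_left_mono norm_sum_power2_le) simp
    finally show "(norm (fst (zv k (Suc 0) \<omega>) - fst (zv k 0 \<omega>)))\<^sup>2
      \<le> \<alpha>\<^sup>2 * (norm (DX k \<omega>))\<^sup>2 + a\<^sup>2 * (real T * (\<Sum>t<T. (norm (dyl k t \<omega>))\<^sup>2))" .
  qed
  moreover have "fst (zv k (Suc j) \<omega>) - fst (zv k j \<omega>) = 0" if "j \<noteq> 0" using that by (simp add: zv_def)
  ultimately show ?thesis by (cases "j = 0") (simp_all add: Bv_def)
qed

text \<open>The induction invariant at the start of iteration k. A refresh discards the carried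
  estimates, so they are constrained only at the other indices; this takes care of k = 0, where the
  stored values are dummies.\<close>

definition regular where
  "regular k \<longleftrightarrow> adapted (k * N) (X k) \<and> adapted (k * N) (Y k) \<and> adapted (k * N) (V k)
    \<and> sq_integrable P (X k) \<and> sq_integrable P (Y k)
    \<and> (k mod q1 \<noteq> 0 \<longrightarrow> adapted (k * N) (DX k) \<and> adapted (k * N) (DY k) \<and> adapted (k * N) (DV k)
      \<and> sq_integrable P (err_x k 0) \<and> sq_integrable P (err_y k 0) \<and> sq_integrable P (err_v k 0))"

lemma regular_0: "regular 0"
  unfolding regular_def adapted_def X_0[abs_def] Y_0[abs_def] V_0[abs_def] by (simp add: sq_integrable_const)

lemma zv_0: "zv k 0 = (\<lambda>\<omega>. ((X k \<omega>, Y k \<omega>), V k \<omega>))" and zy_0: "zy k 0 = (\<lambda>\<omega>. (X k \<omega>, Y k \<omega>))"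
  by (auto simp: zv_def zy_def loop_0)

text \<open>Once the outer sets are drawn both cases look alike: the directions are either new
  averages over S1 samples or carried estimates, which were known one rank earlier.\<close>

lemma refreshed:
  assumes k: "k < K" and regular: "regular k"
  shows "adapted (k * N + 1) (DX k)" "adapted (k * N + 1) (DY k)" "adapted (k * N + 1) (DV k)"
    and "sq_integrable P (err_x k 0)" "sq_integrable P (err_y k 0)" "sq_integrable P (err_v k 0)"
    and "k mod q1 = 0 \<Longrightarrow> (\<integral>\<omega>. (norm (err_x k 0 \<omega>))\<^sup>2 \<partial>P) \<le> dir_var / real S1"
    and "k mod q1 = 0 \<Longrightarrow> (\<integral>\<omega>. (norm (err_y k 0 \<omega>))\<^sup>2 \<partial>P) \<le> \<sigma>g\<^sup>2 / real S1"
    and "k mod q1 = 0 \<Longrightarrow> (\<integral>\<omega>. (norm (err_v k 0 \<omega>))\<^sup>2 \<partial>P) \<le> dir_var / real S1"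
proof -
  have "adapted (k * N + 1) (DX k) \<and> adapted (k * N + 1) (DY k) \<and> adapted (k * N + 1) (DV k)
      \<and> sq_integrable P (err_x k 0) \<and> sq_integrable P (err_y k 0) \<and> sq_integrable P (err_v k 0)
      \<and> (k mod q1 = 0 \<longrightarrow> (\<integral>\<omega>. (norm (err_x k 0 \<omega>))\<^sup>2 \<partial>P) \<le> dir_var / real S1
        \<and> (\<integral>\<omega>. (norm (err_y k 0 \<omega>))\<^sup>2 \<partial>P) \<le> \<sigma>g\<^sup>2 / real S1
        \<and> (\<integral>\<omega>. (norm (err_v k 0 \<omega>))\<^sup>2 \<partial>P) \<le> dir_var / real S1)"
  proof (cases "k mod q1 = 0")
    case False
    then have "adapted (k * N) (DX k)" "adapted (k * N) (DY k)" "adapted (k * N) (DV k)" using regular by (auto simp: regular_def)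
    from this[THEN adapted_mono, of "k * N + 1"] False show ?thesis using regular by (simp add: regular_def)
  next
    case True
    have r: "rank T J (Outer d k) = k * N" for d by simp
    have mem: "\<And>d j. j < S1 \<Longrightarrow> (Outer d k, j) \<in> I" using drawn_batches(1)[OF k True] by blast
    have m: "X k \<in> borel_measurable (past (drawn_before (k * N)))" "Y k \<in> borel_measurable (past (drawn_before (k * N)))"
      "V k \<in> borel_measurable (past (drawn_before (k * N)))" using regular by (auto simp: regular_def adapted_def)
    have u: "zy k 0 \<in> borel_measurable (past (drawn_before (k * N)))" "zv k 0 \<in> borel_measurable (past (drawn_before (k * N)))"
      unfolding zv_0 zy_0 by (intro borel_measurable_Pair m)+
    note idx = batch_indices(1,2)[of S1 "Outer _ k", OF mem, unfolded r]
      and sub = batch_indices(3)[of S1 "Outer _ k", OF mem, unfolded r]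
    note sx = spider_refresh[OF drawn_before_sub[of "k * N"] idx S1 h_continuous(1) H_continuous(1) hx_mean u(2)
        h_variance(1,2)[OF zv_bound], of X_dir]
    note sv = spider_refresh[OF drawn_before_sub[of "k * N"] idx S1 h_continuous(3) H_continuous(2) hv_mean u(2)
        h_variance(3,4)[OF zv_bound], of V_dir]
    note sy = spider_refresh[OF drawn_before_sub[of "k * N"] idx S1 h_continuous(2) dir_y_continuous hy_mean u(1)
        hy_variance, of Y_dir]
    have eq: "(\<lambda>\<omega>. (\<Sum>j<S1. hx (smp (Outer X_dir k, j) \<omega>) (zv k 0 \<omega>)) /\<^sub>R real S1) = DX k"
      "(\<lambda>\<omega>. (\<Sum>j<S1. hy (smp (Outer Y_dir k, j) \<omega>) (zy k 0 \<omega>)) /\<^sub>R real S1) = DY k"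
      "(\<lambda>\<omega>. (\<Sum>j<S1. hv (smp (Outer V_dir k, j) \<omega>) (zv k 0 \<omega>)) /\<^sub>R real S1) = DV k"
      using True by (auto simp: DX_def DY_def DV_def zv_0 zy_0)
    have er: "err_x k 0 = (\<lambda>\<omega>. DX k \<omega> - Hx (zv k 0 \<omega>))" "err_y k 0 = (\<lambda>\<omega>. DY k \<omega> - dir_y g (zy k 0 \<omega>))"
      "err_v k 0 = (\<lambda>\<omega>. DV k \<omega> - Hv (zv k 0 \<omega>))"
      by (auto simp: err_x_def err_y_def err_v_def loop_0)
    show ?thesis
      unfolding adapted_def er
      using past_mono[OF sx(1) sub drawn_before_sub] past_mono[OF sy(1) sub drawn_before_sub] past_mono[OF sv(1) sub drawn_before_sub]
        sx(2,3) sy(2,3) sv(2,3) eq[THEN fun_cong] by (simp add: eq)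
  qed
  then show "adapted (k * N + 1) (DX k)" "adapted (k * N + 1) (DY k)" "adapted (k * N + 1) (DV k)"
    "sq_integrable P (err_x k 0)" "sq_integrable P (err_y k 0)" "sq_integrable P (err_v k 0)"
    "k mod q1 = 0 \<Longrightarrow> (\<integral>\<omega>. (norm (err_x k 0 \<omega>))\<^sup>2 \<partial>P) \<le> dir_var / real S1"
    "k mod q1 = 0 \<Longrightarrow> (\<integral>\<omega>. (norm (err_y k 0 \<omega>))\<^sup>2 \<partial>P) \<le> \<sigma>g\<^sup>2 / real S1"
    "k mod q1 = 0 \<Longrightarrow> (\<integral>\<omega>. (norm (err_v k 0 \<omega>))\<^sup>2 \<partial>P) \<le> dir_var / real S1"
    by auto
qed

text \<open>An estimate is its error plus the mean direction, and the latter is bounded because v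
  stays in the ball.\<close>

lemma sq_integrable_dvl_dxl:
  assumes "adapted n (zv k j)"
  shows "sq_integrable P (err_x k j) \<Longrightarrow> sq_integrable P (dxl k j)"
    and "sq_integrable P (err_v k j) \<Longrightarrow> sq_integrable P (dvl k j)"
proof -
  have m: "random_variable borel (zv k j)" using assms by (rule adapted_random)
  have Hm: "Hx \<in> borel_measurable borel" "Hv \<in> borel_measurable borel"
    using H_continuous by (auto intro: borel_measurable_continuous_onI)
  have "sq_integrable P (\<lambda>\<omega>. Hx (zv k j \<omega>))"
    by (rule sq_integrable_bounded[OF measurable_compose[OF m Hm(1)]])
       (use dir_bounded(1)[OF zv_bound] in \<open>simp add: Hx_def\<close>)
  then show "sq_integrable P (err_x k j) \<Longrightarrow> sq_integrable P (dxl k j)"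
    using sq_integrable_add[of P "err_x k j" "\<lambda>\<omega>. Hx (zv k j \<omega>)"] by (simp add: err_x_def)
  have "sq_integrable P (\<lambda>\<omega>. Hv (zv k j \<omega>))"
    by (rule sq_integrable_bounded[OF measurable_compose[OF m Hm(2)]])
       (use dir_bounded(2)[OF zv_bound] in \<open>simp add: Hv_def\<close>)
  then show "sq_integrable P (err_v k j) \<Longrightarrow> sq_integrable P (dvl k j)"
    using sq_integrable_add[of P "err_v k j" "\<lambda>\<omega>. Hv (zv k j \<omega>)"] by (simp add: err_v_def)
qed

text \<open>In contrast to the x- and v-directions, the mean y-direction is controlled by linear
  growth, which calls for a square-integrable evaluation point.\<close>

lemma sq_integrable_dyl:
  assumes "sq_integrable P (zy k t)" and "sq_integrable P (err_y k t)"
  shows "sq_integrable P (dyl k t)"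
proof -
  have "Lg-lipschitz_on UNIV (dir_y g)"
    by (rule lipschitz_onI[OF _ Lg_nonneg]) (unfold dist_norm, rule dir_y_lipschitz)
  from sq_integrable_add[OF assms(2) sq_integrable_lipschitz[OF assms(1) this]]
  show ?thesis by (simp add: err_y_def)
qed

lemma X_Suc_regular:
  assumes k: "k < K" and regular: "regular k"
  shows "sq_integrable P (DX k)" and "adapted (k * N + 1) (X (Suc k))" and "sq_integrable P (X (Suc k))"
proof -
  have "adapted (k * N) (zv k 0)" using regular unfolding regular_def adapted_def zv_0 by (intro borel_measurable_Pair) auto
  then show dx: "sq_integrable P (DX k)"
    using sq_integrable_dvl_dxl(1) refreshed(4)[OF k regular] by (fastforce simp: loop_0[abs_def])
  have "adapted (k * N + 1) (X k)" using regular adapted_mono[of "k * N" "X k" "k * N + 1"] by (simp add: regular_def)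
  then show "adapted (k * N + 1) (X (Suc k))"
    using refreshed(1)[OF k regular] unfolding X_Suc[abs_def] adapted_def
    by (intro borel_measurable_diff borel_measurable_scaleR borel_measurable_const)
  show "sq_integrable P (X (Suc k))"
    unfolding X_Suc[abs_def] using regular by (intro sq_integrable_diff sq_integrable_scaleR dx) (simp add: regular_def)
qed

text \<open>Measurability, second moments and the error bound need a joint induction: the estimator
  update requires the second moment of the move, the move is a multiple of the current direction,
  and that direction is error plus mean.\<close>

lemma y_loop_regular:
  assumes k: "k < K" and regular: "regular k" and "t \<le> T"
  shows "adapted (k * N + 1 + t) (yl k t) \<and> adapted (k * N + 1 + t) (dyl k t) \<and> adapted (k * N + 1 + t) (zy k t)
    \<and> sq_integrable P (yl k t) \<and> sq_integrable P (err_y k t) \<and> sq_integrable P (dyl k t)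
    \<and> (\<integral>\<omega>. (norm (err_y k t \<omega>))\<^sup>2 \<partial>P) \<le> (\<integral>\<omega>. (norm (err_y k 0 \<omega>))\<^sup>2 \<partial>P)
      + (\<Sum>i<t. Lg\<^sup>2 * (\<integral>\<omega>. (norm (zy k (Suc i) \<omega> - zy k i \<omega>))\<^sup>2 \<partial>P)) / real q1"
  using \<open>t \<le> T\<close>
proof (induction t)
  case 0
  have m: "adapted (k * N + 1) (X k)" "adapted (k * N + 1) (Y k)"
    using regular adapted_mono[of "k * N" _ "k * N + 1"] by (auto simp: regular_def)
  have "sq_integrable P (zy k 0)" using regular unfolding zy_0 by (intro sq_integrable_Pair) (auto simp: regular_def)
  moreover have "yl k 0 = Y k" "dyl k 0 = DY k" by (auto simp: loop_0)
  ultimately show ?case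
    using m refreshed(2,5)[OF k regular] sq_integrable_dyl[of k 0] regular
    by (auto simp: regular_def adapted_def zy_0 intro: borel_measurable_Pair)
next
  case (Suc t)
  let ?n = "k * N + 1 + t"
  have IH: "adapted ?n (yl k t)" "adapted ?n (dyl k t)" "adapted ?n (zy k t)" "sq_integrable P (yl k t)"
    "sq_integrable P (err_y k t)" "sq_integrable P (dyl k t)" and t: "t < T" using Suc by auto
  have X': "adapted ?n (X (Suc k))" using X_Suc_regular(2)[OF k regular] by (rule adapted_mono) simp
  have yl': "adapted ?n (yl k (Suc t))" "sq_integrable P (yl k (Suc t))"
    unfolding yl_Suc[abs_def] using IH
    by (auto simp: adapted_def intro!: sq_integrable_diff sq_integrable_scaleR)
  have zy_S: "zy k (Suc t) = (\<lambda>\<omega>. (X (Suc k) \<omega>, yl k (Suc t) \<omega>))" by (auto simp: zy_def)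
  have z': "adapted ?n (zy k (Suc t))" using X' yl'(1) unfolding zy_S adapted_def by (rule borel_measurable_Pair)
  have sz': "sq_integrable P (zy k (Suc t))"
    unfolding zy_S by (rule sq_integrable_Pair[OF X_Suc_regular(3)[OF k regular] yl'(2)])
  have i: "integrable P (\<lambda>\<omega>. (norm (zy k (Suc t) \<omega> - zy k t \<omega>))\<^sup>2)"
    unfolding move_y using IH(6) X_Suc_regular(1)[OF k regular] by (cases "t = 0") (simp_all add: sq_integrable_def)
  note step = y_step[OF k t refl IH(3) z' IH(2,5) i]
  show ?case
    using step adapted_mono[OF yl'(1), of "Suc ?n"] adapted_mono[OF z', of "Suc ?n"] yl'(2) sq_integrable_dyl[OF sz' step(2)]
      Suc.IH t by (simp add: add_divide_distrib)
qed

lemma integrable_Bv: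
  assumes k: "k < K" and regular: "regular k" and "sq_integrable P (dvl k j)"
  shows "integrable P (Bv k j)"
proof -
  have "integrable P (\<lambda>\<omega>. \<Sum>t<T. (norm (dyl k t \<omega>))\<^sup>2)"
    using y_loop_regular[OF k regular] by (intro Bochner_Integration.integrable_sum) (simp add: sq_integrable_def)
  then show ?thesis
    unfolding Bv_def[abs_def] using X_Suc_regular(1)[OF k regular] assms(3) by (cases "j = 0") (simp_all add: sq_integrable_def)
qed

text \<open>The offset T in the rank places this loop after all y-sets of the iteration, when
  \<open>Y (Suc k)\<close> is already known.\<close>

lemma v_loop_regular:
  assumes k: "k < K" and regular: "regular k" and "j \<le> J"
  shows "adapted (k * N + 1 + T + j) (vl k j) \<and> adapted (k * N + 1 + T + j) (dxl k j) \<and> adapted (k * N + 1 + T + j) (dvl k j)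
    \<and> adapted (k * N + 1 + T + j) (zv k j) \<and> sq_integrable P (err_x k j) \<and> sq_integrable P (err_v k j) \<and> sq_integrable P (dvl k j)
    \<and> (\<integral>\<omega>. (norm (err_x k j \<omega>))\<^sup>2 \<partial>P)
      \<le> (\<integral>\<omega>. (norm (err_x k 0 \<omega>))\<^sup>2 \<partial>P) + (\<Sum>i<j. \<integral>\<omega>. Bv k i \<omega> \<partial>P) / real q1
    \<and> (\<integral>\<omega>. (norm (err_v k j \<omega>))\<^sup>2 \<partial>P)
      \<le> (\<integral>\<omega>. (norm (err_v k 0 \<omega>))\<^sup>2 \<partial>P) + (\<Sum>i<j. \<integral>\<omega>. Bv k i \<omega> \<partial>P) / real q1"
  using \<open>j \<le> J\<close>
proof (induction j)
  case 0
  have m: "adapted (k * N + 1 + T) (X k)" "adapted (k * N + 1 + T) (Y k)" "adapted (k * N + 1 + T) (V k)"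
    using regular adapted_mono[of "k * N" _ "k * N + 1 + T"] by (auto simp: regular_def)
  then have z: "adapted (k * N + 1 + T) (zv k 0)" unfolding zv_0 adapted_def by (intro borel_measurable_Pair)
  have "adapted (k * N + 1 + T) (DX k)" "adapted (k * N + 1 + T) (DV k)"
    using refreshed(1,3)[OF k regular] adapted_mono[of "k * N + 1" _ "k * N + 1 + T"] by auto
  moreover have "vl k 0 = V k" "dxl k 0 = DX k" "dvl k 0 = DV k" by (auto simp: loop_0)
  ultimately show ?case
    using m(3) z refreshed(4,6)[OF k regular] sq_integrable_dvl_dxl(2)[OF z] by simp
next
  case (Suc j)
  let ?n = "k * N + 1 + T + j"
  have IH: "adapted ?n (vl k j)" "adapted ?n (dxl k j)" "adapted ?n (dvl k j)" "adapted ?n (zv k j)"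
    "sq_integrable P (err_x k j)" "sq_integrable P (err_v k j)" "sq_integrable P (dvl k j)" and j: "j < J" using Suc by auto
  have X': "adapted ?n (X (Suc k))" using X_Suc_regular(2)[OF k regular] by (rule adapted_mono) simp
  have "adapted (k * N + 1 + T) (Y (Suc k))" using y_loop_regular[OF k regular, of T] by (simp add: Y_Suc[abs_def])
  then have Y': "adapted ?n (Y (Suc k))" by (rule adapted_mono) simp
  have "closest_point (cball 0 M) \<in> borel_measurable (borel :: (real ^ 'q) measure)"
    using M_nonneg by (intro borel_measurable_continuous_onI continuous_on_closest_point) auto
  moreover have "(\<lambda>\<omega>. vl k j \<omega> - b *\<^sub>R dvl k j \<omega>) \<in> borel_measurable (past (drawn_before ?n))"
    using IH by (auto simp: adapted_def)
  ultimately have v': "adapted ?n (vl k (Suc j))"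
    unfolding vl_Suc[abs_def] adapted_def by (rule measurable_compose[rotated])
  have zv_S: "zv k (Suc j) = (\<lambda>\<omega>. ((X (Suc k) \<omega>, Y (Suc k) \<omega>), vl k (Suc j) \<omega>))" by (auto simp: zv_def)
  have z': "adapted ?n (zv k (Suc j))" using X' Y' v' unfolding zv_S adapted_def by (intro borel_measurable_Pair)
  note step = v_step[OF k j refl IH(4) z' IH(2,3,5,6) integrable_Bv[OF k regular IH(7)] move_v]
  have z'': "adapted (Suc ?n) (zv k (Suc j))" using z' by (rule adapted_mono) simp
  show ?case
    using step adapted_mono[OF v', of "Suc ?n"] z'' sq_integrable_dvl_dxl(2)[OF z'' step(4)] Suc.IH j
    by (simp add: add_divide_distrib)
qed

text \<open>The last point of an inner loop is the first point of the next iteration, so a carried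
  estimate keeps its error. Positive T and J matter: a loop of length 0 would end at the old
  x.\<close>

lemma zy_T: "zy k T \<omega> = zy (Suc k) 0 \<omega>" and zv_J: "zv k J \<omega> = zv (Suc k) 0 \<omega>"
  using T J by (auto simp: zy_def zv_def loop_0 Y_Suc V_Suc)

lemma errors_carry_over:
  assumes "Suc k mod q1 \<noteq> 0"
  shows "err_x (Suc k) 0 = err_x k J" "err_y (Suc k) 0 = err_y k T" "err_v (Suc k) 0 = err_v k J"
  using carry_over[OF assms] by (auto simp: err_x_def err_y_def err_v_def loop_0 zy_T zv_J)

lemma regular: "k \<le> K \<Longrightarrow> regular k"
proof (induction k)
  case 0
  show ?case by (rule regular_0)
next
  case (Suc k)
  then have k: "k < K" and reg_k: "regular k" by auto
  \<comment> \<open>The ranks of one iteration fill exactly N values, so the end of the v-loop is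
    the start of the next iteration.\<close>
  have e: "k * N + 1 + T + J = Suc k * N" by simp
  note y = y_loop_regular[OF k reg_k order_refl] and v = v_loop_regular[OF k reg_k order_refl, unfolded e]
  have le: "k * N + 1 \<le> Suc k * N" "k * N + 1 + T \<le> Suc k * N" by auto
  have "adapted (Suc k * N) (X (Suc k))" by (rule adapted_mono[OF X_Suc_regular(2)[OF k reg_k] le(1)])
  moreover have "adapted (Suc k * N) (Y (Suc k))" "adapted (Suc k * N) (dyl k T)"
    using y adapted_mono[OF _ le(2)] unfolding Y_Suc[abs_def] by blast+
  moreover have "adapted (Suc k * N) (V (Suc k))" using v unfolding V_Suc[abs_def] by simp
  moreover have "DX (Suc k) = dxl k J" "DY (Suc k) = dyl k T" "DV (Suc k) = dvl k J" if "Suc k mod q1 \<noteq> 0"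
    using carry_over[OF that] by auto
  ultimately show ?case
    unfolding regular_def using y v X_Suc_regular(3)[OF k reg_k] errors_carry_over[of k] by (simp add: Y_Suc[abs_def])
qed

subsection \<open>Accumulated errors and convergence\<close>

definition Nx where "Nx k = (\<integral>\<omega>. (norm (DX k \<omega>))\<^sup>2 \<partial>P)"
definition Ny where "Ny k = (\<integral>\<omega>. (\<Sum>t<T. (norm (dyl k t \<omega>))\<^sup>2) \<partial>P)"
definition Nv where "Nv k = (\<integral>\<omega>. (\<Sum>j<J. (norm (dvl k j \<omega>))\<^sup>2) \<partial>P)"
text \<open>\<open>Qy k\<close> and \<open>Qv k\<close> bound the mean squared increments of sampled
  directions, summed over the inner steps of iteration k. Divided by the batch size they bound the
  growth of the errors; \<open>Qv\<close> serves both the x- and the v-direction.\<close>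

definition Qy where "Qy k = Lg\<^sup>2 * (\<alpha>\<^sup>2 * Nx k + a\<^sup>2 * Ny k)"
definition Qv where "Qv k = M1 * (\<alpha>\<^sup>2 * Nx k + a\<^sup>2 * (real T * Ny k)) + 2 * Lg\<^sup>2 * (b\<^sup>2 * Nv k)"
definition Ex where "Ex k j = (\<integral>\<omega>. (norm (err_x k j \<omega>))\<^sup>2 \<partial>P)"
definition Ey where "Ey k t = (\<integral>\<omega>. (norm (err_y k t \<omega>))\<^sup>2 \<partial>P)"
definition Ev where "Ev k j = (\<integral>\<omega>. (norm (err_v k j \<omega>))\<^sup>2 \<partial>P)"

lemma N_nonneg: "Nx k \<ge> 0" "Ny k \<ge> 0" "Nv k \<ge> 0"
  by (simp_all add: Nx_def Ny_def Nv_def sum_nonneg)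

lemma Q_nonneg: "Qy k \<ge> 0" "Qv k \<ge> 0"
  using N_nonneg M1_nonneg by (auto simp: Qy_def Qv_def intro!: mult_nonneg_nonneg add_nonneg_nonneg)

lemma run_integrable:
  assumes k: "k < K"
  shows "integrable P (\<lambda>\<omega>. (norm (DX k \<omega>))\<^sup>2)"
    and "t < T \<Longrightarrow> integrable P (\<lambda>\<omega>. (norm (dyl k t \<omega>))\<^sup>2)"
    and "j < J \<Longrightarrow> integrable P (\<lambda>\<omega>. (norm (dvl k j \<omega>))\<^sup>2)"
    and "integrable P (\<lambda>\<omega>. (norm (err_x k 0 \<omega>))\<^sup>2)"
    and "t < T \<Longrightarrow> integrable P (\<lambda>\<omega>. (norm (err_y k t \<omega>))\<^sup>2)"
    and "j < J \<Longrightarrow> integrable P (\<lambda>\<omega>. (norm (err_v k j \<omega>))\<^sup>2)"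
  using X_Suc_regular(1)[OF k regular] y_loop_regular[OF k regular, of t] v_loop_regular[OF k regular, of j] refreshed(4)[OF k regular] k
  by (auto simp: sq_integrable_def)

lemma total_moves:
  assumes k: "k < K"
  shows "(\<Sum>i<T. Lg\<^sup>2 * (\<integral>\<omega>. (norm (zy k (Suc i) \<omega> - zy k i \<omega>))\<^sup>2 \<partial>P)) = Qy k"
    and "(\<Sum>i<J. \<integral>\<omega>. Bv k i \<omega> \<partial>P) = Qv k"
proof -
  note int = run_integrable[OF k]
  have Ny: "Ny k = (\<Sum>t<T. \<integral>\<omega>. (norm (dyl k t \<omega>))\<^sup>2 \<partial>P)" and Nv: "Nv k = (\<Sum>j<J. \<integral>\<omega>. (norm (dvl k j \<omega>))\<^sup>2 \<partial>P)"
    unfolding Ny_def Nv_def using int by (auto intro!: Bochner_Integration.integral_sum)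
  have y: "(\<integral>\<omega>. (norm (zy k (Suc i) \<omega> - zy k i \<omega>))\<^sup>2 \<partial>P)
      = (if i = 0 then \<alpha>\<^sup>2 * Nx k else 0) + a\<^sup>2 * (\<integral>\<omega>. (norm (dyl k i \<omega>))\<^sup>2 \<partial>P)" if "i < T" for i
    unfolding move_y Nx_def using int(1) int(2)[OF that] by (cases "i = 0") simp_all
  show "(\<Sum>i<T. Lg\<^sup>2 * (\<integral>\<omega>. (norm (zy k (Suc i) \<omega> - zy k i \<omega>))\<^sup>2 \<partial>P)) = Qy k"
    using T by (simp add: y sum.distrib Qy_def Ny flip: sum_distrib_left)
  have v: "(\<integral>\<omega>. Bv k i \<omega> \<partial>P) = (if i = 0 then M1 * (\<alpha>\<^sup>2 * Nx k + a\<^sup>2 * (real T * Ny k)) else 0)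
      + 2 * Lg\<^sup>2 * (b\<^sup>2 * (\<integral>\<omega>. (norm (dvl k i \<omega>))\<^sup>2 \<partial>P))" if "i < J" for i
  proof -
    define s where "s \<omega> = (\<Sum>t<T. (norm (dyl k t \<omega>))\<^sup>2)" for \<omega>
    have "integrable P s" unfolding s_def[abs_def] using int(2) by (auto intro!: Bochner_Integration.integrable_sum)
    then show ?thesis
      unfolding Bv_def Nx_def Ny_def s_def[symmetric] using int(1) int(3)[OF that] by (cases "i = 0") simp_all
  qed
  show "(\<Sum>i<J. \<integral>\<omega>. Bv k i \<omega> \<partial>P) = Qv k"
    using J by (simp add: v sum.distrib Qv_def Nv flip: sum_distrib_left)
qed

lemma error_growth:
  assumes k: "k < K"
  shows "t \<le> T \<Longrightarrow> Ey k t \<le> Ey k 0 + Qy k / real q1"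
    and "j \<le> J \<Longrightarrow> Ex k j \<le> Ex k 0 + Qv k / real q1"
    and "j \<le> J \<Longrightarrow> Ev k j \<le> Ev k 0 + Qv k / real q1"
proof -
  have regular: "regular k" using k by (intro regular) simp
  have "(\<Sum>i<t. Lg\<^sup>2 * (\<integral>\<omega>. (norm (zy k (Suc i) \<omega> - zy k i \<omega>))\<^sup>2 \<partial>P)) / real q1 \<le> Qy k / real q1" if "t \<le> T"
    unfolding total_moves(1)[OF k, symmetric] using that by (intro divide_right_mono sum_mono2) auto
  then show "t \<le> T \<Longrightarrow> Ey k t \<le> Ey k 0 + Qy k / real q1"
    using y_loop_regular[OF k regular, of t] unfolding Ey_def by linarith
  have nn: "(\<integral>\<omega>. Bv k i \<omega> \<partial>P) \<ge> 0" for i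
    using M1_nonneg by (intro Bochner_Integration.integral_nonneg) (auto simp: Bv_def intro!: add_nonneg_nonneg mult_nonneg_nonneg sum_nonneg)
  have "(\<Sum>i<j. \<integral>\<omega>. Bv k i \<omega> \<partial>P) / real q1 \<le> Qv k / real q1" if "j \<le> J"
    unfolding total_moves(2)[OF k, symmetric] using that nn by (intro divide_right_mono sum_mono2) auto
  then show "j \<le> J \<Longrightarrow> Ex k j \<le> Ex k 0 + Qv k / real q1" "j \<le> J \<Longrightarrow> Ev k j \<le> Ev k 0 + Qv k / real q1"
    using v_loop_regular[OF k regular, of j] unfolding Ex_def Ev_def by linarith+
qed

text \<open>An increase Q / q1 of an error persists for at most q1 iterations, so the total charges
  each Q at most once. This is where equality of batch size and period removes q1. The factors T and
  J arise because every inner step is bounded by the error at the end of its loop.\<close>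

lemma total_errors:
  shows "(\<Sum>k<K. Ex k 0) \<le> real K * (dir_var / real S1) + (\<Sum>k<K. Qv k)"
    and "(\<Sum>k<K. \<Sum>t<T. Ey k t) \<le> real T * (real K * (\<sigma>g\<^sup>2 / real S1) + (\<Sum>k<K. Qy k))"
    and "(\<Sum>k<K. \<Sum>j<J. Ev k j) \<le> real J * (real K * (dir_var / real S1) + (\<Sum>k<K. Qv k))"
proof -
  have q: "Qv k / real q1 \<ge> 0" for k using Q_nonneg by simp
  have r: "Ex k 0 \<le> dir_var / real S1" "Ey k 0 \<le> \<sigma>g\<^sup>2 / real S1" "Ev k 0 \<le> dir_var / real S1" if "k < K" "k mod q1 = 0" for k
    using refreshed(7-9)[OF that(1) regular that(2)] that(1) by (simp_all add: Ex_def Ey_def Ev_def)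
  have s: "Ex (Suc k) 0 \<le> Ex k 0 + Qv k / real q1" "Ey (Suc k) 0 \<le> Ey k 0 + Qy k / real q1"
    "Ev (Suc k) 0 \<le> Ev k 0 + Qv k / real q1" if "Suc k < K" "Suc k mod q1 \<noteq> 0" for k
    using error_growth[of k J] error_growth[of k T] errors_carry_over[OF that(2)] that(1)
    by (simp_all add: Ex_def Ey_def Ev_def)
  have x: "(\<Sum>k<K. Ex k 0 + Qv k / real q1) \<le> real K * (dir_var / real S1) + (\<Sum>k<K. Qv k)"
    by (rule refresh_period_sum[where \<epsilon> = "\<lambda>k. Ex k 0" and Q = Qv, OF q1 Q_nonneg(2) r(1) s(1)])
  have y: "(\<Sum>k<K. Ey k 0 + Qy k / real q1) \<le> real K * (\<sigma>g\<^sup>2 / real S1) + (\<Sum>k<K. Qy k)"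
    by (rule refresh_period_sum[where \<epsilon> = "\<lambda>k. Ey k 0" and Q = Qy, OF q1 Q_nonneg(1) r(2) s(2)])
  have v: "(\<Sum>k<K. Ev k 0 + Qv k / real q1) \<le> real K * (dir_var / real S1) + (\<Sum>k<K. Qv k)"
    by (rule refresh_period_sum[where \<epsilon> = "\<lambda>k. Ev k 0" and Q = Qv, OF q1 Q_nonneg(2) r(3) s(3)])
  have "(\<Sum>k<K. Ex k 0) \<le> (\<Sum>k<K. Ex k 0 + Qv k / real q1)" using q by (intro sum_mono) simp
  then show "(\<Sum>k<K. Ex k 0) \<le> real K * (dir_var / real S1) + (\<Sum>k<K. Qv k)" using x by linarith
  have "(\<Sum>k<K. \<Sum>t<T. Ey k t) \<le> (\<Sum>k<K. \<Sum>t<T. Ey k 0 + Qy k / real q1)"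
    using error_growth(1) by (intro sum_mono) auto
  also have "\<dots> = real T * (\<Sum>k<K. Ey k 0 + Qy k / real q1)" by (simp add: sum_distrib_left)
  also have "\<dots> \<le> real T * (real K * (\<sigma>g\<^sup>2 / real S1) + (\<Sum>k<K. Qy k))" using y by (intro mult_left_mono) auto
  finally show "(\<Sum>k<K. \<Sum>t<T. Ey k t) \<le> real T * (real K * (\<sigma>g\<^sup>2 / real S1) + (\<Sum>k<K. Qy k))" .
  have "(\<Sum>k<K. \<Sum>j<J. Ev k j) \<le> (\<Sum>k<K. \<Sum>j<J. Ev k 0 + Qv k / real q1)"
    using error_growth(3) by (intro sum_mono) auto
  also have "\<dots> = real J * (\<Sum>k<K. Ev k 0 + Qv k / real q1)" by (simp add: sum_distrib_left)
  also have "\<dots> \<le> real J * (real K * (dir_var / real S1) + (\<Sum>k<K. Qv k))" using v by (intro mult_left_mono) auto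
  finally show "(\<Sum>k<K. \<Sum>j<J. Ev k j) \<le> real J * (real K * (dir_var / real S1) + (\<Sum>k<K. Qv k))" .
qed

lemma grad_Phi_integrable:
  assumes "k \<le> K"
  shows "integrable P (\<lambda>\<omega>. (norm (grad \<Phi> (X k \<omega>)))\<^sup>2)"
proof -
  have "continuous_on UNIV (grad \<Phi>)" by (rule lipschitz_on_continuous_on[OF grad_Phi_lipschitz])
  then have "grad \<Phi> \<in> borel_measurable borel" by (rule borel_measurable_continuous_onI)
  moreover have "random_variable borel (X k)" using regular[OF assms] by (simp add: regular_def sq_integrable_def)
  ultimately have "(\<lambda>\<omega>. grad \<Phi> (X k \<omega>)) \<in> borel_measurable P" by (rule measurable_compose[rotated])
  from sq_integrable_bounded[OF this norm_grad_Phi] show ?thesis by (simp add: sq_integrable_def)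
qed

lemma lyapunov_integrable:
  assumes "k \<le> K"
  shows "integrable P (\<lambda>\<omega>. lyapunov (X k \<omega>) (Y k \<omega>) (V k \<omega>))"
proof -
  have X: "sq_integrable P (X k)" and Y: "sq_integrable P (Y k)" and V: "random_variable borel (V k)"
    using regular[OF assms] adapted_random by (auto simp: regular_def)
  have ly: "(Lg / \<mu>)-lipschitz_on UNIV ystar"
    using ystar_lipschitz Lg_nonneg mu_pos by (intro lipschitz_onI) (auto simp: dist_norm)
  have Lv: "(Lf / \<mu> + Cf * Lgg / \<mu>\<^sup>2) * (1 + Lg / \<mu>) \<ge> 0"
    using Lf_nonneg Lg_nonneg Cf_nonneg Lgg_nonneg mu_pos
    by (intro add_nonneg_nonneg divide_nonneg_nonneg mult_nonneg_nonneg) auto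
  have lv: "((Lf / \<mu> + Cf * Lgg / \<mu>\<^sup>2) * (1 + Lg / \<mu>))-lipschitz_on UNIV vstar"
    by (rule lipschitz_onI[OF _ Lv]) (unfold dist_norm, rule vstar_lipschitz)
  have lP: "(Cf * (1 + Lg / \<mu>))-lipschitz_on UNIV \<Phi>"
    using Cf_nonneg Lg_nonneg mu_pos by (intro lipschitz_onI) (auto simp: dist_norm intro: Phi_lipschitz)
  have "sq_integrable P (\<lambda>\<omega>. \<Phi> (X k \<omega>))" by (rule sq_integrable_lipschitz[OF X lP])
  \<comment> \<open>Pairing with the constant 1 turns square integrability into
    integrability.\<close>
  then have "integrable P (\<lambda>\<omega>. inner (\<Phi> (X k \<omega>)) 1)"
    by (rule sq_integrable_inner) (rule sq_integrable_const)
  moreover have "sq_integrable P (\<lambda>\<omega>. Y k \<omega> - ystar (X k \<omega>))"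
    by (intro sq_integrable_diff Y sq_integrable_lipschitz[OF X ly])
  moreover have "sq_integrable P (\<lambda>\<omega>. V k \<omega> - vstar (X k \<omega>))"
    by (intro sq_integrable_diff sq_integrable_bounded[OF V V_bound] sq_integrable_lipschitz[OF X lv])
  ultimately show ?thesis by (simp add: lyapunov_def sq_integrable_def)
qed

text \<open>The coefficient of K / S1 after summation: each refresh variance times the weight of
  that error in the Lyapunov decrease, and times T or J for the number of inner steps it
  affects.\<close>

definition noise_const where
  "noise_const = \<alpha> * dir_var + 7 * a * real T / \<mu> * \<sigma>g\<^sup>2 + 12 * b * real J / \<mu> * dir_var"

text \<open>Summing the decrease telescopes the Lyapunov function. Besides refresh noise, the
  accumulated errors are multiples of the three summed squared directions; \<open>cx\<close>,
  \<open>cy\<close> and \<open>cv\<close> state that each multiple is covered by the negative one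
  from the decrease.\<close>

theorem gradient_norm_bound:
  defines "Cv \<equiv> (Lf / \<mu> + Cf * Lgg / \<mu>\<^sup>2) * (1 + Lg / \<mu>)"
  assumes lower: "\<And>x. B \<le> \<Phi> x" and K: "K > 0"
    and aL: "a * (2 * (Lg + \<mu>)) \<le> 1" and bL: "b * (2 * (Lg + \<mu>)) \<le> 1" and \<alpha>L: "\<alpha> * L\<Phi> \<le> 1 / 6"
    and bJ: "128 * (b * M1 * real J) \<le> a * \<mu>\<^sup>2"
    and \<alpha>s: "\<alpha> * (8 * M1) \<le> a * \<mu>" "\<alpha> * (48 * Lg\<^sup>2) \<le> b * \<mu>"
      "\<alpha> * (96 * (Lg / \<mu>)\<^sup>2) \<le> a * \<mu>" "\<alpha> * (48 * Cv\<^sup>2) \<le> b * \<mu>"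
    and cx: "(\<alpha> + 12 * b * real J / \<mu>) * (M1 * \<alpha>\<^sup>2) + 7 * a * real T / \<mu> * (Lg\<^sup>2 * \<alpha>\<^sup>2) \<le> \<alpha> / 4"
    and cy: "(\<alpha> + 12 * b * real J / \<mu>) * (M1 * (a\<^sup>2 * real T)) + 7 * a * real T / \<mu> * (Lg\<^sup>2 * a\<^sup>2) \<le> a / (4 * Lg)"
    and cv: "(\<alpha> + 12 * b * real J / \<mu>) * (2 * Lg\<^sup>2 * b\<^sup>2) \<le> b / (4 * Lg)"
  shows "(1 / real K) * (\<Sum>k<K. \<integral>\<omega>. (norm (grad \<Phi> (X k \<omega>)))\<^sup>2 \<partial>P)
    \<le> 2 / \<alpha> * ((lyapunov x0 y0 v0 - B) * (1 / real K) + noise_const * (1 / real S1))"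
proof -
  define E where "E k = (\<integral>\<omega>. lyapunov (X k \<omega>) (Y k \<omega>) (V k \<omega>) \<partial>P)" for k
  define Gk where "Gk k = (\<integral>\<omega>. (norm (grad \<Phi> (X k \<omega>)))\<^sup>2 \<partial>P)" for k
  define Sy where "Sy k = (\<Sum>t<T. Ey k t)" for k
  define Sv where "Sv k = (\<Sum>j<J. Ev k j)" for k
  have step: "\<alpha> / 2 * Gk k \<le> (E k - E (Suc k)) - \<alpha> / 4 * Nx k - a / (4 * Lg) * Ny k - b / (4 * Lg) * Nv k
      + \<alpha> * Ex k 0 + 7 * a / \<mu> * Sy k + 12 * b / \<mu> * Sv k" if k: "k < K" for k
  proof -
    note int = run_integrable[OF k] grad_Phi_integrable[of k] lyapunov_integrable[of k] lyapunov_integrable[of "Suc k"]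
    define R where "R \<omega> = lyapunov (X k \<omega>) (Y k \<omega>) (V k \<omega>) - \<alpha> / 2 * (norm (grad \<Phi> (X k \<omega>)))\<^sup>2
      - \<alpha> / 4 * (norm (DX k \<omega>))\<^sup>2 - a / (4 * Lg) * (\<Sum>t<T. (norm (dyl k t \<omega>))\<^sup>2)
      - b / (4 * Lg) * (\<Sum>j<J. (norm (dvl k j \<omega>))\<^sup>2) + \<alpha> * (norm (err_x k 0 \<omega>))\<^sup>2
      + 7 * a / \<mu> * (\<Sum>t<T. (norm (err_y k t \<omega>))\<^sup>2) + 12 * b / \<mu> * (\<Sum>j<J. (norm (err_v k j \<omega>))\<^sup>2)" for \<omega>
    have sums: "integrable P (\<lambda>\<omega>. \<Sum>t<T. (norm (dyl k t \<omega>))\<^sup>2)" "integrable P (\<lambda>\<omega>. \<Sum>j<J. (norm (dvl k j \<omega>))\<^sup>2)"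
      "integrable P (\<lambda>\<omega>. \<Sum>t<T. (norm (err_y k t \<omega>))\<^sup>2)" "integrable P (\<lambda>\<omega>. \<Sum>j<J. (norm (err_v k j \<omega>))\<^sup>2)"
      using int by (auto intro!: Bochner_Integration.integrable_sum)
    have le: "lyapunov (X (Suc k) \<omega>) (Y (Suc k) \<omega>) (V (Suc k) \<omega>) \<le> R \<omega>" for \<omega>
    proof -
      have vp: "norm (vl k (Suc j) \<omega> - w) \<le> norm (vl k j \<omega> - b *\<^sub>R dvl k j \<omega> - w)" if "norm w \<le> M" for j w
        unfolding vl_Suc by (rule proj_nonexpansive[OF that])
      show ?thesis
        using lyapunov_decrease[where y = "\<lambda>t. yl k t \<omega>" and Dy = "\<lambda>t. dyl k t \<omega>" and v = "\<lambda>j. vl k j \<omega>"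
          and Dv = "\<lambda>j. dvl k j \<omega>" and x = "X k \<omega>" and Dx = "DX k \<omega>",
          OF M T J a aL b bL \<alpha> \<alpha>L bJ[unfolded M1_def] \<alpha>s(1)[unfolded M1_def] \<alpha>s(2,3) \<alpha>s(4)[unfolded Cv_def] yl_Suc vp]
        unfolding R_def err_y_def err_v_def err_x_def Hv_def Hx_def zy_def zv_def Y_Suc V_Suc X_Suc
        by (simp add: loop_0 cong: if_cong)
    qed
    have "E (Suc k) \<le> (\<integral>\<omega>. R \<omega> \<partial>P)"
      unfolding E_def using int sums k by (intro integral_mono le) (auto simp: R_def[abs_def])
    also have "\<dots> = E k - \<alpha> / 2 * Gk k - \<alpha> / 4 * Nx k - a / (4 * Lg) * Ny k - b / (4 * Lg) * Nv k
      + \<alpha> * Ex k 0 + 7 * a / \<mu> * (\<integral>\<omega>. (\<Sum>t<T. (norm (err_y k t \<omega>))\<^sup>2) \<partial>P)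
      + 12 * b / \<mu> * (\<integral>\<omega>. (\<Sum>j<J. (norm (err_v k j \<omega>))\<^sup>2) \<partial>P)"
      unfolding R_def E_def Gk_def Nx_def Ny_def Nv_def Ex_def using int sums k by simp
    also have "(\<integral>\<omega>. (\<Sum>t<T. (norm (err_y k t \<omega>))\<^sup>2) \<partial>P) = Sy k"
      unfolding Sy_def Ey_def using int by (intro Bochner_Integration.integral_sum) auto
    also have "(\<integral>\<omega>. (\<Sum>j<J. (norm (err_v k j \<omega>))\<^sup>2) \<partial>P) = Sv k"
      unfolding Sv_def Ev_def using int by (intro Bochner_Integration.integral_sum) auto
    finally show ?thesis by linarith
  qed
  have E0: "E 0 = lyapunov x0 y0 v0" by (simp add: E_def X_0 Y_0 V_0 prob_space)
  have EK: "B \<le> E K"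
  proof -
    have "B \<le> lyapunov (X K \<omega>) (Y K \<omega>) (V K \<omega>)" for \<omega>
      unfolding lyapunov_def using lower[of "X K \<omega>"] by (simp add: add_increasing2)
    then have "(\<integral>\<omega>. B \<partial>P) \<le> E K"
      unfolding E_def using lyapunov_integrable[of K] by (intro integral_mono) auto
    then show ?thesis by (simp add: prob_space)
  qed
  define SNx where "SNx = (\<Sum>k<K. Nx k)"
  define SNy where "SNy = (\<Sum>k<K. Ny k)"
  define SNv where "SNv = (\<Sum>k<K. Nv k)"
  define n where "n = real K / real S1"
  have SN: "SNx \<ge> 0" "SNy \<ge> 0" "SNv \<ge> 0" using N_nonneg by (auto simp: SNx_def SNy_def SNv_def intro: sum_nonneg)
  have SQy: "(\<Sum>k<K. Qy k) = Lg\<^sup>2 * (\<alpha>\<^sup>2 * SNx + a\<^sup>2 * SNy)"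
    unfolding Qy_def SNx_def SNy_def by (simp add: sum.distrib flip: sum_distrib_left)
  have SQv: "(\<Sum>k<K. Qv k) = M1 * (\<alpha>\<^sup>2 * SNx + a\<^sup>2 * (real T * SNy)) + 2 * Lg\<^sup>2 * (b\<^sup>2 * SNv)"
    unfolding Qv_def SNx_def SNy_def SNv_def by (simp add: sum.distrib flip: sum_distrib_left)
  have "(\<Sum>k<K. E k - E (Suc k)) = E 0 - E K" by (rule sum_lessThan_telescope')
  moreover have "(\<Sum>k<K. \<alpha> / 2 * Gk k) \<le> (\<Sum>k<K. (E k - E (Suc k)) - \<alpha> / 4 * Nx k - a / (4 * Lg) * Ny k
      - b / (4 * Lg) * Nv k + \<alpha> * Ex k 0 + 7 * a / \<mu> * Sy k + 12 * b / \<mu> * Sv k)"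
    by (intro sum_mono step) simp
  ultimately have "\<alpha> / 2 * (\<Sum>k<K. Gk k) \<le> (E 0 - E K) - \<alpha> / 4 * SNx - a / (4 * Lg) * SNy - b / (4 * Lg) * SNv
      + \<alpha> * (\<Sum>k<K. Ex k 0) + 7 * a / \<mu> * (\<Sum>k<K. Sy k) + 12 * b / \<mu> * (\<Sum>k<K. Sv k)"
    unfolding SNx_def SNy_def SNv_def sum_distrib_left by (simp add: sum.distrib sum_subtractf)
  also have "\<dots> \<le> (E 0 - E K) - \<alpha> / 4 * SNx - a / (4 * Lg) * SNy - b / (4 * Lg) * SNv
      + \<alpha> * (real K * (dir_var / real S1) + (\<Sum>k<K. Qv k))
      + 7 * a / \<mu> * (real T * (real K * (\<sigma>g\<^sup>2 / real S1) + (\<Sum>k<K. Qy k)))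
      + 12 * b / \<mu> * (real J * (real K * (dir_var / real S1) + (\<Sum>k<K. Qv k)))"
    using \<alpha> a b mu_pos unfolding Sy_def Sv_def by (intro add_mono mult_left_mono total_errors order_refl) auto
  \<comment> \<open>All terms proportional to K / S1 are collected in \<open>noise_const\<close>.
    The x- and v-errors share the drift \<open>Qv\<close>, which explains its combined
    weight.\<close>
  also have "\<dots> = (E 0 - E K) + noise_const * n - \<alpha> / 4 * SNx - a / (4 * Lg) * SNy - b / (4 * Lg) * SNv
      + ((\<alpha> + 12 * b * real J / \<mu>) * (\<Sum>k<K. Qv k) + 7 * a * real T / \<mu> * (\<Sum>k<K. Qy k))"
  proof -
    have "D - x - y - z + \<alpha> * (s * n + Q) + p * (t * (r * n + Q')) + q * (j * (s * n + Q))
        = D + (\<alpha> * s + p * t * r + q * j * s) * n - x - y - z + ((\<alpha> + q * j) * Q + p * t * Q')"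
      for D x y z s Q p t r Q' q j :: real by (simp add: algebra_simps)
    from this[of _ _ _ _ dir_var _ "7 * a / \<mu>" "real T" "\<sigma>g\<^sup>2" _ "12 * b / \<mu>" "real J"]
    show ?thesis by (simp add: noise_const_def n_def mult.commute[of "real K"])
  qed
  also have "(\<alpha> + 12 * b * real J / \<mu>) * (\<Sum>k<K. Qv k) + 7 * a * real T / \<mu> * (\<Sum>k<K. Qy k)
      = ((\<alpha> + 12 * b * real J / \<mu>) * (M1 * \<alpha>\<^sup>2) + 7 * a * real T / \<mu> * (Lg\<^sup>2 * \<alpha>\<^sup>2)) * SNx
      + ((\<alpha> + 12 * b * real J / \<mu>) * (M1 * (a\<^sup>2 * real T)) + 7 * a * real T / \<mu> * (Lg\<^sup>2 * a\<^sup>2)) * SNy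
      + (\<alpha> + 12 * b * real J / \<mu>) * (2 * Lg\<^sup>2 * b\<^sup>2) * SNv"
  proof -
    have "c * (m * (u * x + v * (t * y)) + 2 * l * (w * z)) + d * (l * (u * x + v * y))
        = (c * (m * u) + d * (l * u)) * x + (c * (m * (v * t)) + d * (l * v)) * y + c * (2 * l * w) * z"
      for c m u x v t y l w z d :: real by (simp add: algebra_simps)
    then show ?thesis unfolding SQy SQv .
  qed
  also have "(E 0 - E K) + noise_const * n - \<alpha> / 4 * SNx - a / (4 * Lg) * SNy - b / (4 * Lg) * SNv + \<dots>
      \<le> (E 0 - E K) + noise_const * n"
    using cx[THEN mult_right_mono, OF SN(1)] cy[THEN mult_right_mono, OF SN(2)] cv[THEN mult_right_mono, OF SN(3)]
    by linarith
  also have "\<dots> \<le> (lyapunov x0 y0 v0 - B) + noise_const * n" using E0 EK by simp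
  finally have "2 / \<alpha> * (1 / real K) * (\<alpha> / 2 * (\<Sum>k<K. Gk k))
      \<le> 2 / \<alpha> * (1 / real K) * ((lyapunov x0 y0 v0 - B) + noise_const * n)"
    using \<alpha> by (intro mult_left_mono) auto
  moreover have "2 / \<alpha> * (1 / real K) * (\<alpha> / 2 * (\<Sum>k<K. Gk k)) = (1 / real K) * (\<Sum>k<K. Gk k)"
    using \<alpha> by simp
  moreover have "2 / \<alpha> * (1 / real K) * ((lyapunov x0 y0 v0 - B) + noise_const * n)
      = 2 / \<alpha> * ((lyapunov x0 y0 v0 - B) * (1 / real K) + noise_const * (1 / real S1))"
    using K by (simp add: n_def distrib_left add_divide_distrib)
  ultimately have "(1 / real K) * (\<Sum>k<K. Gk k)
      \<le> 2 / \<alpha> * ((lyapunov x0 y0 v0 - B) * (1 / real K) + noise_const * (1 / real S1))"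
    by (simp only:)
  then show ?thesis by (simp only: Gk_def)
qed

end

section \<open>Consequences of the step sizes for r = 1, and the final bound\<close>

lemma step_size_conditions:
  fixes T J :: nat and \<mu> Lg M1 \<beta> \<eta> lam1 lam2 \<alpha> C3 :: real
  defines "a \<equiv> lam1 * \<beta>" and "b \<equiv> lam2 * \<eta>"
  assumes \<mu>: "0 < \<mu>" "\<mu> \<le> Lg" and M1: "M1 \<ge> 0" and T: "T > 0" and J: "J > 0"
    and C3: "2 * real T \<le> C3"
    and pos: "0 < \<beta>" "\<beta> < 1" "0 < \<eta>" "\<eta> < 1" "0 < lam1" "0 < lam2" "0 < \<alpha>"
    and lam1: "lam1 * (2 * Lg + 2 * \<mu>) \<le> 1" "lam1 * (real T * Lg\<^sup>2 * \<beta>\<^sup>2 * C3) \<le> (1/2) ^ (2 * T + 5) * \<mu>"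
    and lam2: "lam2 * (2 * Lg + 2 * \<mu>) \<le> 1"
      "lam2 * (real J * (Lg\<^sup>2 * \<eta>\<^sup>2 + real T * M1 * \<beta> * \<eta>)) \<le> (1/2) ^ (2 * (T + J) + 6) * \<mu>"
    and \<alpha>: "\<alpha> * (12 * sqrt M1) \<le> 1" "\<alpha> * (192 * lam1 * \<beta> * Lg\<^sup>2 * (1 + C3)) \<le> \<mu>"
      "\<alpha> * (192 * lam2 * \<eta> * M1 * (1 + (Lg / \<mu>)\<^sup>2 + real J)) \<le> \<mu>"
      "\<alpha> * (M1 * real T * \<beta> + Lg\<^sup>2 * \<eta>) \<le> (1/2) ^ (2 * (T + J) + 3)"
  shows "a * (2 * (Lg + \<mu>)) \<le> 1" and "b * (2 * (Lg + \<mu>)) \<le> 1"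
    and "(\<alpha> + 12 * b * real J / \<mu>) * (M1 * \<alpha>\<^sup>2) + 7 * a * real T / \<mu> * (Lg\<^sup>2 * \<alpha>\<^sup>2) \<le> \<alpha> / 4"
    and "(\<alpha> + 12 * b * real J / \<mu>) * (M1 * (a\<^sup>2 * real T)) + 7 * a * real T / \<mu> * (Lg\<^sup>2 * a\<^sup>2) \<le> a / (4 * Lg)"
    and "(\<alpha> + 12 * b * real J / \<mu>) * (2 * Lg\<^sup>2 * b\<^sup>2) \<le> b / (4 * Lg)"
proof -
  have Lg: "Lg > 0" using \<mu> by simp
  have a: "a > 0" "a \<le> lam1" and b: "b > 0" "b \<le> lam2" using pos by (auto simp: a_def b_def)
  have "a * (2 * Lg + 2 * \<mu>) \<le> lam1 * (2 * Lg + 2 * \<mu>)" "b * (2 * Lg + 2 * \<mu>) \<le> lam2 * (2 * Lg + 2 * \<mu>)"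
    using a b \<mu> Lg by (auto intro: mult_right_mono)
  then show "a * (2 * (Lg + \<mu>)) \<le> 1" "b * (2 * (Lg + \<mu>)) \<le> 1" using lam1(1) lam2(1) by simp_all
  have l: "0 \<le> lam1 * Lg" "lam1 * Lg \<le> 1 / 2" "0 \<le> lam2 * Lg" "lam2 * Lg \<le> 1 / 2"
    using lam1(1) lam2(1) pos Lg mult_pos_pos[OF pos(5) \<mu>(1)] mult_pos_pos[OF pos(6) \<mu>(1)]
    by (auto simp: distrib_left)
  \<comment> \<open>T and J are at least 1, so the exponents are at least 7, 10 and 7; only these
    fixed powers of 1/2 are kept.\<close>
  have p1: "(1/2 :: real) ^ (2 * T + 5) \<le> 1 / 128" "(1/2 :: real) ^ (2 * (T + J) + 6) \<le> 1 / 1024"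
    "(1/2 :: real) ^ (2 * (T + J) + 3) \<le> 1 / 128"
    using power_decreasing[of 7 "2 * T + 5" "1/2::real"] power_decreasing[of 10 "2 * (T + J) + 6" "1/2::real"]
      power_decreasing[of 7 "2 * (T + J) + 3" "1/2::real"] T J by (auto simp: power_divide)
  have T1: "real T \<ge> 1" using T by auto
  have g1: "\<alpha> * (M1 * real T * \<beta>) \<le> 1 / 128" "\<alpha> * (Lg\<^sup>2 * \<eta>) \<le> 1 / 128"
  proof -
    have "\<alpha> * (M1 * real T * \<beta>) \<ge> 0" "\<alpha> * (Lg\<^sup>2 * \<eta>) \<ge> 0" using pos M1 by auto
    moreover have "\<alpha> * (M1 * real T * \<beta>) + \<alpha> * (Lg\<^sup>2 * \<eta>) \<le> 1 / 128"
      using \<alpha>(4) p1(3) by (simp add: distrib_left)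
    ultimately show "\<alpha> * (M1 * real T * \<beta>) \<le> 1 / 128" "\<alpha> * (Lg\<^sup>2 * \<eta>) \<le> 1 / 128" by linarith+
  qed
  have g2: "lam2 * (real J * (Lg\<^sup>2 * \<eta>\<^sup>2)) / \<mu> \<le> 1 / 1024" "lam2 * (real J * (real T * M1 * \<beta> * \<eta>)) / \<mu> \<le> 1 / 1024"
  proof -
    have "lam2 * (real J * (Lg\<^sup>2 * \<eta>\<^sup>2)) \<ge> 0" "lam2 * (real J * (real T * M1 * \<beta> * \<eta>)) \<ge> 0" using pos M1 by auto
    moreover have "lam2 * (real J * (Lg\<^sup>2 * \<eta>\<^sup>2)) + lam2 * (real J * (real T * M1 * \<beta> * \<eta>)) \<le> 1 / 1024 * \<mu>"
      unfolding distrib_left[symmetric] by (rule order_trans[OF lam2(2) mult_right_mono[OF p1(2)]]) (use \<mu> in simp)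
    ultimately show "lam2 * (real J * (Lg\<^sup>2 * \<eta>\<^sup>2)) / \<mu> \<le> 1 / 1024" "lam2 * (real J * (real T * M1 * \<beta> * \<eta>)) / \<mu> \<le> 1 / 1024"
      using \<mu> by (simp_all add: divide_le_eq)
  qed
  have g3: "lam1 * (real T * Lg\<^sup>2 * \<beta>\<^sup>2) / \<mu> \<le> 1 / 128"
  proof -
    have "lam1 * (real T * Lg\<^sup>2 * \<beta>\<^sup>2) * 1 \<le> lam1 * (real T * Lg\<^sup>2 * \<beta>\<^sup>2) * C3"
      using pos C3 T1 by (intro mult_left_mono) auto
    also have "\<dots> \<le> 1 / 128 * \<mu>"
      unfolding mult.assoc[of lam1] by (rule order_trans[OF lam1(2) mult_right_mono[OF p1(1)]]) (use \<mu> in simp)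
    finally show ?thesis using \<mu> by (simp add: divide_le_eq)
  qed
  have g4: "\<alpha>\<^sup>2 * M1 \<le> 1 / 144"
  proof -
    have "(\<alpha> * (12 * sqrt M1))\<^sup>2 \<le> 1\<^sup>2" using \<alpha>(1) pos M1 by (intro power_mono) auto
    then show ?thesis using M1 by (simp add: power_mult_distrib)
  qed
  have g5: "\<alpha> * (a * Lg\<^sup>2 * real T) / \<mu> \<le> 1 / 192"
  proof -
    have "\<alpha> * (192 * a * Lg\<^sup>2 * real T) \<le> \<alpha> * (192 * a * Lg\<^sup>2 * (1 + C3))"
      using pos a C3 T1 by (intro mult_left_mono) auto
    also have "\<dots> \<le> \<mu>" using \<alpha>(2) by (simp only: a_def mult.assoc)
    finally have "\<alpha> * (192 * a * Lg\<^sup>2 * real T) \<le> \<mu>" .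
    then show ?thesis using \<mu> by (simp add: divide_le_eq mult_ac)
  qed
  have g6: "\<alpha> * (b * M1 * real J) / \<mu> \<le> 1 / 192"
  proof -
    have "\<alpha> * (192 * b * M1 * real J) \<le> \<alpha> * (192 * b * M1 * (1 + (Lg / \<mu>)\<^sup>2 + real J))"
      using pos b M1 by (intro mult_left_mono) auto
    also have "\<dots> \<le> \<mu>" using \<alpha>(3) by (simp only: b_def mult.assoc)
    finally have "\<alpha> * (192 * b * M1 * real J) \<le> \<mu>" .
    then show ?thesis using \<mu> by (simp add: divide_le_eq mult_ac)
  qed
  \<comment> \<open>After factoring out \<alpha>, the bracket is at most 1/144 + 12/192 + 7/192,
    which is below 1/4; the three terms are bounded by the square-root condition and the bounds from
    C5 and C4.\<close>
  have "(\<alpha> + 12 * b * real J / \<mu>) * (M1 * \<alpha>\<^sup>2) + 7 * a * real T / \<mu> * (Lg\<^sup>2 * \<alpha>\<^sup>2)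
      = \<alpha> * (\<alpha>\<^sup>2 * M1 + 12 * (\<alpha> * (b * M1 * real J) / \<mu>) + 7 * (\<alpha> * (a * Lg\<^sup>2 * real T) / \<mu>))"
    by (simp add: power2_eq_square algebra_simps)
  also have "\<dots> \<le> \<alpha> * (1 / 4)" using g4 g5 g6 pos by (intro mult_left_mono) auto
  finally show "(\<alpha> + 12 * b * real J / \<mu>) * (M1 * \<alpha>\<^sup>2) + 7 * a * real T / \<mu> * (Lg\<^sup>2 * \<alpha>\<^sup>2) \<le> \<alpha> / 4" by simp
  have quarter: "x \<le> c / (4 * Lg)" if "x * Lg \<le> c * (1 / 4)" for x c :: real
    using that Lg by (simp add: field_simps)
  have m: "x * u \<le> c * (1 / 2)" if "x \<le> c" "0 \<le> u" "u \<le> 1 / 2" "0 \<le> c" for x u c :: real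
    by (rule order_trans[OF mult_right_mono[OF that(1,2)] mult_left_mono[OF that(3,4)]])
  \<comment> \<open>One factor a is kept outside and the other split into lam1 and \<beta>.
    Multiplication by Lg produces lam1 * Lg, at most 1/2, while \<beta> completes the expressions
    bounded in \<open>g1\<close>, \<open>g2\<close> and \<open>g3\<close>.\<close>
  have "((\<alpha> + 12 * b * real J / \<mu>) * (M1 * (a\<^sup>2 * real T)) + 7 * a * real T / \<mu> * (Lg\<^sup>2 * a\<^sup>2)) * Lg
      = a * (\<alpha> * (M1 * real T * \<beta>) * (lam1 * Lg) + 12 * (lam2 * (real J * (real T * M1 * \<beta> * \<eta>)) / \<mu> * (lam1 * Lg))
        + 7 * (lam1 * (real T * Lg\<^sup>2 * \<beta>\<^sup>2) / \<mu> * (lam1 * Lg)))"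
    by (simp add: a_def b_def power2_eq_square algebra_simps)
  also have "\<dots> \<le> a * (1 / 4)"
    using m[OF g1(1) l(1,2)] m[OF g2(2) l(1,2)] m[OF g3 l(1,2)] a by (intro mult_left_mono) auto
  finally show "(\<alpha> + 12 * b * real J / \<mu>) * (M1 * (a\<^sup>2 * real T)) + 7 * a * real T / \<mu> * (Lg\<^sup>2 * a\<^sup>2) \<le> a / (4 * Lg)"
    by (rule quarter)
  have "((\<alpha> + 12 * b * real J / \<mu>) * (2 * Lg\<^sup>2 * b\<^sup>2)) * Lg
      = b * (2 * (\<alpha> * (Lg\<^sup>2 * \<eta>) * (lam2 * Lg)) + 24 * (lam2 * (real J * (Lg\<^sup>2 * \<eta>\<^sup>2)) / \<mu> * (lam2 * Lg)))"
    by (simp add: b_def power2_eq_square algebra_simps)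
  also have "\<dots> \<le> b * (1 / 4)"
    using m[OF g1(2) l(3,4)] m[OF g2(1) l(3,4)] b by (intro mult_left_mono) auto
  finally show "(\<alpha> + 12 * b * real J / \<mu>) * (2 * Lg\<^sup>2 * b\<^sup>2) \<le> b / (4 * Lg)"
    by (rule quarter)
qed

text \<open>Since \<open>c / 0 = 0\<close>, positivity of the step size excludes vanishing denominators.\<close>

lemma le_divide_imp:
  fixes x :: real
  assumes "x \<le> c / d" "0 < x" "0 \<le> d"
  shows "x * d \<le> c"
  using assms by (cases "d = 0") (auto simp: pos_le_divide_eq)

theorem theorem1:
  fixes D\<^sub>\<xi> :: "'u measure" and D\<^sub>\<zeta> :: "'w measure"
    and F :: "'u \<Rightarrow> (real ^ 'p) \<times> (real ^ 'q) \<Rightarrow> real"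
    and G :: "'w \<Rightarrow> (real ^ 'p) \<times> (real ^ 'q) \<Rightarrow> real"
    and f g :: "(real ^ 'p) \<times> (real ^ 'q) \<Rightarrow> real"
    and \<Phi> :: "real ^ 'p \<Rightarrow> real"
    and \<mu> Cf Lf Lg Lgxy Lgyy \<sigma>f \<sigma>g \<sigma>gxy \<sigma>gyy :: real
    and M Lgg M1 Cy Cv L\<Phi> C3 \<beta> \<eta> :: real
    and T J :: nat
    and x0 :: "real ^ 'p" and y0 v0 :: "real ^ 'q"
  assumes "prob_space D\<^sub>\<xi>" and "prob_space D\<^sub>\<zeta>"
    and "\<And>z. integrable D\<^sub>\<xi> (\<lambda>\<xi>. F \<xi> z)" and "\<And>z. f z = (\<integral>\<xi>. F \<xi> z \<partial>D\<^sub>\<xi>)"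
    and "\<And>z. integrable D\<^sub>\<zeta> (\<lambda>\<zeta>. G \<zeta> z)" and "\<And>z. g z = (\<integral>\<zeta>. G \<zeta> z \<partial>D\<^sub>\<zeta>)"
    and "\<Phi> = hyperobjective f g"
    and "\<mu> > 0"
    and "smooth_pair \<mu> f g"
    and "\<And>\<xi> \<zeta>. \<xi> \<in> space D\<^sub>\<xi> \<Longrightarrow> \<zeta> \<in> space D\<^sub>\<zeta> \<Longrightarrow> smooth_pair \<mu> (F \<xi>) (G \<zeta>)"
    and "\<not> convex_on UNIV \<Phi>" and "bdd_below (range \<Phi>)"
    and "lipschitz_pair Cf Lf Lg Lgxy Lgyy f g"
    and "\<And>\<xi> \<zeta>. \<xi> \<in> space D\<^sub>\<xi> \<Longrightarrow> \<zeta> \<in> space D\<^sub>\<zeta> \<Longrightarrow>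
           lipschitz_pair Cf Lf Lg Lgxy Lgyy (F \<xi>) (G \<zeta>)"
    and "\<And>z. unbiased_estimate D\<^sub>\<xi> norm \<sigma>f (\<lambda>\<xi>. grad (F \<xi>) z) (grad f z)"
    and "\<And>z. unbiased_estimate D\<^sub>\<zeta> norm \<sigma>g (\<lambda>\<zeta>. grad (G \<zeta>) z) (grad g z)"
    and "\<And>z. unbiased_estimate D\<^sub>\<zeta> spectral_norm \<sigma>gxy (\<lambda>\<zeta>. hess_xy (G \<zeta>) z) (hess_xy g z)"
    and "\<And>z. unbiased_estimate D\<^sub>\<zeta> spectral_norm \<sigma>gyy (\<lambda>\<zeta>. hess_yy (G \<zeta>) z) (hess_yy g z)"
    and "M \<ge> Cf / \<mu>"
    and "Lgg = max Lgxy Lgyy"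
    and "M1 = 4 * Lf\<^sup>2 + 4 * M\<^sup>2 * Lgg\<^sup>2"
    and "Cy = Lg / \<mu>"
    and "Cv = (Lf / \<mu> + Cf * Lgg / \<mu>\<^sup>2) * (1 + Lg / \<mu>)"
    and "L\<Phi> = Lf + (2 * Lf * Lg + Cf * Lgg) / \<mu> + (Lf * Lg\<^sup>2 + 2 * Cf * Lg * Lgg) / \<mu>\<^sup>2
              + Cf * Lg\<^sup>2 * Lgg / \<mu> ^ 3"
    and "T > 0" and "J > 0"
    and "0 < \<beta>" and "\<beta> < 1" and "0 < \<eta>" and "\<eta> < 1"
    and "C3 = (real J)\<^sup>2 + (real J)\<^sup>2 * M\<^sup>2 + 2 * (real T)\<^sup>2"
    and "v0 \<in> cball 0 M"
  shows "\<exists>C. \<forall>K S1 S2 q1 r lam1 lam2 \<alpha> C4 C5 (P :: 's measure) smp.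
    K > 0 \<and> S1 > 0 \<and> q1 > 0 \<and> S2 = q1 \<and> r = real S2 / real q1 \<and>
    lam1 = Min {1 / (2 * Lg + 2 * \<mu>),
               (1/2) ^ (2 * T + 5) * \<mu> * r / (real T * Lg\<^sup>2 * \<beta>\<^sup>2 * C3)} \<and>
    lam2 = Min {1 / (2 * Lg + 2 * \<mu>),
               \<mu>\<^sup>2 * lam1 * \<beta> / (128 * M1 * real J * \<eta>),
               (1/2) ^ (2 * (T + J) + 6) * \<mu> * r
                 / (real J * (Lg\<^sup>2 * \<eta>\<^sup>2 + real T * M1 * \<beta> * \<eta>))} \<and>
    C4 = 192 * lam1 * \<beta> * Lg\<^sup>2 * (1 + C3 / r) \<and>
    C5 = 192 * lam2 * \<eta> * M1 * (1 + Cy\<^sup>2 + real J / r) \<and>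
    \<alpha> = Min {\<mu> * lam1 * \<beta> / (96 * Cy\<^sup>2 + 8 * M1),
              \<mu> * lam2 * \<eta> / (48 * (Lg\<^sup>2 + Cv\<^sup>2)),
              1 / (6 * L\<Phi>),
              sqrt r / (12 * sqrt M1),
              \<mu> / C4,
              \<mu> / C5,
              (1/2) ^ (2 * (T + J) + 3) * r / (M1 * real T * \<beta> + Lg\<^sup>2 * \<eta>)} \<and>
    lam1 > 0 \<and> lam2 > 0 \<and> \<alpha> > 0 \<and>
    iid_samples P D\<^sub>\<xi> D\<^sub>\<zeta> (drawn K T J q1 S1 S2) smp
    \<longrightarrow>
    (let p = \<lparr>als_T = T, als_J = J, als_q1 = q1, als_S1 = S1, als_S2 = S2,
              als_lam1 = lam1, als_lam2 = lam2, als_alpha = \<alpha>, als_beta = \<beta>, als_eta = \<eta>,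
              als_tau_x = 0, als_tau_y = 0, als_tau_v = 0, als_M = M\<rparr>;
         x = (\<lambda>k \<omega>. als_x p F G x0 y0 v0 (\<lambda>S i. smp (S, i) \<omega>) k)
     in (\<forall>k<K. integrable P (\<lambda>\<omega>. (norm (grad \<Phi> (x k \<omega>)))\<^sup>2)) \<and>
        (1 / real K) * (\<Sum>k<K. \<integral>\<omega>. (norm (grad \<Phi> (x k \<omega>)))\<^sup>2 \<partial>P)
          \<le> C * (1 / real K + 1 / real S1))"
proof -
  interpret pair: smooth_lipschitz_pair f g \<mu> Cf Lf Lg Lgxy Lgyy
    by (rule smooth_lipschitz_pair.intro[OF assms(9,13,8)])
  obtain B where B: "\<And>x. B \<le> \<Phi> x"
    using \<open>bdd_below (range \<Phi>)\<close> by (auto simp: bdd_below_def)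
  \<comment> \<open>These are the prescribed step sizes and constants with r = 1 substituted. They
    mention none of K, S1 and q1, so a constant built from them can be chosen before those are
    quantified.\<close>
  define l1 where "l1 = Min {1 / (2 * Lg + 2 * \<mu>), (1/2) ^ (2 * T + 5) * \<mu> * 1 / (real T * Lg\<^sup>2 * \<beta>\<^sup>2 * C3)}"
  define l2 where "l2 = Min {1 / (2 * Lg + 2 * \<mu>), \<mu>\<^sup>2 * l1 * \<beta> / (128 * M1 * real J * \<eta>),
    (1/2) ^ (2 * (T + J) + 6) * \<mu> * 1 / (real J * (Lg\<^sup>2 * \<eta>\<^sup>2 + real T * M1 * \<beta> * \<eta>))}"
  define c4 where "c4 = 192 * l1 * \<beta> * Lg\<^sup>2 * (1 + C3 / 1)"
  define c5 where "c5 = 192 * l2 * \<eta> * M1 * (1 + Cy\<^sup>2 + real J / 1)"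
  define al where "al = Min {\<mu> * l1 * \<beta> / (96 * Cy\<^sup>2 + 8 * M1), \<mu> * l2 * \<eta> / (48 * (Lg\<^sup>2 + Cv\<^sup>2)),
    1 / (6 * L\<Phi>), sqrt 1 / (12 * sqrt M1), \<mu> / c4, \<mu> / c5,
    (1/2) ^ (2 * (T + J) + 3) * 1 / (M1 * real T * \<beta> + Lg\<^sup>2 * \<eta>)}"
  define s where "s = (2 * (Cf + Lg * M))\<^sup>2"
  define n where "n = al * s + 7 * (l1 * \<beta>) * real T / \<mu> * \<sigma>g\<^sup>2 + 12 * (l2 * \<eta>) * real J / \<mu> * s"
  define d where "d = pair.lyapunov x0 y0 v0 - B"
  show ?thesis
  \<comment> \<open>Up to the factor 2 / al the bound is d / K + n / S1; the maximum of d and n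
    serves both terms.\<close>
  proof (rule exI[of _ "2 / al * max d n"], intro allI impI, elim conjE, goal_cases)
    case (1 K S1 S2 q1 r lam1 lam2 \<alpha> C4 C5 P smp)
    have r: "r = 1" using 1(3-5) by simp
    have e1: "lam1 = l1" using 1(6) unfolding r l1_def .
    have e2: "lam2 = l2" using 1(7) unfolding r e1 l2_def .
    have e4: "C4 = c4" using 1(8) unfolding r e1 c4_def .
    have e5: "C5 = c5" using 1(9) unfolding r e2 c5_def .
    have e: "\<alpha> = al" using 1(10) unfolding r e1 e2 e4 e5 al_def .
    have pos: "l1 > 0" "l2 > 0" "al > 0" using 1(11-13) unfolding e1 e2 e .
    have M1: "M1 \<ge> 0" using assms(21) by simp
    have Lg: "Lg > 0" "\<mu> \<le> Lg" using pair.Lg_pos pair.mu_le_Lg by auto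
    have C3: "2 * real T \<le> C3"
    proof -
      have "real T \<le> (real T)\<^sup>2" using \<open>T > 0\<close> by (simp add: power2_eq_square)
      moreover have "0 \<le> (real J)\<^sup>2 + (real J)\<^sup>2 * M\<^sup>2" by simp
      ultimately show ?thesis unfolding assms(31) by linarith
    qed
    have L\<Phi>: "L\<Phi> = pair.L\<Phi>" unfolding assms(24) pair.L\<Phi>_def assms(20) ..
    have L\<Phi>0: "L\<Phi> \<ge> 0"
      using lipschitz_on_nonneg[OF pair.grad_Phi_lipschitz] unfolding L\<Phi> pair.L\<Phi>_def .
    have Cy: "Cy = Lg / \<mu>" by (rule assms(22))
    note bs = \<open>0 < \<beta>\<close> \<open>\<beta> < 1\<close> \<open>0 < \<eta>\<close> \<open>\<eta> < 1\<close> \<open>0 < \<mu>\<close>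
    have l1: "l1 * (2 * Lg + 2 * \<mu>) \<le> 1" "l1 * (real T * Lg\<^sup>2 * \<beta>\<^sup>2 * C3) \<le> (1/2) ^ (2 * T + 5) * \<mu>"
      by (rule le_divide_imp[OF _ pos(1)]; use C3 Lg bs in \<open>simp add: l1_def\<close>)+
    have l2: "l2 * (2 * Lg + 2 * \<mu>) \<le> 1" "l2 * (128 * M1 * real J * \<eta>) \<le> \<mu>\<^sup>2 * l1 * \<beta>"
      "l2 * (real J * (Lg\<^sup>2 * \<eta>\<^sup>2 + real T * M1 * \<beta> * \<eta>)) \<le> (1/2) ^ (2 * (T + J) + 6) * \<mu>"
      by (rule le_divide_imp[OF _ pos(2)]; use M1 Lg bs in \<open>simp add: l2_def\<close>)+
    have c: "c4 \<ge> 0" "c5 \<ge> 0" using pos M1 bs C3 by (simp_all add: c4_def c5_def)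
    have le: "al \<le> \<mu> * l1 * \<beta> / (96 * Cy\<^sup>2 + 8 * M1)" "al \<le> \<mu> * l2 * \<eta> / (48 * (Lg\<^sup>2 + Cv\<^sup>2))"
      "al \<le> 1 / (6 * L\<Phi>)" "al \<le> sqrt 1 / (12 * sqrt M1)" "al \<le> \<mu> / c4" "al \<le> \<mu> / c5"
      "al \<le> (1/2) ^ (2 * (T + J) + 3) * 1 / (M1 * real T * \<beta> + Lg\<^sup>2 * \<eta>)"
      unfolding al_def by (rule Min_le, simp only: finite_insert finite.emptyI, blast)+
    have "0 \<le> 96 * Cy\<^sup>2 + 8 * M1" "0 \<le> 48 * (Lg\<^sup>2 + Cv\<^sup>2)" "0 \<le> 6 * L\<Phi>" "0 \<le> 12 * sqrt M1"
      "0 \<le> M1 * real T * \<beta> + Lg\<^sup>2 * \<eta>" using M1 bs L\<Phi>0 by simp_all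
    note al = le_divide_imp[OF le(1) pos(3) this(1)] le_divide_imp[OF le(2) pos(3) this(2)]
      le_divide_imp[OF le(3) pos(3) this(3)] le_divide_imp[OF le(4)[unfolded real_sqrt_one] pos(3) this(4)]
      le_divide_imp[OF le(5) pos(3) c(1)] le_divide_imp[OF le(6) pos(3) c(2)]
      le_divide_imp[OF le(7)[unfolded mult_1_right] pos(3) this(5)]
    note cond = step_size_conditions[OF \<open>0 < \<mu>\<close> Lg(2) M1 \<open>T > 0\<close> \<open>J > 0\<close> C3 bs(1-4) pos l1 l2(1,3) al(4)
        al(5)[unfolded c4_def div_by_1] al(6)[unfolded c5_def Cy div_by_1] al(7)]
    have iid: "iid_samples P D\<^sub>\<xi> D\<^sub>\<zeta> (drawn K T J q1 S1 q1) smp" and gt: "K > 0" "S1 > 0" "q1 > 0"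
      using 1(1-4,14) by simp_all
    have prob_P: "prob_space P" using iid by (simp add: iid_samples_def)
    interpret run: als_run f g \<mu> Cf Lf Lg Lgxy Lgyy P D\<^sub>\<xi> D\<^sub>\<zeta> smp K T J q1 S1 F G \<sigma>g M l1 l2 al \<beta> \<eta> x0 y0 v0
    proof (intro als_run.intro pair.smooth_lipschitz_pair_axioms iid_family.intro iid_family_axioms.intro als_run_axioms.intro)
      show "prob_space P" by (rule prob_P)
      show "prob_space (D\<^sub>\<xi> \<Otimes>\<^sub>M D\<^sub>\<zeta>)" using assms(1,2) by (rule prob_space_pair)
      show "prob_space.indep_vars P (\<lambda>_. D\<^sub>\<xi> \<Otimes>\<^sub>M D\<^sub>\<zeta>) smp (drawn K T J q1 S1 q1)"
        "\<And>i. i \<in> drawn K T J q1 S1 q1 \<Longrightarrow> distr P (D\<^sub>\<xi> \<Otimes>\<^sub>M D\<^sub>\<zeta>) (smp i) = D\<^sub>\<xi> \<Otimes>\<^sub>M D\<^sub>\<zeta>"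
        using iid by (auto simp: iid_samples_def)
      show "smooth_lipschitz_pair (F \<xi>) (G \<zeta>) \<mu> Cf Lf Lg Lgxy Lgyy"
        if "\<xi> \<in> space D\<^sub>\<xi>" "\<zeta> \<in> space D\<^sub>\<zeta>" for \<xi> \<zeta>
        by (rule smooth_lipschitz_pair.intro[OF assms(10)[OF that] assms(14)[OF that] assms(8)])
    qed (use assms(1,2,15-19,25-27,29,32) gt pos in \<open>simp_all add: unbiased_estimate_def\<close>)
    have M1': "run.M1 = M1" by (simp add: run.M1_def assms(21) assms(20))
    have n: "run.noise_const = n" by (simp add: run.noise_const_def run.dir_var_def n_def s_def)
    have Cv: "Cv = (Lf / \<mu> + Cf * max Lgxy Lgyy / \<mu>\<^sup>2) * (1 + Lg / \<mu>)" unfolding assms(23) assms(20) ..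
    have conds: "al * pair.L\<Phi> \<le> 1 / 6" "128 * (l2 * \<eta> * run.M1 * real J) \<le> l1 * \<beta> * \<mu>\<^sup>2"
      "al * (8 * run.M1) \<le> l1 * \<beta> * \<mu>" "al * (48 * Lg\<^sup>2) \<le> l2 * \<eta> * \<mu>"
      "al * (96 * (Lg / \<mu>)\<^sup>2) \<le> l1 * \<beta> * \<mu>" "al * (48 * Cv\<^sup>2) \<le> l2 * \<eta> * \<mu>"
    proof -
      \<comment> \<open>The first two entries of the minimum defining \<open>al\<close> have a sum
        in the denominator; as the summands are nonnegative, each satisfies the bound on its
        own.\<close>
      have "al * (96 * Cy\<^sup>2) \<ge> 0" "al * (8 * M1) \<ge> 0" "al * (48 * Lg\<^sup>2) \<ge> 0" "al * (48 * Cv\<^sup>2) \<ge> 0"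
        using pos M1 by auto
      moreover have "al * (96 * Cy\<^sup>2) + al * (8 * M1) \<le> l1 * \<beta> * \<mu>" "al * (48 * Lg\<^sup>2) + al * (48 * Cv\<^sup>2) \<le> l2 * \<eta> * \<mu>"
        using al(1,2) by (simp_all add: algebra_simps)
      ultimately show "al * (8 * run.M1) \<le> l1 * \<beta> * \<mu>" "al * (48 * Lg\<^sup>2) \<le> l2 * \<eta> * \<mu>"
        "al * (96 * (Lg / \<mu>)\<^sup>2) \<le> l1 * \<beta> * \<mu>" "al * (48 * Cv\<^sup>2) \<le> l2 * \<eta> * \<mu>"
        unfolding M1' Cy[symmetric] by linarith+
      show "al * pair.L\<Phi> \<le> 1 / 6" using al(3) unfolding L\<Phi> by simp
      show "128 * (l2 * \<eta> * run.M1 * real J) \<le> l1 * \<beta> * \<mu>\<^sup>2" using l2(2) unfolding M1' by (simp add: mult_ac)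
    qed
    have "(1 / real K) * (\<Sum>k<K. \<integral>\<omega>. (norm (grad \<Phi> (run.X k \<omega>)))\<^sup>2 \<partial>P)
        \<le> 2 / al * (d * (1 / real K) + n * (1 / real S1))"
      unfolding d_def n[symmetric] assms(7)
      by (rule run.gradient_norm_bound[OF B[unfolded assms(7)] gt(1) cond(1,2) conds(1-5) conds(6)[unfolded Cv]
        cond(3-5)[folded M1']])
    also have "\<dots> \<le> 2 / al * (max d n * (1 / real K) + max d n * (1 / real S1))"
      using pos by (intro mult_left_mono add_mono mult_right_mono) auto
    finally have bound: "(1 / real K) * (\<Sum>k<K. \<integral>\<omega>. (norm (grad \<Phi> (run.X k \<omega>)))\<^sup>2 \<partial>P)
        \<le> 2 / al * max d n * (1 / real K + 1 / real S1)"
      by (simp only: distrib_left mult.assoc)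
    have x: "als_x \<lparr>als_T = T, als_J = J, als_q1 = q1, als_S1 = S1, als_S2 = q1, als_lam1 = l1, als_lam2 = l2,
        als_alpha = al, als_beta = \<beta>, als_eta = \<eta>, als_tau_x = 0, als_tau_y = 0, als_tau_v = 0, als_M = M\<rparr>
        F G x0 y0 v0 (\<lambda>S i. smp (S, i) \<omega>) k = run.X k \<omega>" for k \<omega>
      by (simp add: als_x_def run.X_def run.state_def run.params_def)
    have int: "integrable P (\<lambda>\<omega>. (norm (grad \<Phi> (run.X k \<omega>)))\<^sup>2)" if "k < K" for k
      unfolding assms(7) by (rule run.grad_Phi_integrable) (use that in simp)
    show ?case unfolding e1 e2 e 1(4) Let_def x using bound int by blast
  qed
qed

end
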